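(* Suppose that the standing assumption (i)–(iii) of the context holds, with constants $L_f,L_{\nabla f},C,\theta,\gamma,\sigma$. Let $\epsilon\in(0,1/e]$, let $\rho,\overline\lambda,\underline\lambda$ be as in Algorithm 2 (described in the context), let $\widehat K_\epsilon$ be as defined in the context, and set $$\underline{\beta_f}=\frac{C^2}{2\overline\lambda}(L_{\nabla f}+\underline\lambda^{-1})^{-2},\qquad \overline{\beta_f}=\frac{C^2}{2\underline\lambda}(L_{\nabla f}+\overline\lambda^{-1})^{-2},$$ $$C_f'=\min\Big\{\frac12,\frac{(2^{\frac{2\theta-1}{2\theta}}-1)(\gamma\epsilon^\sigma)^{1-2\theta}}{(2\theta-1)\overline{\beta_f}}\Big\}\ \text{(used only for }\theta>1/2),\qquad \Lambda=\max\Big\{(\tfrac12\gamma\epsilon^\sigma)^{-2\theta},(\widehat K_\epsilon+1)^{\frac\theta{1-\theta}}\Big\},$$ $$\overline K_{f,\theta}=\begin{cases}\Big\lceil\frac{1+\underline{\beta_f}}{\underline{\beta_f}}\log\big(2\overline\lambda C^{-2}(L_{\nabla f}+\underline\lambda^{-1})^2\gamma\epsilon^\sigma\Lambda\big)\Big\rceil_+ +1&\text{if }\theta=\frac12,\\[1ex]\Big\lceil\frac1{C_f'(2\theta-1)\underline{\beta_f}}\big(2\overline\lambda C^{-2}(L_{\nabla f}+\underline\lambda^{-1})^2\Lambda\big)^{2\theta-1}\Big\rceil+1&\text{if }\theta\in(\frac12,1),\end{cases}$$ $$\widehat N_\epsilon=\widehat K_\epsilon\Big(\Big\lceil\frac{\log(2L_{\nabla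 f}\overline\lambda)}{\log\rho^{-1}}\Big\rceil_+ +1\Big)\overline K_{f,\theta}.$$ Then the total numbers of evaluations of the proximal operator of $p$, of the proximal operator of $q$, and of the gradient $\nabla f$ performed by Algorithm 2 are at most $\widehat K_\epsilon$, $\widehat N_\epsilon$, and $\widehat K_\epsilon+\widehat N_\epsilon$, respectively, to generate a pair $(x^k,y^k)$ such that $x^k$ is a $(\gamma\epsilon^\sigma/(4L_f),\epsilon)$-stationary point of the problem $\min_x\Psi(x)$, and $y^k$ satisfies $$F^*(x^k)-F(x^k,y^k)\le\min\Big\{\frac{\gamma\epsilon^\sigma}{2},\frac1{k+1}\Big\},\qquad \operatorname{dist}\big(y^k,Y^*(x^k)\big)\le\frac1{C(1-\theta)}\min\Big\{\Big(\frac\gamma2\Big)^{1-\theta}\epsilon^{\sigma(1-\theta)},\frac1{\sqrt{k+1}}\Big\}.$$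
   Context: Problem: $\min_x\max_y\{f(x,y)+p(x)-q(y)\}$, where $f:\mathbb{R}^n\times\mathbb{R}^m\to\mathbb{R}$ is a smooth function, $p:\mathbb{R}^n\to\mathbb{R}\cup\{+\infty\}$, $q:\mathbb{R}^m\to\mathbb{R}\cup\{+\infty\}$. $\|\cdot\|$ is the Euclidean norm, $\mathcal{B}(x,r)$ the closed ball of center $x$ and radius $r$. Notation: $\mathcal{X}=\operatorname{dom}p$, $\mathcal{Y}=\operatorname{dom}q$, $F(x,y)=f(x,y)-q(y)$, $F^*(x)=\max_yF(x,y)$, $Y^*(x)=\{y:F(x,y)=F^*(x)\}$, $\Psi(x)=F^*(x)+p(x)$, $\Psi^*=\min_x\Psi(x)$. $L$-smooth on a set means that the gradient is $L$-Lipschitz there. $\lceil t\rceil_+=\max\{\lceil t\rceil,0\}$. $\partial$ denotes the limiting subdifferential: for proper closed $\phi$ and $x\in\operatorname{dom}\phi$, $v\in\partial\phi(x)$ iff there are $x^k\to x$ with $\phi(x^k)\to\phi(x)$ and $v^k\to v$ with $\liminf_{z\to x^k,z\ne x^k}\frac{\phi(z)-\phi(x^k)-\langle v^k,z-x^k\rangle}{\|z-x^k\|}\ge0$ for all $k$. $\partial_yF(x,y)$ means $\nabla_yf(x,y)-\partial q(y)$. $\operatorname{dist}(0,\emptyset)=+\infty$. Standing assumption: (i) For each fixed $y\in\mathcal{Y}$, $f(\cdot,y)$ is $L_f$-Lipschitz continuous on $\mathcal{X}$; moreover $f$ is $L_{\nabla f}$-smooth on $\mathcal{X}\times\mathcal{Y}$.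 (ii) $p$ and $q$ are proper closed convex (with exactly computable proximal operators), and the affine hull of $\mathcal{X}$ is $\mathbb{R}^n$. (iii) For each $x\in\mathcal{X}$, $\max_yF(x,y)$ has a nonempty solution set and finite optimal value, and there are constants $C>0$, $\theta\in[1/2,1)$, $\gamma>0$, $\sigma>0$ such that for any $x\in\mathcal{X}$, $C(F^*(x)-F(x,y))^\theta\le\operatorname{dist}(0,\partial_yF(x,y))$ for all $y\in\mathcal{L}(x)$, where $\mathcal{L}(x)=\{y:0<F^*(x)-F(x,y)\le\gamma\operatorname{dist}(0,\partial\Psi(x))^\sigma\}$. Stationarity: for proper closed $\phi$, $\epsilon>0$, $r\ge0$, a point $\bar x$ is an $(r,\epsilon)$-stationary point of $\min_x\phi(x)$ if $\bar x\in\operatorname{dom}\phi$ and $\operatorname{dist}(\bar x,\mathscr S_\epsilon)\le r$, where $\mathscr S_\epsilon=\{x:\operatorname{dist}(0,\partial\phi(x))\le\epsilon\}$. (The minimax problem is identified with $\min_x\Psi(x)$.) Algorithm 1 (proximal gradient subroutine for $\min_z h(z)=g(z)+q(z)$; inputs $z^0$, $\overline\lambda>0$, $\rho\in(0,1)$, $\tau>0$): for $k=0,1,2,\dots$: for $i=0,1,2,\dots$ set $\lambda_{k,i}=\overline\lambda\rho^i$, $z^{k+1,i}=\arg\min_z\{\langle\nabla g(z^k),z\rangle+\frac1{2\lambda_{k,i}}\|z-z^k\|^2+q(z)\}$ (one evaluation of the proximal operator of $q$); at the first $i$ with $h(z^{k+1,i})+\frac1{2\lambda_{k,i}}\|z^{k+1,i}-z^k\|^2\le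 h(z^k)$ set $z^{k+1}=z^{k+1,i}$, $\lambda_k=\lambda_{k,i}$ and leave the inner loop; if $\|z^{k+1}-z^k\|\le\tau$, return $z^{k+1}$. Algorithm 2 (inexact proximal gradient method). Inputs: $L_f,L_{\nabla f},C,\theta,\gamma,\sigma$ from the standing assumption; $\epsilon>0$, $\overline\lambda>0$, $\rho\in(0,1)$, and $(x^0,y^0)\in\mathcal{X}\times\mathcal{Y}$ with $F^*(x^0)-F(x^0,y^0)\le\min\{\gamma\epsilon^\sigma/2,1\}$. Set $r=\gamma\epsilon^\sigma/(4L_f)$, $\underline\lambda=\min\{\rho/L_{\nabla f},\overline\lambda\}$, $M=(1-\theta)^{-1}C^{-1/\theta}L_{\nabla f}^{1/\theta}$, $\nu=\theta^{-1}(1-\theta)$. For $k=0,1,2,\dots$: set $\delta_k=\eta_k=1/(k+1)$ and $L_k=L_{\nabla f}+\delta_k^{(\nu-1)/(1+\nu)}M^{2/(1+\nu)}$; compute $x^{k+1}=\arg\min_{x\in\mathcal{B}(x^k,r)}\{\langle\nabla_xf(x^k,y^k),x\rangle+\frac{L_k}2\|x-x^k\|^2+p(x)\}$ (counted as one evaluation of the proximal operator of $p$); let $y^{k+1}$ be the output of Algorithm 1 applied with $g(\cdot)=-f(x^{k+1},\cdot)$, the function $q$, parameters $\overline\lambda,\rho$, initial point $z^0=y^k$, and $\tau=\frac{C}{L_{\nabla f}+\underline\lambda^{-1}}\min\{(\frac12\gamma\epsilon^\sigma)^\theta,\eta_{k+1}^{\theta/(2(1-\theta))}\}$. Definition of $\widehat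 K_\epsilon$: with $A=(1-\theta)^{-2}C^{-2}L_{\nabla f}^2$, $\underline L=L_{\nabla f}+M^{2/(1+\nu)}$, $a=8(\Psi(x^0)-\Psi^*+3+2A\underline L^{-1})$, $b=8(3/2+A\underline L^{-1})$, let $\widehat C_1=\big(36(1+\nu)\nu^{-1}b\underline L\lceil\log(18(1+\nu)\nu^{-1}b\underline L)\rceil_+ +72(1+\nu)\nu^{-1}b\underline L+1\big)^{\frac{1+\nu}{2\nu}}$, $\widehat C_2=\Big(\frac{4b(1+\nu)(3M)^{2/\nu}}{M^{2/(1+\nu)}}\Big\lceil\log\Big(\frac{2b(1+\nu)(3M)^{2/\nu}}{M^{2/(1+\nu)}}\Big)\Big\rceil_+ +\frac{8b(1+\nu)(3M)^{2/\nu}}{\nu M^{2/(1+\nu)}}+1\Big)^{\frac{1+\nu}2}$, $\widehat C_3=(36\underline La)^{\frac{1+\nu}{2\nu}}+M^{-1}(4a(3M)^{2/\nu})^{\frac{1+\nu}2}$, $\widehat C_4=72A$, $\widehat C_5=\Big(\frac{144(1+\nu)bL_{\nabla f}^2}{M^{2/(1+\nu)}}\Big\lceil\log\Big(\frac{72(1+\nu)bL_{\nabla f}^2}{M^{2/(1+\nu)}}\Big)\Big\rceil_+ +\frac{288(1+\nu)bL_{\nabla f}^2}{M^{2/(1+\nu)}}+1\Big)^{\frac{1+\nu}2}$, $\widehat C_6=(144aL_{\nabla f}^2)^{\frac{1+\nu}2}/M$, $\widehat C_7=\Big(\frac{64(1+\nu)bL_f^2}{\gamma^2M^{2/(1+\nu)}}\Big\lceil\log\Big(\frac{32(1+\nu)bL_f^2}{\gamma^2M^{2/(1+\nu)}}\Big)\Big\rceil_+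 +\frac{128\sigma(1+\nu)bL_f^2}{\gamma^2M^{2/(1+\nu)}}+1\Big)^{\frac{1+\nu}2}$, $\widehat C_8=(64aL_f^2)^{\frac{1+\nu}2}/(\gamma^{1+\nu}M)$, and $\widehat K_\epsilon=\Big\lceil\widehat C_1\epsilon^{-\frac{1+\nu}\nu}(\log\epsilon^{-1})^{\frac{1+\nu}{2\nu}}+\widehat C_2\epsilon^{-\frac{1+\nu}\nu}(\log\epsilon^{-1})^{\frac{1+\nu}2}+\widehat C_3\epsilon^{-\frac{1+\nu}\nu}+\widehat C_4\epsilon^{-2}+\widehat C_5\epsilon^{-(1+\nu)}(\log\epsilon^{-1})^{\frac{1+\nu}2}+\widehat C_6\epsilon^{-(1+\nu)}+\widehat C_7\epsilon^{-(1+\nu)\sigma}(\log\epsilon^{-1})^{\frac{1+\nu}2}+\widehat C_8\epsilon^{-(1+\nu)\sigma}\Big\rceil$.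
   Formalization: The bound on dist(y^k,Y*(x^k)) is not claimed when k=0 and y^0 lies outside L(x^0) and Y*(x^0), which needs dist(0,∂Ψ(x^0))<ε; there the original fails, e.g. f=cos(y)/2, p=q=0, y^0=π. *)

theory Defs
  imports "HOL-Analysis.Analysis"
begin

section \<open>Extended-real-valued functions\<close>

definition edom :: "('a \<Rightarrow> ereal) \<Rightarrow> 'a set" where
  "edom \<phi> = {x. \<phi> x < \<infinity>}"

definition epi :: "('a \<Rightarrow> ereal) \<Rightarrow> ('a \<times> real) set" where
  "epi \<phi> = {(x, t). \<phi> x \<le> ereal t}"

definition proper_closed_convex :: "('a::euclidean_space \<Rightarrow> ereal) \<Rightarrow> bool" where
  "proper_closed_convex \<phi> \<longleftrightarrow>
     (\<forall>x. \<phi> x \<noteq> -\<infinity>) \<and> edom \<phi> \<noteq> {} \<and> closed (epi \<phi>) \<and> convex (epi \<phi>)"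

text \<open>Distance to a set with value \<open>\<infinity>\<close> at the empty set; the library's \<^const>\<open>infdist\<close>
  takes the value \<open>0\<close> there.\<close>

definition edist :: "'a::metric_space \<Rightarrow> 'a set \<Rightarrow> ereal" where
  "edist x S = (INF s\<in>S. ereal (dist x s))"

text \<open>Powers with a positive exponent of a number in \<open>[0, \<infinity>]\<close>.\<close>

definition epow :: "ereal \<Rightarrow> real \<Rightarrow> ereal" where
  "epow t a = (if t = \<infinity> then \<infinity> else ereal (real_of_ereal t powr a))"

definition frechet_subdiff :: "('a::euclidean_space \<Rightarrow> ereal) \<Rightarrow> 'a \<Rightarrow> 'a set" where
  "frechet_subdiff \<phi> x = {v. x \<in> edom \<phi> \<and>
     0 \<le> Liminf (at x) (\<lambda>z. (\<phi> z - \<phi> x - ereal (v \<bullet> (z - x))) / ereal (norm (z - x)))}"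

definition lim_subdiff :: "('a::euclidean_space \<Rightarrow> ereal) \<Rightarrow> 'a \<Rightarrow> 'a set" where
  "lim_subdiff \<phi> x = {v. x \<in> edom \<phi> \<and>
     (\<exists>xs vs. xs \<longlonglongrightarrow> x \<and> (\<lambda>k. \<phi> (xs k)) \<longlonglongrightarrow> \<phi> x \<and> vs \<longlonglongrightarrow> v \<and>
        (\<forall>k. vs k \<in> frechet_subdiff \<phi> (xs k)))}"

definition stationary_point :: "('a::euclidean_space \<Rightarrow> ereal) \<Rightarrow> real \<Rightarrow> real \<Rightarrow> 'a \<Rightarrow> bool" where
  "stationary_point \<phi> r \<epsilon> x \<longleftrightarrow>
     x \<in> edom \<phi> \<and> edist x {u. edist 0 (lim_subdiff \<phi> u) \<le> ereal \<epsilon>} \<le> ereal r"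

definition grad :: "('a::euclidean_space \<Rightarrow> real) \<Rightarrow> 'a \<Rightarrow> 'a" where
  "grad f z = (THE D. GDERIV f z :> D)"

section \<open>The minimax problem\<close>

definition Fobj :: "('a \<times> 'b \<Rightarrow> real) \<Rightarrow> ('b \<Rightarrow> ereal) \<Rightarrow> 'a \<Rightarrow> 'b \<Rightarrow> ereal" where
  "Fobj f q x y = ereal (f (x, y)) - q y"

definition Fmax :: "('a \<times> 'b \<Rightarrow> real) \<Rightarrow> ('b \<Rightarrow> ereal) \<Rightarrow> 'a \<Rightarrow> ereal" where
  "Fmax f q x = (SUP y. Fobj f q x y)"

definition Ymax :: "('a \<times> 'b \<Rightarrow> real) \<Rightarrow> ('b \<Rightarrow> ereal) \<Rightarrow> 'a \<Rightarrow> 'b set" where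
  "Ymax f q x = {y. Fobj f q x y = Fmax f q x}"

definition Psi ::
  "('a \<times> 'b \<Rightarrow> real) \<Rightarrow> ('a \<Rightarrow> ereal) \<Rightarrow> ('b \<Rightarrow> ereal) \<Rightarrow> 'a \<Rightarrow> ereal" where
  "Psi f p q x = Fmax f q x + p x"

definition Psi_min ::
  "('a \<times> 'b \<Rightarrow> real) \<Rightarrow> ('a \<Rightarrow> ereal) \<Rightarrow> ('b \<Rightarrow> ereal) \<Rightarrow> ereal" where
  "Psi_min f p q = (INF x. Psi f p q x)"

definition subdiff_y ::
  "('a \<times> 'b::euclidean_space \<Rightarrow> real) \<Rightarrow> ('b \<Rightarrow> ereal) \<Rightarrow> 'a \<Rightarrow> 'b \<Rightarrow> 'b set" where
  "subdiff_y f q x y = (\<lambda>v. grad (\<lambda>u. f (x, u)) y - v) ` lim_subdiff q y"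

text \<open>If \<open>0\<close> is a subgradient of \<open>Psi\<close> at \<open>x\<close>, this region is empty: the error bound assumed on it
  then says nothing at \<open>x\<close>. E.g. for \<open>f (x, y) = cos y / 2\<close> and \<open>p = q = 0\<close> it is empty everywhere, and
  the method started at \<open>y0 = pi\<close> never moves \<open>y\<close>. Hence no bound on the distance of \<open>y0\<close> to \<open>Ymax\<close> can
  be expected for the initial pair unless \<open>y0\<close> is in the region or optimal; when \<open>x0\<close> is not
  \<open>\<epsilon>\<close>-stationary, the initial accuracy requirement ensures this.\<close>

definition KL_region ::
  "('a::euclidean_space \<times> 'b \<Rightarrow> real) \<Rightarrow> ('a \<Rightarrow> ereal) \<Rightarrow> ('b \<Rightarrow> ereal) \<Rightarrow> real \<Rightarrow> real \<Rightarrow>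
     'a \<Rightarrow> 'b set" where
  "KL_region f p q \<gamma> \<sigma> x = {y. 0 < Fmax f q x - Fobj f q x y \<and>
     Fmax f q x - Fobj f q x y \<le> ereal \<gamma> * epow (edist 0 (lim_subdiff (Psi f p q) x)) \<sigma>}"

text \<open>The gradient of \<open>f\<close> is continuous everywhere, but its Lipschitz continuity is required only on
  \<open>edom p \<times> edom q\<close>. The constants \<open>Lf\<close> and \<open>Lg\<close> are positive because they occur as divisors in the
  algorithm.\<close>

definition standing_assumption ::
  "('a::euclidean_space \<times> 'b::euclidean_space \<Rightarrow> real) \<Rightarrow> ('a \<Rightarrow> ereal) \<Rightarrow> ('b \<Rightarrow> ereal) \<Rightarrow>
     real \<Rightarrow> real \<Rightarrow> real \<Rightarrow> real \<Rightarrow> real \<Rightarrow> real \<Rightarrow> bool" where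
  "standing_assumption f p q Lf Lg C \<theta> \<gamma> \<sigma> \<longleftrightarrow>
     f differentiable_on UNIV \<and> continuous_on UNIV (grad f) \<and>
     0 < Lf \<and> (\<forall>y\<in>edom q. Lf-lipschitz_on (edom p) (\<lambda>x. f (x, y))) \<and>
     0 < Lg \<and> Lg-lipschitz_on (edom p \<times> edom q) (grad f) \<and>
     proper_closed_convex p \<and> proper_closed_convex q \<and> affine hull (edom p) = UNIV \<and>
     (\<forall>x\<in>edom p. Ymax f q x \<noteq> {} \<and> \<bar>Fmax f q x\<bar> \<noteq> \<infinity>) \<and>
     0 < C \<and> 1/2 \<le> \<theta> \<and> \<theta> < 1 \<and> 0 < \<gamma> \<and> 0 < \<sigma> \<and>
     (\<forall>x\<in>edom p. \<forall>y\<in>KL_region f p q \<gamma> \<sigma> x.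
        ereal C * epow (Fmax f q x - Fobj f q x y) \<theta> \<le> edist 0 (subdiff_y f q x y))"

section \<open>Proximal gradient subroutine\<close>

definition pg_trial ::
  "('b::euclidean_space \<Rightarrow> real) \<Rightarrow> ('b \<Rightarrow> ereal) \<Rightarrow> real \<Rightarrow> 'b \<Rightarrow> 'b" where
  "pg_trial g q lam z =
     arg_min (\<lambda>w. ereal (grad g z \<bullet> w + (norm (w - z))\<^sup>2 / (2 * lam)) + q w) (\<lambda>w. True)"

definition pg_accept ::
  "('b::euclidean_space \<Rightarrow> real) \<Rightarrow> ('b \<Rightarrow> ereal) \<Rightarrow> real \<Rightarrow> 'b \<Rightarrow> bool" where
  "pg_accept g q lam z \<longleftrightarrow>
     (let w = pg_trial g q lam z in
       ereal (g w) + q w + ereal ((norm (w - z))\<^sup>2 / (2 * lam)) \<le> ereal (g z) + q z)"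

definition pg_step ::
  "('b::euclidean_space \<Rightarrow> real) \<Rightarrow> ('b \<Rightarrow> ereal) \<Rightarrow> real \<Rightarrow> real \<Rightarrow> 'b \<Rightarrow> nat \<Rightarrow> 'b \<Rightarrow> bool" where
  "pg_step g q lam \<rho> z i w \<longleftrightarrow>
     pg_accept g q (lam * \<rho> ^ i) z \<and> (\<forall>j<i. \<not> pg_accept g q (lam * \<rho> ^ j) z) \<and>
     w = pg_trial g q (lam * \<rho> ^ i) z"

text \<open>\<open>pg_run g q lam \<rho> \<tau> z w N G\<close>: the subroutine started at \<open>z\<close> terminates and returns \<open>w\<close>, having
  used \<open>N\<close> evaluations of the proximal operator of \<open>q\<close> (one per trial step size) and \<open>G\<close> evaluations
  of the gradient of \<open>g\<close> (one per iteration, as it does not depend on the trial step size).\<close>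

inductive pg_run ::
  "('b::euclidean_space \<Rightarrow> real) \<Rightarrow> ('b \<Rightarrow> ereal) \<Rightarrow> real \<Rightarrow> real \<Rightarrow> real \<Rightarrow>
     'b \<Rightarrow> 'b \<Rightarrow> nat \<Rightarrow> nat \<Rightarrow> bool"
  for g q lam \<rho> \<tau> where
  stop: "pg_step g q lam \<rho> z i w \<Longrightarrow> norm (w - z) \<le> \<tau> \<Longrightarrow> pg_run g q lam \<rho> \<tau> z w (i + 1) 1"
| step: "pg_step g q lam \<rho> z i z' \<Longrightarrow> \<not> norm (z' - z) \<le> \<tau> \<Longrightarrow> pg_run g q lam \<rho> \<tau> z' w N G \<Longrightarrow>
           pg_run g q lam \<rho> \<tau> z w (i + 1 + N) (1 + G)"

section \<open>Inexact proximal gradient method\<close>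

definition nu_const :: "real \<Rightarrow> real" where
  "nu_const \<theta> = (1 - \<theta>) / \<theta>"

definition M_const :: "real \<Rightarrow> real \<Rightarrow> real \<Rightarrow> real" where
  "M_const Lg C \<theta> = inverse (1 - \<theta>) * C powr (- 1 / \<theta>) * Lg powr (1 / \<theta>)"

definition radius :: "real \<Rightarrow> real \<Rightarrow> real \<Rightarrow> real \<Rightarrow> real" where
  "radius Lf \<gamma> \<sigma> \<epsilon> = \<gamma> * \<epsilon> powr \<sigma> / (4 * Lf)"

definition lam_low :: "real \<Rightarrow> real \<Rightarrow> real \<Rightarrow> real" where
  "lam_low Lg lam \<rho> = min (\<rho> / Lg) lam"

definition delta :: "nat \<Rightarrow> real" where
  "delta k = 1 / (real k + 1)"

definition eta :: "nat \<Rightarrow> real" where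
  "eta k = 1 / (real k + 1)"

definition L_seq :: "real \<Rightarrow> real \<Rightarrow> real \<Rightarrow> nat \<Rightarrow> real" where
  "L_seq Lg C \<theta> k = (let \<nu> = nu_const \<theta> in
     Lg + delta k powr ((\<nu> - 1) / (1 + \<nu>)) * M_const Lg C \<theta> powr (2 / (1 + \<nu>)))"

definition tau_seq ::
  "real \<Rightarrow> real \<Rightarrow> real \<Rightarrow> real \<Rightarrow> real \<Rightarrow> real \<Rightarrow> real \<Rightarrow> real \<Rightarrow> nat \<Rightarrow> real" where
  "tau_seq Lg C \<theta> \<gamma> \<sigma> \<epsilon> lam \<rho> k =
     C / (Lg + inverse (lam_low Lg lam \<rho>)) *
       min ((\<gamma> * \<epsilon> powr \<sigma> / 2) powr \<theta>) (eta (k + 1) powr (\<theta> / (2 * (1 - \<theta>))))"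

definition x_step ::
  "('a::euclidean_space \<times> 'b \<Rightarrow> real) \<Rightarrow> ('a \<Rightarrow> ereal) \<Rightarrow> real \<Rightarrow> real \<Rightarrow> 'a \<Rightarrow> 'b \<Rightarrow> 'a" where
  "x_step f p r L x y =
     arg_min (\<lambda>u. ereal (grad (\<lambda>w. f (w, y)) x \<bullet> u + L / 2 * (norm (u - x))\<^sup>2) + p u)
       (\<lambda>u. u \<in> cball x r)"

text \<open>\<open>ipg_run \<dots> x0 y0 k x y P Q G\<close>: the method started at \<open>(x0, y0)\<close> generates \<open>(x, y)\<close> as its
  \<open>k\<close>-th iterate, having used in total \<open>P\<close> and \<open>Q\<close> evaluations of the proximal operators of \<open>p\<close> and
  \<open>q\<close>, and \<open>G\<close> evaluations of the gradient of \<open>f\<close>. The premises of \<open>Suc\<close> determine the next iterate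
  uniquely, and a call of the subroutine that does not terminate blocks the run.\<close>

inductive ipg_run ::
  "('a::euclidean_space \<times> 'b::euclidean_space \<Rightarrow> real) \<Rightarrow> ('a \<Rightarrow> ereal) \<Rightarrow> ('b \<Rightarrow> ereal) \<Rightarrow>
     real \<Rightarrow> real \<Rightarrow> real \<Rightarrow> real \<Rightarrow> real \<Rightarrow> real \<Rightarrow> real \<Rightarrow> real \<Rightarrow> real \<Rightarrow> 'a \<Rightarrow> 'b \<Rightarrow>
     nat \<Rightarrow> 'a \<Rightarrow> 'b \<Rightarrow> nat \<Rightarrow> nat \<Rightarrow> nat \<Rightarrow> bool"
  for f p q Lf Lg C \<theta> \<gamma> \<sigma> \<epsilon> lam \<rho> x0 y0 where
  Zero: "ipg_run f p q Lf Lg C \<theta> \<gamma> \<sigma> \<epsilon> lam \<rho> x0 y0 0 x0 y0 0 0 0"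
| Suc: "ipg_run f p q Lf Lg C \<theta> \<gamma> \<sigma> \<epsilon> lam \<rho> x0 y0 k x y P Q G \<Longrightarrow>
        x' = x_step f p (radius Lf \<gamma> \<sigma> \<epsilon>) (L_seq Lg C \<theta> k) x y \<Longrightarrow>
        pg_run (\<lambda>u. - f (x', u)) q lam \<rho> (tau_seq Lg C \<theta> \<gamma> \<sigma> \<epsilon> lam \<rho> k) y y' Nq Ng \<Longrightarrow>
        ipg_run f p q Lf Lg C \<theta> \<gamma> \<sigma> \<epsilon> lam \<rho> x0 y0 (Suc k) x' y' (P + 1) (Q + Nq) (G + 1 + Ng)"

section \<open>Complexity bounds\<close>

definition ceil_plus :: "real \<Rightarrow> int" where
  "ceil_plus t = max \<lceil>t\<rceil> 0"

definition Chat1 :: "real \<Rightarrow> real \<Rightarrow> real \<Rightarrow> real" where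
  "Chat1 \<nu> b Lu =
     (36 * (1 + \<nu>) / \<nu> * b * Lu * ceil_plus (ln (18 * (1 + \<nu>) / \<nu> * b * Lu))
      + 72 * (1 + \<nu>) / \<nu> * b * Lu + 1) powr ((1 + \<nu>) / (2 * \<nu>))"

definition Chat2 :: "real \<Rightarrow> real \<Rightarrow> real \<Rightarrow> real" where
  "Chat2 \<nu> b M =
     (4 * b * (1 + \<nu>) * (3 * M) powr (2 / \<nu>) / M powr (2 / (1 + \<nu>))
        * ceil_plus (ln (2 * b * (1 + \<nu>) * (3 * M) powr (2 / \<nu>) / M powr (2 / (1 + \<nu>))))
      + 8 * b * (1 + \<nu>) * (3 * M) powr (2 / \<nu>) / (\<nu> * M powr (2 / (1 + \<nu>))) + 1)
     powr ((1 + \<nu>) / 2)"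

definition Chat3 :: "real \<Rightarrow> real \<Rightarrow> real \<Rightarrow> real \<Rightarrow> real" where
  "Chat3 \<nu> a Lu M =
     (36 * Lu * a) powr ((1 + \<nu>) / (2 * \<nu>))
     + inverse M * (4 * a * (3 * M) powr (2 / \<nu>)) powr ((1 + \<nu>) / 2)"

definition Chat4 :: "real \<Rightarrow> real" where
  "Chat4 A = 72 * A"

definition Chat5 :: "real \<Rightarrow> real \<Rightarrow> real \<Rightarrow> real \<Rightarrow> real" where
  "Chat5 \<nu> b M Lg =
     (144 * (1 + \<nu>) * b * Lg\<^sup>2 / M powr (2 / (1 + \<nu>))
        * ceil_plus (ln (72 * (1 + \<nu>) * b * Lg\<^sup>2 / M powr (2 / (1 + \<nu>))))
      + 288 * (1 + \<nu>) * b * Lg\<^sup>2 / M powr (2 / (1 + \<nu>)) + 1) powr ((1 + \<nu>) / 2)"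

definition Chat6 :: "real \<Rightarrow> real \<Rightarrow> real \<Rightarrow> real \<Rightarrow> real" where
  "Chat6 \<nu> a M Lg = (144 * a * Lg\<^sup>2) powr ((1 + \<nu>) / 2) / M"

definition Chat7 :: "real \<Rightarrow> real \<Rightarrow> real \<Rightarrow> real \<Rightarrow> real \<Rightarrow> real \<Rightarrow> real" where
  "Chat7 \<nu> b M Lf \<gamma> \<sigma> =
     (64 * (1 + \<nu>) * b * Lf\<^sup>2 / (\<gamma>\<^sup>2 * M powr (2 / (1 + \<nu>)))
        * ceil_plus (ln (32 * (1 + \<nu>) * b * Lf\<^sup>2 / (\<gamma>\<^sup>2 * M powr (2 / (1 + \<nu>)))))
      + 128 * \<sigma> * (1 + \<nu>) * b * Lf\<^sup>2 / (\<gamma>\<^sup>2 * M powr (2 / (1 + \<nu>))) + 1) powr ((1 + \<nu>) / 2)"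

definition Chat8 :: "real \<Rightarrow> real \<Rightarrow> real \<Rightarrow> real \<Rightarrow> real \<Rightarrow> real" where
  "Chat8 \<nu> a M Lf \<gamma> = (64 * a * Lf\<^sup>2) powr ((1 + \<nu>) / 2) / (\<gamma> powr (1 + \<nu>) * M)"

text \<open>The argument \<open>\<Delta>\<close> stands for \<open>Psi x0 - Psi_min\<close>.\<close>

definition K_hat ::
  "real \<Rightarrow> real \<Rightarrow> real \<Rightarrow> real \<Rightarrow> real \<Rightarrow> real \<Rightarrow> real \<Rightarrow> real \<Rightarrow> int" where
  "K_hat \<Delta> Lf Lg C \<theta> \<gamma> \<sigma> \<epsilon> =
    (let \<nu> = nu_const \<theta>;
         M = M_const Lg C \<theta>;
         A = (1 - \<theta>) powr (- 2) * C powr (- 2) * Lg\<^sup>2;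
         Lu = Lg + M powr (2 / (1 + \<nu>));
         a = 8 * (\<Delta> + 3 + 2 * A / Lu);
         b = 8 * (3 / 2 + A / Lu);
         l = ln (1 / \<epsilon>)
     in \<lceil>Chat1 \<nu> b Lu * \<epsilon> powr (- (1 + \<nu>) / \<nu>) * l powr ((1 + \<nu>) / (2 * \<nu>))
        + Chat2 \<nu> b M * \<epsilon> powr (- (1 + \<nu>) / \<nu>) * l powr ((1 + \<nu>) / 2)
        + Chat3 \<nu> a Lu M * \<epsilon> powr (- (1 + \<nu>) / \<nu>)
        + Chat4 A * \<epsilon> powr (- 2)
        + Chat5 \<nu> b M Lg * \<epsilon> powr (- (1 + \<nu>)) * l powr ((1 + \<nu>) / 2)
        + Chat6 \<nu> a M Lg * \<epsilon> powr (- (1 + \<nu>))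
        + Chat7 \<nu> b M Lf \<gamma> \<sigma> * \<epsilon> powr (- (1 + \<nu>) * \<sigma>) * l powr ((1 + \<nu>) / 2)
        + Chat8 \<nu> a M Lf \<gamma> * \<epsilon> powr (- (1 + \<nu>) * \<sigma>)\<rceil>)"

definition beta_low :: "real \<Rightarrow> real \<Rightarrow> real \<Rightarrow> real \<Rightarrow> real" where
  "beta_low Lg C lam \<rho> = C\<^sup>2 / (2 * lam) / (Lg + inverse (lam_low Lg lam \<rho>))\<^sup>2"

definition beta_up :: "real \<Rightarrow> real \<Rightarrow> real \<Rightarrow> real \<Rightarrow> real" where
  "beta_up Lg C lam \<rho> = C\<^sup>2 / (2 * lam_low Lg lam \<rho>) / (Lg + inverse lam)\<^sup>2"

definition Cf_const ::
  "real \<Rightarrow> real \<Rightarrow> real \<Rightarrow> real \<Rightarrow> real \<Rightarrow> real \<Rightarrow> real \<Rightarrow> real \<Rightarrow> real" where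
  "Cf_const Lg C \<theta> \<gamma> \<sigma> \<epsilon> lam \<rho> =
     min (1 / 2)
       ((2 powr ((2 * \<theta> - 1) / (2 * \<theta>)) - 1) * (\<gamma> * \<epsilon> powr \<sigma>) powr (1 - 2 * \<theta>)
          / ((2 * \<theta> - 1) * beta_up Lg C lam \<rho>))"

definition Lambda_const :: "real \<Rightarrow> real \<Rightarrow> real \<Rightarrow> real \<Rightarrow> int \<Rightarrow> real" where
  "Lambda_const \<theta> \<gamma> \<sigma> \<epsilon> K =
     max ((\<gamma> * \<epsilon> powr \<sigma> / 2) powr (- 2 * \<theta>)) ((real_of_int K + 1) powr (\<theta> / (1 - \<theta>)))"

definition Kf_bar ::
  "real \<Rightarrow> real \<Rightarrow> real \<Rightarrow> real \<Rightarrow> real \<Rightarrow> real \<Rightarrow> real \<Rightarrow> real \<Rightarrow> int \<Rightarrow> int" where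
  "Kf_bar Lg C \<theta> \<gamma> \<sigma> \<epsilon> lam \<rho> K =
    (let \<beta> = beta_low Lg C lam \<rho>;
         c = 2 * lam / C\<^sup>2 * (Lg + inverse (lam_low Lg lam \<rho>))\<^sup>2;
         \<Lambda> = Lambda_const \<theta> \<gamma> \<sigma> \<epsilon> K
     in if \<theta> = 1 / 2
        then ceil_plus ((1 + \<beta>) / \<beta> * ln (c * \<gamma> * \<epsilon> powr \<sigma> * \<Lambda>)) + 1
        else \<lceil>1 / (Cf_const Lg C \<theta> \<gamma> \<sigma> \<epsilon> lam \<rho> * (2 * \<theta> - 1) * \<beta>)
                * (c * \<Lambda>) powr (2 * \<theta> - 1)\<rceil> + 1)"

definition N_hat ::
  "real \<Rightarrow> real \<Rightarrow> real \<Rightarrow> real \<Rightarrow> real \<Rightarrow> real \<Rightarrow> real \<Rightarrow> real \<Rightarrow> int \<Rightarrow> int" where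
  "N_hat Lg C \<theta> \<gamma> \<sigma> \<epsilon> lam \<rho> K =
     K * (ceil_plus (ln (2 * Lg * lam) / ln (1 / \<rho>)) + 1) * Kf_bar Lg C \<theta> \<gamma> \<sigma> \<epsilon> lam \<rho> K"

end

theory Submission
  imports Defs
begin

text \<open>The problem is \<open>min\<^sub>x Psi x\<close> with \<open>Psi = F\<^sup>* + p\<close> and \<open>F\<^sup>* x = max\<^sub>y (f (x, y) - q y)\<close>. The
  inner problem need not be concave and \<open>F\<^sup>*\<close> need not be differentiable; what is used instead is the
  Kurdyka-Lojasiewicz inequality for the inner problem at points \<open>x\<close> that are not \<open>\<epsilon>\<close>-stationary.

  Write \<open>gap x y = F\<^sup>* x - (f (x, y) - q y)\<close> and \<open>R = \<gamma> \<epsilon>\<^sup>\<sigma>\<close>. If \<open>x\<close> is not \<open>\<epsilon>\<close>-stationary, the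
  inequality holds at all \<open>y\<close> with \<open>0 < gap x y \<le> R\<close>. It has three consequences. First, the distance
  of such a \<open>y\<close> to the set of maximisers is at most \<open>gap\<^bsup>1-\<theta>\<^esup> / (C (1 - \<theta>))\<close> (\<open>error_bound\<close>): were
  it larger, Ekeland's principle would give a point where the desingularised gap has slope less than
  \<open>C (1 - \<theta>)\<close>, and a short proximal gradient step from there contradicts the inequality. Secondly, a
  maximiser for \<open>x\<^sub>1\<close> has gap at most \<open>(Lg |x\<^sub>1 - x\<^sub>2| / C)\<^bsup>1/\<theta>\<^esup>\<close> at a nearby \<open>x\<^sub>2\<close>, so that the maximisers depend
  on \<open>x\<close> in a Hoelder continuous way with exponent \<open>\<nu> = (1 - \<theta>) / \<theta>\<close> (\<open>maximisers_hoelder\<close>).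
  Thirdly, proximal gradient steps in \<open>y\<close> decrease the gap at a rate known from the inequality, which
  bounds the length of every run of the subroutine (\<open>pg_terminates\<close>, \<open>Kf_bar_bounds_steps\<close>).

  The radius \<open>r = R / (4 Lf)\<close> of the outer step is such that a pair with gap at most \<open>R / 2\<close> at \<open>x\<close>
  has gap at most \<open>R\<close> at all points of \<open>X\<close> within distance \<open>r\<close> of \<open>x\<close>. As long as \<open>x\<close> is not
  \<open>(r, \<epsilon>)\<close>-stationary, none of these points is \<open>\<epsilon>\<close>-stationary; hence the inequality is available
  along the segment to the next iterate as well as for the subroutine there.

  Hoelder continuity of the maximisers gives the upper model
  \<open>F\<^sup>* x' \<le> F\<^sup>* x + \<nabla>\<^sub>xf (x, y) \<bullet> (x' - x) + Lg/2 |x' - x|\<^sup>2 + M/(1+\<nu>) |x' - x|\<^bsup>1+\<nu>\<^esup>\<close>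
  for every maximiser \<open>y\<close> at \<open>x\<close> (\<open>Fs_upper_bound\<close>). Young's inequality turns its last term into a
  quadratic one with an error \<open>\<delta>\<^sub>k / 2\<close>, and the inexactness of \<open>y\<^sub>k\<close> costs another error
  \<open>A \<eta>\<^sub>k / L\<^sub>k\<close>; so \<open>Psi\<close> decreases by \<open>L\<^sub>k/4 |x\<^sub>k\<^sub>+\<^sub>1 - x\<^sub>k|\<^sup>2\<close> up to errors of order \<open>1 / (k + 1)\<close>
  (\<open>descent_step\<close>). Summing up, one of the last \<open>K / 2\<close> steps before step \<open>K\<close> satisfies
  \<open>L\<^sub>k |x\<^sub>k\<^sub>+\<^sub>1 - x\<^sub>k|\<^sup>2 \<le> (a + b ln K) / K\<close>, and the number \<open>K_hat\<close> is large enough for this to make the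
  step shorter than \<open>r\<close> and the optimality residual of \<open>x\<^sub>k\<^sub>+\<^sub>1\<close> at most \<open>\<epsilon>\<close> (\<open>K_hat_suffices\<close>). Thus
  \<open>x\<^sub>k\<close> was \<open>(r, \<epsilon>)\<close>-stationary after all.\<close>

section \<open>Gradients\<close>

lemma grad_eqI:
  assumes "GDERIV g z :> D"
  shows "grad g z = D"
  unfolding grad_def
proof (rule the_equality)
  show "GDERIV g z :> D" by (rule assms)
next
  fix E assume "GDERIV g z :> E"
  then have "(\<lambda>h. h \<bullet> E) = (\<lambda>h. h \<bullet> D)"
    using assms unfolding gderiv_def by (rule has_derivative_unique)
  then show "E = D" by (metis vector_eq_ldot)
qed

lemma GDERIV_grad:
  fixes g :: "'a::euclidean_space \<Rightarrow> real"
  assumes "g differentiable (at z)"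
  shows "GDERIV g z :> grad g z"
proof -
  obtain D where D: "(g has_derivative D) (at z)"
    using assms unfolding differentiable_def by blast
  have "D = (\<lambda>h. h \<bullet> adjoint D 1)"
    using adjoint_works[OF has_derivative_linear[OF D], of _ 1] by auto
  then have "GDERIV g z :> adjoint D 1"
    using D unfolding gderiv_def by simp
  then show ?thesis by (simp add: grad_eqI)
qed

lemma GDERIV_fst:
  fixes f :: "'a::euclidean_space \<times> 'b::euclidean_space \<Rightarrow> real"
  assumes "GDERIV f (x, y) :> D"
  shows "GDERIV (\<lambda>u. f (u, y)) x :> fst D"
proof -
  have "((\<lambda>u. (u, y)) has_derivative (\<lambda>h. (h, 0))) (at x)"
    by (auto intro!: derivative_eq_intros)
  from has_derivative_compose[OF this, of f "\<lambda>h. h \<bullet> D"] assms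
  show ?thesis by (simp add: gderiv_def inner_prod_def)
qed

lemma GDERIV_snd:
  fixes f :: "'a::euclidean_space \<times> 'b::euclidean_space \<Rightarrow> real"
  assumes "GDERIV f (x, y) :> D"
  shows "GDERIV (\<lambda>u. f (x, u)) y :> snd D"
proof -
  have "((\<lambda>u. (x, u)) has_derivative (\<lambda>h. (0, h))) (at y)"
    by (auto intro!: derivative_eq_intros)
  from has_derivative_compose[OF this, of f "\<lambda>h. h \<bullet> D"] assms
  show ?thesis by (simp add: gderiv_def inner_prod_def)
qed

lemma GDERIV_line:
  assumes "GDERIV g (z + t *\<^sub>R d) :> D"
  shows "((\<lambda>t. g (z + t *\<^sub>R d)) has_real_derivative D \<bullet> d) (at t)"
proof -
  have "((\<lambda>t. z + t *\<^sub>R d) has_derivative (\<lambda>h. h *\<^sub>R d)) (at t)"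
    by (auto intro!: derivative_eq_intros)
  from has_derivative_compose[OF this, of g "\<lambda>h. h \<bullet> D"] assms
  show ?thesis
    by (simp add: gderiv_def has_field_derivative_def inner_commute mult_commute_abs)
qed

text \<open>The gradients are compared along the segment only: for \<open>f\<close> their Lipschitz continuity is available
  on \<open>edom p \<times> edom q\<close>, which need not be open.\<close>
lemma gradient_upper_bound:
  fixes g :: "'a::real_inner \<Rightarrow> real"
  assumes der: "\<And>t. t \<in> {0..1} \<Longrightarrow> GDERIV g (z + t *\<^sub>R d) :> G t"
    and lip: "\<And>t. t \<in> {0..1} \<Longrightarrow> norm (G t - G 0) \<le> L * (t * norm d)"
  shows "g (z + d) \<le> g z + G 0 \<bullet> d + L / 2 * (norm d)\<^sup>2"
proof -
  define h where "h t = g (z + t *\<^sub>R d) - t * (G 0 \<bullet> d) - L / 2 * t\<^sup>2 * (norm d)\<^sup>2" for t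
  have "\<exists>y. (h has_real_derivative y) (at t) \<and> y \<le> 0" if "0 \<le> t" "t \<le> 1" for t
  proof (intro exI conjI)
    show "(h has_real_derivative (G t \<bullet> d - G 0 \<bullet> d - L * t * (norm d)\<^sup>2)) (at t)"
      unfolding h_def using that
      by (auto intro!: derivative_eq_intros GDERIV_line der simp: field_simps)
    have "(G t - G 0) \<bullet> d \<le> norm (G t - G 0) * norm d" by (rule norm_cauchy_schwarz)
    also have "\<dots> \<le> L * (t * norm d) * norm d"
      using lip[of t] that by (intro mult_right_mono) auto
    finally show "G t \<bullet> d - G 0 \<bullet> d - L * t * (norm d)\<^sup>2 \<le> 0"
      by (simp add: inner_diff_left power2_eq_square)
  qed
  then have "h 1 \<le> h 0"
    by (intro DERIV_nonpos_imp_nonincreasing[of 0 1]) auto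
  then show ?thesis by (simp add: h_def)
qed

section \<open>Closed convex functions\<close>

lemma real_edom:
  assumes "proper_closed_convex q" "w \<in> edom q"
  shows "ereal (real_of_ereal (q w)) = q w"
  using assms by (cases "q w") (auto simp: proper_closed_convex_def edom_def)

lemma proper_closed_convex_ineq:
  assumes q: "proper_closed_convex q" and u: "u \<in> edom q" and w: "w \<in> edom q"
    and t: "0 \<le> t" "t \<le> 1"
  shows "w + t *\<^sub>R (u - w) \<in> edom q"
    and "real_of_ereal (q (w + t *\<^sub>R (u - w)))
      \<le> (1 - t) * real_of_ereal (q w) + t * real_of_ereal (q u)"
proof -
  have "(w, real_of_ereal (q w)) \<in> epi q" "(u, real_of_ereal (q u)) \<in> epi q"
    using real_edom[OF q u] real_edom[OF q w] by (auto simp: epi_def)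
  then have "(1 - t) *\<^sub>R (w, real_of_ereal (q w)) + t *\<^sub>R (u, real_of_ereal (q u)) \<in> epi q"
    using q t unfolding proper_closed_convex_def convex_alt by blast
  moreover have "(1 - t) *\<^sub>R w + t *\<^sub>R u = w + t *\<^sub>R (u - w)"
    by (simp add: algebra_simps)
  ultimately have *: "q (w + t *\<^sub>R (u - w))
      \<le> ereal ((1 - t) * real_of_ereal (q w) + t * real_of_ereal (q u))"
    by (simp add: epi_def)
  then show dom: "w + t *\<^sub>R (u - w) \<in> edom q"
    unfolding edom_def by (auto intro: le_less_trans)
  show "real_of_ereal (q (w + t *\<^sub>R (u - w)))
      \<le> (1 - t) * real_of_ereal (q w) + t * real_of_ereal (q u)"
    using * real_edom[OF q dom] by (metis ereal_less_eq(3))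
qed

lemma closed_sublevel:
  assumes q: "proper_closed_convex q" and S: "closed S"
    and h: "continuous_on UNIV h" and \<pi>: "continuous_on UNIV \<pi>"
  shows "closed {z \<in> S. q (\<pi> z) \<le> ereal (h z)}"
proof -
  have "closed ((\<lambda>z. (\<pi> z, h z)) -` epi q)"
    using q h \<pi> by (intro closed_vimage continuous_on_Pair) (auto simp: proper_closed_convex_def)
  moreover have "{z \<in> S. q (\<pi> z) \<le> ereal (h z)} = S \<inter> (\<lambda>z. (\<pi> z, h z)) -` epi q"
    by (auto simp: epi_def)
  ultimately show ?thesis using S by auto
qed

text \<open>The nonempty sublevel sets form a chain of compact sets, and any point of their intersection is a
  minimiser; that \<open>q\<close> is bounded below on \<open>S\<close> is a consequence.\<close>

lemma attains_min_compact:
  assumes q: "proper_closed_convex q" and S: "compact S" "S \<inter> edom q \<noteq> {}"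
    and h: "continuous_on UNIV h"
  shows "\<exists>w\<in>S \<inter> edom q. \<forall>u\<in>S \<inter> edom q.
    h w + real_of_ereal (q w) \<le> h u + real_of_ereal (q u)"
proof -
  define A where "A T = {w \<in> S. q w \<le> ereal (T - h w)}" for T
  define V where "V = A ` {T. A T \<noteq> {}}"
  have cA: "compact (A T)" for T
  proof -
    have "closed (A T)" unfolding A_def
      by (rule closed_sublevel[where \<pi> = "\<lambda>w. w", OF q])
        (use S h in \<open>auto intro!: continuous_intros simp: compact_imp_closed\<close>)
    moreover have "A T = S \<inter> A T" by (auto simp: A_def)
    ultimately show ?thesis using compact_Int_closed[OF S(1)] by metis
  qed
  have mono: "A T \<subseteq> A T'" if "T \<le> T'" for T T'
    using that by (force simp: A_def intro: order_trans)
  have inA: "u \<in> A (h u + real_of_ereal (q u))" if "u \<in> S \<inter> edom q" for u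
    using that real_edom[OF q, of u] by (auto simp: A_def)
  have "\<Inter>V \<noteq> {}"
  proof (rule compact_chain)
    show "\<And>S. S \<in> V \<Longrightarrow> compact S" using cA by (auto simp: V_def)
    show "{} \<notin> V" by (auto simp: V_def)
    show "\<And>S T. S \<in> V \<and> T \<in> V \<Longrightarrow> S \<subseteq> T \<or> T \<subseteq> S"
    proof -
      fix S T assume "S \<in> V \<and> T \<in> V"
      then obtain s t where "S = A s" "T = A t" by (auto simp: V_def)
      then show "S \<subseteq> T \<or> T \<subseteq> S" using mono[of s t] mono[of t s] linear[of s t] by blast
    qed
  qed
  then obtain w where w: "\<And>T. A T \<noteq> {} \<Longrightarrow> w \<in> A T" by (auto simp: V_def)
  have wu: "w \<in> A (h u + real_of_ereal (q u))" if "u \<in> S \<inter> edom q" for u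
    using inA[OF that] w by blast
  obtain u0 where u0: "u0 \<in> S \<inter> edom q" using S by blast
  have wd: "w \<in> S \<inter> edom q"
    using wu[OF u0] by (auto simp: A_def edom_def intro: le_less_trans)
  have "h w + real_of_ereal (q w) \<le> h u + real_of_ereal (q u)" if "u \<in> S \<inter> edom q" for u
  proof -
    have "q w \<le> ereal (h u + real_of_ereal (q u) - h w)"
      using wu[OF that] by (simp add: A_def)
    then have "real_of_ereal (q w) \<le> h u + real_of_ereal (q u) - h w"
      using real_edom[OF q, of w] wd by (metis (no_types) IntE ereal_less_eq(3))
    then show ?thesis by simp
  qed
  then show ?thesis using wd by blast
qed

lemma prox_attained:
  fixes q :: "'a::euclidean_space \<Rightarrow> ereal"
  assumes q: "proper_closed_convex q" and z: "z \<in> edom q" and c: "0 < c"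
  shows "\<exists>w\<in>edom q. \<forall>u\<in>edom q.
    g \<bullet> w + c / 2 * (norm (w - z))\<^sup>2 + real_of_ereal (q w)
      \<le> g \<bullet> u + c / 2 * (norm (u - z))\<^sup>2 + real_of_ereal (q u)"
proof -
  define qr where "qr w = real_of_ereal (q w)" for w
  define \<Phi> where "\<Phi> u = g \<bullet> u + c / 2 * (norm (u - z))\<^sup>2 + qr u" for u
  have cont: "continuous_on UNIV (\<lambda>u. g \<bullet> u + c / 2 * (norm (u - z))\<^sup>2)"
    by (intro continuous_intros)
  obtain w1 where w1: "\<And>u. u \<in> cball z 1 \<inter> edom q \<Longrightarrow> qr w1 \<le> qr u"
    using attains_min_compact[OF q, of "cball z 1" "\<lambda>_. 0"] z unfolding qr_def by fastforce
  \<comment> \<open>Convexity turns the minimum of \<open>q\<close> on the unit ball into a linear lower bound outside it.\<close>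
  define B where "B = norm g + (qr z - qr w1)"
  define R where "R = max 1 (2 * B / c)"
  have far: "\<Phi> z \<le> \<Phi> u" if u: "u \<in> edom q" "norm (u - z) > R" for u
  proof -
    define d where "d = norm (u - z)"
    have d: "d > 1" "d \<ge> 2 * B / c" using u(2) by (auto simp: d_def R_def)
    let ?t = "1 / d"
    have t: "0 \<le> ?t" "?t \<le> 1" using d by auto
    have "z + ?t *\<^sub>R (u - z) \<in> cball z 1 \<inter> edom q"
      using proper_closed_convex_ineq(1)[OF q u(1) z t] d
      by (simp add: dist_norm d_def)
    then have "qr w1 \<le> (1 - ?t) * qr z + ?t * qr u"
      using w1 proper_closed_convex_ineq(2)[OF q u(1) z t] unfolding qr_def by fastforce
    then have "d * qr w1 \<le> d * ((1 - ?t) * qr z + ?t * qr u)"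
      using d by (intro mult_left_mono) auto
    also have "\<dots> = (d - 1) * qr z + qr u" using d by (simp add: field_simps)
    finally have 1: "qr u \<ge> qr z - d * (qr z - qr w1)" by (simp add: algebra_simps)
    have "g \<bullet> (z - u) \<le> norm g * norm (z - u)" by (rule norm_cauchy_schwarz)
    then have 2: "g \<bullet> u \<ge> g \<bullet> z - norm g * d"
      by (simp add: inner_diff_right d_def norm_minus_commute)
    have "B * d \<le> c / 2 * d * d"
      using d c by (intro mult_right_mono) (auto simp: field_simps)
    then have "c / 2 * d\<^sup>2 \<ge> norm g * d + d * (qr z - qr w1)"
      by (simp add: B_def power2_eq_square algebra_simps)
    then show ?thesis using 1 2 by (simp add: \<Phi>_def d_def[symmetric])
  qed
  have R: "R \<ge> 0" by (simp add: R_def)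
  obtain w where w: "w \<in> edom q" "\<And>u. u \<in> cball z R \<inter> edom q \<Longrightarrow> \<Phi> w \<le> \<Phi> u"
    using attains_min_compact[OF q, of "cball z R", OF _ _ cont] z R
    unfolding \<Phi>_def qr_def by fastforce
  have "\<Phi> w \<le> \<Phi> u" if "u \<in> edom q" for u
  proof (cases "norm (u - z) > R")
    case True
    have "\<Phi> w \<le> \<Phi> z" using w(2)[of z] z R by simp
    also have "\<dots> \<le> \<Phi> u" using far that True by blast
    finally show ?thesis .
  next
    case False
    then show ?thesis using w(2) that by (simp add: dist_norm norm_minus_commute)
  qed
  then show ?thesis using w(1) unfolding \<Phi>_def qr_def by blast
qed

text \<open>The algorithm minimises extended-valued functions, the convex analysis is done with real values on
  the domain. Since \<open>arg_min\<close> is an arbitrary point unless a minimiser exists, existence is a premise.\<close>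
lemma arg_min_ereal:
  assumes q: "proper_closed_convex q"
    and ex: "\<exists>w\<in>edom q. P w \<and> (\<forall>u\<in>edom q. P u \<longrightarrow> h w + real_of_ereal (q w) \<le> h u + real_of_ereal (q u))"
  defines "w \<equiv> arg_min (\<lambda>u. ereal (h u) + q u) P"
  shows "w \<in> edom q" "P w" "\<And>u. u \<in> edom q \<Longrightarrow> P u \<Longrightarrow> h w + real_of_ereal (q w) \<le> h u + real_of_ereal (q u)"
proof -
  obtain v where v: "v \<in> edom q" "P v"
    "\<And>u. u \<in> edom q \<Longrightarrow> P u \<Longrightarrow> h v + real_of_ereal (q v) \<le> h u + real_of_ereal (q u)"
    using ex by blast
  have val: "ereal (h u) + q u = ereal (h u + real_of_ereal (q u))" if "u \<in> edom q" for u
    using real_edom[OF q that] by (metis plus_ereal.simps(1))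
  have inf: "ereal (h u) + q u = \<infinity>" if "u \<notin> edom q" for u
    using that by (simp add: edom_def)
  have le: "ereal (h v) + q v \<le> ereal (h u) + q u" if "P u" for u
    by (cases "u \<in> edom q") (use v that in \<open>auto simp: val inf\<close>)
  have "is_arg_min (\<lambda>u. ereal (h u) + q u) P v"
    using v le by (auto simp: is_arg_min_def not_less)
  then have am: "is_arg_min (\<lambda>u. ereal (h u) + q u) P w"
    unfolding w_def arg_min_def by (rule someI)
  then show "P w" by (simp add: is_arg_min_def)
  have wle: "ereal (h w) + q w \<le> ereal (h u) + q u" if "P u" for u
    using am that by (simp add: is_arg_min_linorder)
  show wd: "w \<in> edom q"
  proof (rule ccontr)
    assume "w \<notin> edom q"
    then show False using wle[OF v(2)] inf val[OF v(1)] by simp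
  qed
  show "h w + real_of_ereal (q w) \<le> h u + real_of_ereal (q u)" if "u \<in> edom q" "P u" for u
    using wle[OF that(2)] by (simp add: val that(1) wd)
qed

lemma nonneg_if_affine_nonneg:
  fixes a b :: real
  assumes "\<And>t. 0 < t \<Longrightarrow> t \<le> 1 \<Longrightarrow> 0 \<le> a + t * b"
  shows "0 \<le> a"
proof -
  have "((\<lambda>t. a + t * b) \<longlongrightarrow> a + 0 * b) (at_right 0)"
    by (intro tendsto_intros)
  moreover have "eventually (\<lambda>t. 0 \<le> a + t * b) (at_right 0)"
    using assms by (auto simp: eventually_at_right_field intro!: exI[of _ 1])
  ultimately show ?thesis
    using tendsto_lowerbound[of "\<lambda>t. a + t * b" a "at_right 0" 0] by simp
qed

text \<open>The optimality condition of a proximal step, in subgradient form. At \<open>u = z\<close> it contains the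
  sufficient decrease of the model.\<close>

lemma prox_variational:
  assumes q: "proper_closed_convex q" and S: "convex S" and w: "w \<in> S \<inter> edom q"
    and min: "\<And>u. u \<in> edom q \<Longrightarrow> u \<in> S \<Longrightarrow>
      g \<bullet> w + c / 2 * (norm (w - z))\<^sup>2 + real_of_ereal (q w)
        \<le> g \<bullet> u + c / 2 * (norm (u - z))\<^sup>2 + real_of_ereal (q u)"
    and u: "u \<in> S \<inter> edom q"
  shows "real_of_ereal (q w) + (- g - c *\<^sub>R (w - z)) \<bullet> (u - w) \<le> real_of_ereal (q u)"
proof -
  have "0 \<le> (g \<bullet> (u - w) + c * ((w - z) \<bullet> (u - w)) + real_of_ereal (q u) - real_of_ereal (q w))
      + t * (c / 2 * (norm (u - w))\<^sup>2)" if t: "0 < t" "t \<le> 1" for t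
  proof -
    let ?u = "w + t *\<^sub>R (u - w)"
    have "?u = (1 - t) *\<^sub>R w + t *\<^sub>R u" by (simp add: algebra_simps)
    then have "?u \<in> S" using S w u t by (auto simp: convex_alt)
    moreover have dom: "?u \<in> edom q" and
      le: "real_of_ereal (q ?u) \<le> (1 - t) * real_of_ereal (q w) + t * real_of_ereal (q u)"
      using proper_closed_convex_ineq[OF q] u w t by auto
    ultimately have le': "g \<bullet> w + c / 2 * (norm (w - z))\<^sup>2 + real_of_ereal (q w)
      \<le> g \<bullet> ?u + c / 2 * (norm (?u - z))\<^sup>2 + ((1 - t) * real_of_ereal (q w) + t * real_of_ereal (q u))"
      using min[of ?u] by linarith
    have eqn: "(norm (?u - z))\<^sup>2
        = (norm (w - z))\<^sup>2 + 2 * t * ((w - z) \<bullet> (u - w)) + t\<^sup>2 * (norm (u - w))\<^sup>2"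
      unfolding power2_norm_eq_inner
      by (simp add: algebra_simps inner_commute power2_eq_square)
    have eqg: "g \<bullet> ?u = g \<bullet> w + t * (g \<bullet> (u - w))"
      by (simp add: inner_add_right)
    have aux: "0 \<le> t * ((gd + c * e + qu - qw) + t * (c / 2 * m))"
      if "gw + c / 2 * n + qw
        \<le> (gw + t * gd) + c / 2 * (n + 2 * t * e + t\<^sup>2 * m) + ((1 - t) * qw + t * qu)"
      for gw gd n m e qw qu :: real
      using that by (simp add: field_simps power2_eq_square)
    have "0 \<le> t * ((g \<bullet> (u - w) + c * ((w - z) \<bullet> (u - w)) + real_of_ereal (q u) - real_of_ereal (q w))
      + t * (c / 2 * (norm (u - w))\<^sup>2))"
      by (rule aux) (use le' in \<open>simp only: eqn eqg\<close>)
    then show ?thesis using t by (simp add: zero_le_mult_iff)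
  qed
  from nonneg_if_affine_nonneg[OF this] show ?thesis
    by (simp add: inner_diff_left inner_minus_left)
qed

section \<open>Subdifferentials\<close>

text \<open>A Frechet subgradient is a limiting one by constant sequences. The first-order error \<open>e * norm (z - x)\<close>
  is needed for \<open>Psi\<close>, which is not convex.\<close>
lemma lim_subdiff_if_lower_bound:
  assumes x: "\<phi> x = ereal a"
    and lower: "\<And>e. 0 < e \<Longrightarrow>
      eventually (\<lambda>z. ereal (a + v \<bullet> (z - x) - e * norm (z - x)) \<le> \<phi> z) (at x)"
  shows "v \<in> lim_subdiff \<phi> x"
proof -
  let ?Q = "\<lambda>z. (\<phi> z - \<phi> x - ereal (v \<bullet> (z - x))) / ereal (norm (z - x))"
  have ev: "eventually (\<lambda>z. ereal (- e) \<le> ?Q z) (at x)" if "e > 0" for e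
    using lower[OF that] eventually_neq_at_within[of x x UNIV]
  proof eventually_elim
    case (elim z)
    show ?case
    proof (cases "\<phi> z")
      case (real r)
      then have "- e * norm (z - x) \<le> r - a - v \<bullet> (z - x)" using elim by simp
      then show ?thesis using elim(2) by (simp add: x real field_simps)
    next
      case PInf then show ?thesis using elim(2) by (simp add: x)
    next
      case MInf then show ?thesis using elim by simp
    qed
  qed
  have "y < Liminf (at x) ?Q" if y: "y < 0" for y
  proof -
    obtain e where e: "e > 0" "y < ereal (- e)"
    proof -
      obtain m :: ereal where m: "y < m" "m < 0" using dense[OF y] by blast
      then obtain s where "m = ereal s" by (cases m) auto
      then show ?thesis using m that[of "- s"] by auto
    qed
    have "ereal (- e) \<le> Liminf (at x) ?Q" by (rule Liminf_bounded[OF ev[OF e(1)]])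
    then show ?thesis using e(2) by (rule less_le_trans[rotated])
  qed
  then have "0 \<le> Liminf (at x) ?Q" using linorder_not_less by blast
  then have "v \<in> frechet_subdiff \<phi> x" "x \<in> edom \<phi>"
    using x by (auto simp: frechet_subdiff_def edom_def)
  then show ?thesis
    unfolding lim_subdiff_def
    by (intro CollectI conjI exI[of _ "\<lambda>_. x"] exI[of _ "\<lambda>_. v"]) auto
qed

lemma convex_subgradient_in_lim_subdiff:
  assumes q: "proper_closed_convex q" and w: "w \<in> edom q"
    and sub: "\<And>u. u \<in> edom q \<Longrightarrow> real_of_ereal (q w) + v \<bullet> (u - w) \<le> real_of_ereal (q u)"
  shows "v \<in> lim_subdiff q w"
proof (rule lim_subdiff_if_lower_bound)
  show "q w = ereal (real_of_ereal (q w))" using real_edom[OF q w] by simp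
  fix e :: real assume e: "0 < e"
  have "ereal (real_of_ereal (q w) + v \<bullet> (z - w) - e * norm (z - w)) \<le> q z" for z
  proof (cases "z \<in> edom q")
    case True
    have "real_of_ereal (q w) + v \<bullet> (z - w) - e * norm (z - w) \<le> real_of_ereal (q z)"
      using sub[OF True] e by (smt (verit) mult_nonneg_nonneg norm_ge_zero)
    then show ?thesis using real_edom[OF q True] by (metis ereal_less_eq(3))
  next
    case False
    then show ?thesis by (simp add: edom_def)
  qed
  then show "\<forall>\<^sub>F z in at w. ereal (real_of_ereal (q w) + v \<bullet> (z - w) - e * norm (z - w)) \<le> q z"
    by simp
qed

section \<open>Real inequalities\<close>

lemma powr_concave_tangent:
  fixes a g s :: real
  assumes "0 < a" "a < 1" "0 \<le> g" "0 < s"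
  shows "g powr a \<le> s powr a + a * s powr (a - 1) * (g - s)"
proof (cases "g = 0")
  case True
  have "s powr a = s powr (a - 1) * s"
    using assms by (metis diff_add_cancel powr_add powr_one less_imp_le)
  then show ?thesis using True assms by (simp add: mult_left_le_one_le)
next
  case False
  then have "g powr a * s powr (1 - a) \<le> a * g + (1 - a) * s"
    using assms by (intro Youngs_inequality_0) auto
  then have "(g powr a * s powr (1 - a)) * s powr (a - 1) \<le> (a * g + (1 - a) * s) * s powr (a - 1)"
    by (intro mult_right_mono) auto
  moreover have "s powr (1 - a) * s powr (a - 1) = 1"
    using assms by (simp add: powr_add[symmetric])
  moreover have "s powr (a - 1) * s = s powr a"
    using assms by (metis diff_add_cancel powr_add powr_one less_imp_le)
  ultimately show ?thesis by (simp add: algebra_simps)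
qed

text \<open>An increment bound whose slope is taken at the right end point integrates like one with the
  slope at the left end point, as the two Riemann sums differ by a telescoping sum.\<close>

lemma increment_bound:
  fixes \<phi> w W :: "real \<Rightarrow> real"
  assumes \<phi>: "\<And>s t. 0 \<le> s \<Longrightarrow> s < t \<Longrightarrow> t \<le> 1 \<Longrightarrow> \<phi> t - \<phi> s \<le> (t - s) * w t"
    and W: "\<And>s t. 0 \<le> s \<Longrightarrow> s < t \<Longrightarrow> t \<le> 1 \<Longrightarrow> (t - s) * w s \<le> W t - W s"
  shows "\<phi> 1 - \<phi> 0 \<le> W 1 - W 0"
proof -
  have bound: "\<phi> 1 - \<phi> 0 \<le> W 1 - W 0 + (w 1 - w 0) * inverse (real (Suc n))" for n
  proof -
    define N where "N = Suc n"
    have tel: "(\<Sum>i<N. h (real (Suc i) / real N) - h (real i / real N)) = h 1 - h 0" for h :: "real \<Rightarrow> real"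
      using sum_lessThan_telescope[of "\<lambda>i. h (real i / real N)" N] by (simp add: N_def)
    have st: "0 \<le> real i / real N" "real i / real N < real (Suc i) / real N" "real (Suc i) / real N \<le> 1"
      "real (Suc i) / real N - real i / real N = inverse (real N)" if "i < N" for i
      using that by (auto simp: N_def field_simps)
    have "\<phi> 1 - \<phi> 0 \<le> (\<Sum>i<N. inverse (real N) * w (real (Suc i) / real N))"
      unfolding tel[of \<phi>, symmetric] by (intro sum_mono) (use \<phi> st in \<open>metis lessThan_iff\<close>)
    also have "\<dots> = (\<Sum>i<N. inverse (real N) * w (real i / real N)
        + inverse (real N) * (w (real (Suc i) / real N) - w (real i / real N)))"
      by (intro sum.cong) (auto simp: algebra_simps)
    also have "\<dots> = (\<Sum>i<N. inverse (real N) * w (real i / real N)) + (w 1 - w 0) * inverse (real N)"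
      by (simp only: sum.distrib sum_distrib_left[symmetric] tel mult.commute)
    also have "(\<Sum>i<N. inverse (real N) * w (real i / real N)) \<le> W 1 - W 0"
      unfolding tel[of W, symmetric] by (intro sum_mono) (use W st in \<open>metis lessThan_iff\<close>)
    finally show ?thesis by (simp add: N_def)
  qed
  have "(\<lambda>n. W 1 - W 0 + (w 1 - w 0) * inverse (real (Suc n))) \<longlonglongrightarrow> W 1 - W 0 + (w 1 - w 0) * 0"
    by (intro tendsto_intros LIMSEQ_inverse_real_of_nat)
  then show ?thesis using bound by (intro LIMSEQ_le_const[of _ "W 1 - W 0"]) auto
qed

lemma powr_tangent:
  fixes s t v :: real
  assumes "0 \<le> s" "0 < t" "0 < v"
  shows "(t - s) * s powr v \<le> (t powr (1 + v) - s powr (1 + v)) / (1 + v)"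
proof (cases "s = 0")
  case True
  then show ?thesis using assms by simp
next
  case False
  then have s: "s > 0" using assms by simp
  have "(t powr (1 + v)) powr (1 / (1 + v)) * (s powr (1 + v)) powr (v / (1 + v))
      \<le> 1 / (1 + v) * t powr (1 + v) + v / (1 + v) * s powr (1 + v)"
    using assms s by (intro Youngs_inequality_0) (auto simp: field_simps)
  then have "t * s powr v \<le> (t powr (1 + v) + v * s powr (1 + v)) / (1 + v)"
    using assms s by (simp add: powr_powr add_divide_distrib)
  moreover have "s * s powr v = s powr (1 + v)" using s by (simp add: powr_add)
  ultimately show ?thesis using assms by (simp add: field_simps)
qed

lemma harm_le_ln: "0 < n \<Longrightarrow> harm n \<le> 1 + ln (real n)"
  using decseqD[OF decseq_harm_diff_ln, of 0 "n - 1"] by (simp add: harm_def)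

lemma log_le_linear:
  fixes c x :: real
  assumes "0 < c" "0 < x" "2 * c * ln c \<le> x"
  shows "c * ln x \<le> x"
proof -
  have "ln x = ln (x / (2 * c)) + ln 2 + ln c" using assms by (simp add: ln_div ln_mult)
  also have "ln (x / (2 * c)) \<le> x / (2 * c) - 1" using assms by (intro ln_le_minus_one) auto
  finally have "c * ln x \<le> c * (x / (2 * c) - 1 + ln 2 + ln c)" using assms by (intro mult_left_mono) auto
  also have "\<dots> = x / 2 - c * (1 - ln 2) + c * ln c" using assms by (simp add: field_simps)
  also have "\<dots> \<le> x / 2 + x / 2"
  proof -
    have "ln 2 < (1::real)" using ln_2_less_1 .
    then have "0 \<le> c * (1 - ln 2)" using assms by simp
    then show ?thesis using assms(3) by linarith
  qed
  finally show ?thesis by simp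
qed

text \<open>The lower bounds on \<open>n\<close> ensure \<open>\<alpha> / x \<le> \<epsilon> powr \<omega> / 4\<close> and \<open>\<beta> * ln n / x \<le> \<epsilon> powr \<omega> / 4\<close>
  with \<open>x = n powr (1 / e)\<close>; the second inequality is of the form
  \<open>c' * ln x \<le> x\<close> with \<open>c' = 4 e \<beta> \<epsilon> powr (- \<omega>)\<close>.\<close>

lemma iteration_count_suffices:
  fixes \<alpha> \<beta> e \<omega> \<epsilon> n :: real
  defines "c \<equiv> 4 * e * \<beta>"
  assumes pos: "0 < e" "0 \<le> \<alpha>" "0 < \<beta>" "0 < \<omega>" "0 < \<epsilon>" "0 < n" and l: "1 \<le> ln (1 / \<epsilon>)"
    and n1: "(2 * c * ceil_plus (ln c) + 2 * \<omega> * c + 1) powr e * \<epsilon> powr (- \<omega> * e) * ln (1 / \<epsilon>) powr e \<le> n"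
    and n2: "(4 * \<alpha>) powr e * \<epsilon> powr (- \<omega> * e) \<le> n"
  shows "(\<alpha> + \<beta> * ln n) / n powr (1 / e) \<le> \<epsilon> powr \<omega> / 2"
proof -
  define x where "x = n powr (1 / e)"
  define l where "l = ln (1 / \<epsilon>)"
  define E where "E = \<epsilon> powr (- \<omega>)"
  define B where "B = 2 * c * ceil_plus (ln c) + 2 * \<omega> * c + 1"
  have x: "0 < x" using pos by (simp add: x_def)
  have c: "0 < c" using pos by (simp add: c_def)
  have E: "0 < E" "\<epsilon> powr \<omega> = 1 / E" using pos by (simp_all add: E_def powr_minus field_simps)
  have l1: "1 \<le> l" using l by (simp add: l_def)
  have cp: "0 \<le> real_of_int (ceil_plus t)" "t \<le> real_of_int (ceil_plus t)" for t
    by (auto simp: ceil_plus_def) linarith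
  have B: "0 < B" using c pos cp(1)[of "ln c"] by (simp add: B_def add_nonneg_pos)
  have root: "y \<le> x" if "y powr e \<le> n" "0 \<le> y" for y
  proof -
    have "(y powr e) powr (1 / e) \<le> n powr (1 / e)" using that pos by (intro powr_mono2) auto
    then show ?thesis using that pos by (simp add: x_def powr_powr)
  qed
  have "(B * E * l) powr e \<le> n"
    using n1 by (simp add: powr_mult E_def powr_powr B_def l_def)
  then have xB: "B * E * l \<le> x" using B E l1 by (intro root) auto
  have "(4 * \<alpha> * E) powr e \<le> n"
    using n2 by (simp add: powr_mult E_def powr_powr)
  then have x\<alpha>: "4 * \<alpha> * E \<le> x" using pos E by (intro root) auto
  have "c * E * ln x \<le> x"
  proof (rule log_le_linear)
    have "ln (c * E) = ln c + \<omega> * l"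
      using c pos by (simp add: E_def ln_mult ln_powr l_def ln_div)
    also have "\<dots> \<le> ceil_plus (ln c) * l + \<omega> * l"
      using cp[of "ln c"] mult_left_mono[OF l1 cp(1)[of "ln c"]] by simp
    finally have "2 * (c * E) * ln (c * E) \<le> 2 * (c * E) * (ceil_plus (ln c) * l + \<omega> * l)"
      using c E by (intro mult_left_mono) auto
    also have "\<dots> = (B - 1) * E * l" by (simp add: B_def algebra_simps)
    also have "\<dots> \<le> B * E * l" using E l1 by (intro mult_right_mono) auto
    finally show "2 * (c * E) * ln (c * E) \<le> x" using xB by simp
  qed (use c E x in auto)
  moreover have "ln n = e * ln x" using pos by (simp add: x_def ln_powr)
  ultimately have "4 * (\<beta> * ln n) * E \<le> x" by (simp add: c_def mult_ac)
  with x\<alpha> have "(\<alpha> + \<beta> * ln n) * (2 * E) \<le> x" by (simp add: algebra_simps)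
  then have "(\<alpha> + \<beta> * ln n) / x \<le> 1 / (2 * E)"
    using x E by (simp add: field_simps)
  then show ?thesis by (simp add: E(2) x_def)
qed

text \<open>Restricting the average to the last half of the indices loses a factor \<open>2\<close>, but makes the index found
  proportional to \<open>n\<close>.\<close>
lemma exists_small_in_second_half:
  fixes h :: "nat \<Rightarrow> real"
  assumes n: "0 < n" and h: "\<And>k. k < n \<Longrightarrow> 0 \<le> h k" and sum: "(\<Sum>k<n. h k) \<le> Q / 2"
  shows "\<exists>k<n. real n / 2 \<le> real (k + 1) \<and> h k \<le> Q / real n"
proof (rule ccontr)
  assume neg: "\<not> ?thesis"
  have big: "Q / real n < h k" if "k \<in> {n div 2..<n}" for k
  proof -
    have "n \<le> 2 * (k + 1)" using that by auto
    then have "real n \<le> real (2 * (k + 1))" by (simp only: of_nat_le_iff)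
    then have "real n / 2 \<le> real (k + 1)" by simp
    then show ?thesis using neg that by (meson atLeastLessThan_iff not_le)
  qed
  have "0 \<le> (\<Sum>k<n. h k)" using h by (intro sum_nonneg) auto
  then have Q: "0 \<le> Q" using sum by simp
  have "(real n / 2) * (Q / real n) \<le> real (card {n div 2..<n}) * (Q / real n)"
  proof (rule mult_right_mono)
    have "n \<le> 2 * card {n div 2..<n}" by simp
    then have "real n \<le> real (2 * card {n div 2..<n})" by (simp only: of_nat_le_iff)
    then show "real n / 2 \<le> real (card {n div 2..<n})" by simp
  qed (use Q in simp)
  also have "\<dots> = (\<Sum>k\<in>{n div 2..<n}. Q / real n)" by simp
  also have "\<dots> < (\<Sum>k\<in>{n div 2..<n}. h k)"
    using n big by (intro sum_strict_mono) auto
  also have "\<dots> \<le> (\<Sum>k<n. h k)" using h by (intro sum_mono2) auto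
  finally show False using sum n by simp
qed

section \<open>Decay rates under the Kurdyka-Lojasiewicz inequality\<close>

text \<open>The case \<open>\<theta> = 1 / 2\<close>. The weakening \<open>ln (1 + \<beta>) \<ge> \<beta> / (1 + \<beta>)\<close> produces the factor \<open>(1 + \<beta>) / \<beta>\<close>.\<close>
lemma geometric_decay_steps:
  fixes g :: "nat \<Rightarrow> real"
  assumes \<beta>: "0 < \<beta>" and step: "\<And>k. k < m \<Longrightarrow> (1 + \<beta>) * g (Suc k) \<le> g k"
    and R: "g 0 \<le> R" and T: "0 < T" "T < g m"
  shows "real m < (1 + \<beta>) / \<beta> * ln (R / T)"
proof -
  have "g k * (1 + \<beta>) ^ k \<le> g 0" if "k \<le> m" for k
    using that
  proof (induction k)
    case (Suc k)
    have "g (Suc k) * (1 + \<beta>) ^ Suc k = ((1 + \<beta>) * g (Suc k)) * (1 + \<beta>) ^ k" by simp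
    also have "\<dots> \<le> g k * (1 + \<beta>) ^ k" using step[of k] Suc \<beta> by (intro mult_right_mono) auto
    also have "\<dots> \<le> g 0" using Suc by simp
    finally show ?case .
  qed simp
  then have "T * (1 + \<beta>) ^ m < R"
    using T R \<beta> by (smt (verit) mult_strict_right_mono zero_less_power order_refl)
  then have "(1 + \<beta>) ^ m < R / T" using T by (simp add: field_simps)
  then have "ln ((1 + \<beta>) ^ m) < ln (R / T)" using \<beta> by (intro ln_less_cancel_iff[THEN iffD2]) (auto intro: less_trans[of 0 "(1 + \<beta>) ^ m"])
  then have 1: "real m * ln (1 + \<beta>) < ln (R / T)" using \<beta> by (simp add: ln_realpow)
  have "ln (1 / (1 + \<beta>)) \<le> 1 / (1 + \<beta>) - 1" using \<beta> by (intro ln_le_minus_one) auto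
  then have "\<beta> / (1 + \<beta>) \<le> ln (1 + \<beta>)" using \<beta> by (simp add: ln_div field_simps)
  then have "real m * (\<beta> / (1 + \<beta>)) \<le> real m * ln (1 + \<beta>)" by (intro mult_left_mono) auto
  then have "real m * (\<beta> / (1 + \<beta>)) < ln (R / T)" using 1 by simp
  then show ?thesis using \<beta> by (simp add: field_simps)
qed

text \<open>Each step increases \<open>g powr (1 - 2 \<theta>)\<close> by at least \<open>\<kappa>\<close>: if \<open>g\<close> shrinks by less than the factor
  \<open>2 powr (- 1 / (2 \<theta>))\<close>, this comes from the decay inequality and the tangent of
  \<open>powr (1 - 2 \<theta>)\<close>, and otherwise from the size of the drop itself.\<close>

lemma sublinear_decay_steps:
  fixes g :: "nat \<Rightarrow> real"
  assumes \<theta>: "1 / 2 < \<theta>" "\<theta> < 1" and \<beta>: "0 < \<beta>" and pos: "\<And>k. k \<le> m \<Longrightarrow> 0 < g k"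
    and step: "\<And>k. k < m \<Longrightarrow> \<beta> * g (Suc k) powr (2 * \<theta>) \<le> g k - g (Suc k)"
    and R: "g 0 \<le> R" and T: "0 < T" "T < g m"
    and \<kappa>: "\<kappa> \<le> (2 * \<theta> - 1) * \<beta> / 2" "\<kappa> \<le> (2 powr ((2 * \<theta> - 1) / (2 * \<theta>)) - 1) * R powr (1 - 2 * \<theta>)"
  shows "real m * \<kappa> < (1 / T) powr (2 * \<theta> - 1)"
proof -
  have dec: "g (Suc k) \<le> g k" if "k < m" for k
    using step[OF that] \<beta> by (smt (verit) mult_nonneg_nonneg powr_ge_zero)
  have gR: "g k \<le> R" if "k \<le> m" for k
    using that
  proof (induction k)
    case (Suc k) then show ?case using dec[of k] by simp
  qed (use R in simp)
  have inc: "g k powr (1 - 2 * \<theta>) + \<kappa> \<le> g (Suc k) powr (1 - 2 * \<theta>)" if k: "k < m" for k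
  proof -
    define a b where "a = g k" and "b = g (Suc k)"
    have ab: "0 < a" "0 < b" "b \<le> a" "a \<le> R" using pos[of k] pos[of "Suc k"] dec[OF k] gR[of k] k
      by (auto simp: a_def b_def)
    have st: "\<beta> * b powr (2 * \<theta>) \<le> a - b" using step[OF k] by (simp add: a_def b_def)
    show ?thesis
    proof (cases "a powr (2 * \<theta>) \<le> 2 * b powr (2 * \<theta>)")
      case True
      \<comment> \<open>The tangent of the convex function \<open>powr (1 - 2 \<theta>)\<close> at \<open>a\<close>.\<close>
      have tangent: "(2 * \<theta> - 1) * a powr (- 2 * \<theta>) * (a - b) \<le> b powr (1 - 2 * \<theta>) - a powr (1 - 2 * \<theta>)"
      proof -
        define u where "u = (b / a) powr (1 - 2 * \<theta>)"
        have u: "u > 0" using ab by (simp add: u_def)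
        have "u powr (1 / (2 * \<theta>)) * (b / a) powr ((2 * \<theta> - 1) / (2 * \<theta>))
            \<le> 1 / (2 * \<theta>) * u + (2 * \<theta> - 1) / (2 * \<theta>) * (b / a)"
          using ab u \<theta> by (intro Youngs_inequality_0) (auto simp: field_simps)
        moreover have "u powr (1 / (2 * \<theta>)) * (b / a) powr ((2 * \<theta> - 1) / (2 * \<theta>)) = 1"
          using ab by (simp add: u_def powr_powr powr_add[symmetric] add_divide_distrib[symmetric])
        moreover have "1 / (2 * \<theta>) * u + (2 * \<theta> - 1) / (2 * \<theta>) * (b / a)
            = (u + (2 * \<theta> - 1) * (b / a)) / (2 * \<theta>)" by (simp add: add_divide_distrib)
        ultimately have "1 \<le> (u + (2 * \<theta> - 1) * (b / a)) / (2 * \<theta>)" by simp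
        then have "2 * \<theta> \<le> u + (2 * \<theta> - 1) * (b / a)" using \<theta> by (simp only: le_divide_eq) auto
        then have "(2 * \<theta> - 1) * (1 - b / a) \<le> u - 1" by (simp add: algebra_simps)
        then have "a powr (1 - 2 * \<theta>) * ((2 * \<theta> - 1) * (1 - b / a)) \<le> a powr (1 - 2 * \<theta>) * (u - 1)"
          by (intro mult_left_mono) auto
        moreover have "a powr (1 - 2 * \<theta>) * u = b powr (1 - 2 * \<theta>)"
          using ab by (simp add: u_def powr_divide)
        moreover have "a powr (1 - 2 * \<theta>) * ((2 * \<theta> - 1) * (1 - b / a))
            = (2 * \<theta> - 1) * a powr (- 2 * \<theta>) * (a - b)"
        proof -
          have "a powr (1 - 2 * \<theta>) = a powr (- 2 * \<theta>) * a"
            using ab by (simp add: powr_diff powr_minus field_simps)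
          moreover have "a - b = a * (1 - b / a)" using ab by (simp add: field_simps)
          ultimately show ?thesis by (simp only: mult_ac)
        qed
        ultimately show ?thesis by (simp add: right_diff_distrib)
      qed
      have "(2 * \<theta> - 1) * \<beta> / 2 = (2 * \<theta> - 1) * a powr (- 2 * \<theta>) * (\<beta> * (a powr (2 * \<theta>) / 2))"
        using ab by (simp add: powr_minus field_simps)
      also have "\<dots> \<le> (2 * \<theta> - 1) * a powr (- 2 * \<theta>) * (\<beta> * b powr (2 * \<theta>))"
        using True \<theta> \<beta> by (intro mult_left_mono) auto
      also have "\<dots> \<le> (2 * \<theta> - 1) * a powr (- 2 * \<theta>) * (a - b)"
        using st \<theta> by (intro mult_left_mono) auto
      also note tangent
      finally show ?thesis using \<kappa>(1) by (simp add: a_def b_def)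
    next
      case False
      then have lt: "2 * b powr (2 * \<theta>) \<le> a powr (2 * \<theta>)" by simp
      let ?e = "(1 - 2 * \<theta>) / (2 * \<theta>)"
      have "(a powr (2 * \<theta>)) powr ?e \<le> (2 * b powr (2 * \<theta>)) powr ?e"
        using lt ab \<theta> by (intro powr_mono2') (auto simp: field_simps)
      moreover have "(a powr (2 * \<theta>)) powr ?e = a powr (1 - 2 * \<theta>)"
        "(2 * b powr (2 * \<theta>)) powr ?e = 2 powr ?e * b powr (1 - 2 * \<theta>)"
        using \<theta> by (simp_all add: powr_mult powr_powr)
      ultimately have "a powr (1 - 2 * \<theta>) \<le> 2 powr ?e * b powr (1 - 2 * \<theta>)" by simp
      then have "2 powr ((2 * \<theta> - 1) / (2 * \<theta>)) * a powr (1 - 2 * \<theta>)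
          \<le> 2 powr ((2 * \<theta> - 1) / (2 * \<theta>)) * (2 powr ?e * b powr (1 - 2 * \<theta>))"
        by (intro mult_left_mono) auto
      also have "\<dots> = b powr (1 - 2 * \<theta>)"
        by (simp add: mult.assoc[symmetric] powr_add[symmetric] add_divide_distrib[symmetric])
      finally have 1: "(2 powr ((2 * \<theta> - 1) / (2 * \<theta>)) - 1) * a powr (1 - 2 * \<theta>)
          \<le> b powr (1 - 2 * \<theta>) - a powr (1 - 2 * \<theta>)" by (simp add: algebra_simps)
      have "R powr (1 - 2 * \<theta>) \<le> a powr (1 - 2 * \<theta>)" using ab \<theta> by (intro powr_mono2') auto
      moreover have "1 \<le> 2 powr ((2 * \<theta> - 1) / (2 * \<theta>))" using \<theta> by (intro ge_one_powr_ge_zero) auto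
      ultimately have "(2 powr ((2 * \<theta> - 1) / (2 * \<theta>)) - 1) * R powr (1 - 2 * \<theta>)
          \<le> (2 powr ((2 * \<theta> - 1) / (2 * \<theta>)) - 1) * a powr (1 - 2 * \<theta>)"
        by (intro mult_left_mono) auto
      then show ?thesis using 1 \<kappa>(2) by (simp add: a_def b_def)
    qed
  qed
  have "g 0 powr (1 - 2 * \<theta>) + real k * \<kappa> \<le> g k powr (1 - 2 * \<theta>)" if "k \<le> m" for k
    using that
  proof (induction k)
    case (Suc k) then show ?case using inc[of k] by (simp add: algebra_simps)
  qed simp
  moreover have "0 < g 0 powr (1 - 2 * \<theta>)" using pos[of 0] by simp
  ultimately have "real m * \<kappa> < g m powr (1 - 2 * \<theta>)" by (smt (verit) order_refl)
  also have "\<dots> \<le> T powr (1 - 2 * \<theta>)" using T \<theta> by (intro powr_mono2') auto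
  also have "\<dots> = (1 / T) powr (2 * \<theta> - 1)" using T by (simp add: powr_divide powr_diff field_simps)
  finally show ?thesis .
qed

section \<open>Runs of the subroutine\<close>

lemma pg_run_of_sequence:
  assumes "\<And>k. k \<le> n \<Longrightarrow> \<exists>i\<le>I. pg_step g q lam \<rho> (zs k) i (zs (Suc k))"
    and "\<And>k. k < n \<Longrightarrow> \<tau> < norm (zs (Suc k) - zs k)"
    and "norm (zs (Suc n) - zs n) \<le> \<tau>"
  shows "\<exists>N. pg_run g q lam \<rho> \<tau> (zs 0) (zs (Suc n)) N (n + 1) \<and> N \<le> (I + 1) * (n + 1)"
  using assms
proof (induction n arbitrary: zs)
  case 0
  then obtain i where "i \<le> I" "pg_step g q lam \<rho> (zs 0) i (zs (Suc 0))" by blast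
  then show ?case using pg_run.stop[of g q lam \<rho> "zs 0" i "zs (Suc 0)" \<tau>] 0(3) by auto
next
  case (Suc n)
  have "\<exists>N. pg_run g q lam \<rho> \<tau> (zs (Suc 0)) (zs (Suc (Suc n))) N (n + 1) \<and> N \<le> (I + 1) * (n + 1)"
    using Suc.IH[of "\<lambda>k. zs (Suc k)"] Suc.prems by simp
  then obtain N where N: "pg_run g q lam \<rho> \<tau> (zs (Suc 0)) (zs (Suc (Suc n))) N (n + 1)" "N \<le> (I + 1) * (n + 1)"
    by blast
  obtain i where i: "i \<le> I" "pg_step g q lam \<rho> (zs 0) i (zs (Suc 0))" using Suc.prems(1)[of 0] by blast
  have "pg_run g q lam \<rho> \<tau> (zs 0) (zs (Suc (Suc n))) (i + 1 + N) (1 + (n + 1))"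
    using i(2) N(1) Suc.prems(2)[of 0] by (intro pg_run.step) auto
  moreover have "i + 1 + N \<le> (I + 1) * (Suc n + 1)" using i(1) N(2) by simp
  ultimately show ?case by (metis Suc_eq_plus1 plus_1_eq_Suc)
qed

section \<open>The minimax problem over the reals\<close>

locale minimax_problem =
  fixes f :: "'a::euclidean_space \<times> 'b::euclidean_space \<Rightarrow> real"
    and p :: "'a \<Rightarrow> ereal" and q :: "'b \<Rightarrow> ereal"
    and Lf Lg C \<theta> \<gamma> \<sigma> :: real
  assumes standing: "standing_assumption f p q Lf Lg C \<theta> \<gamma> \<sigma>"
begin

abbreviation "X \<equiv> edom p"
abbreviation "Y \<equiv> edom q"

text \<open>Real versions of the data. They are meaningful for \<open>x \<in> X\<close> and \<open>y \<in> Y\<close> only, where all values are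
  finite.\<close>
definition pr :: "'a \<Rightarrow> real" where "pr x = real_of_ereal (p x)"
definition qr :: "'b \<Rightarrow> real" where "qr y = real_of_ereal (q y)"
definition Fs :: "'a \<Rightarrow> real" where "Fs x = real_of_ereal (Fmax f q x)"
definition gap :: "'a \<Rightarrow> 'b \<Rightarrow> real" where "gap x y = Fs x - f (x, y) + qr y"
definition gx :: "'a \<Rightarrow> 'b \<Rightarrow> 'a" where "gx x y = fst (grad f (x, y))"
definition gy :: "'a \<Rightarrow> 'b \<Rightarrow> 'b" where "gy x y = snd (grad f (x, y))"

lemma constants: "0 < Lf" "0 < Lg" "0 < C" "1/2 \<le> \<theta>" "\<theta> < 1" "0 < \<gamma>" "0 < \<sigma>"
  and pcc: "proper_closed_convex p" "proper_closed_convex q"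
  using standing by (auto simp: standing_assumption_def)

lemma GDERIV_f: "GDERIV f z :> grad f z"
  using standing by (intro GDERIV_grad, cases z) (simp add: standing_assumption_def differentiable_on_def)

lemma GDERIV_gx: "GDERIV (\<lambda>u. f (u, y)) x :> gx x y"
  unfolding gx_def by (intro GDERIV_fst GDERIV_f)

lemma GDERIV_gy: "GDERIV (\<lambda>u. f (x, u)) y :> gy x y"
  unfolding gy_def by (intro GDERIV_snd GDERIV_f)

lemma grad_partial:
  "grad (\<lambda>u. f (u, y)) x = gx x y" "grad (\<lambda>u. f (x, u)) y = gy x y"
  "grad (\<lambda>u. - f (x, u)) y = - gy x y"
  by (intro grad_eqI GDERIV_gx GDERIV_gy GDERIV_minus)+

lemma continuous_f: "continuous_on UNIV (\<lambda>y. f (x, y))"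
proof -
  have "continuous_on UNIV f"
    using standing by (intro differentiable_imp_continuous_on) (simp add: standing_assumption_def)
  then show ?thesis by (rule continuous_on_compose2) (auto intro!: continuous_intros)
qed

lemma grad_lip:
  assumes "x \<in> X" "x' \<in> X" "y \<in> Y" "y' \<in> Y"
  shows "norm (gx x y - gx x' y') \<le> Lg * norm (x - x') + Lg * norm (y - y')"
    and "norm (gy x y - gy x' y') \<le> Lg * norm (x - x') + Lg * norm (y - y')"
proof -
  have "Lg-lipschitz_on (X \<times> Y) (grad f)" using standing by (simp add: standing_assumption_def)
  then have "dist (grad f (x, y)) (grad f (x', y')) \<le> Lg * dist (x, y) (x', y')"
    using assms by (intro lipschitz_onD) auto
  also have "dist (x, y) (x', y') \<le> norm (x - x') + norm (y - y')"
    using norm_Pair_le[of "x - x'" "y - y'"] by (simp add: dist_norm)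
  finally have *: "norm (grad f (x, y) - grad f (x', y')) \<le> Lg * (norm (x - x') + norm (y - y'))"
    using constants by (simp add: dist_norm)
  have **: "norm (fst D) \<le> norm D" "norm (snd D) \<le> norm D" for D :: "'a \<times> 'b"
    by (cases D; simp add: norm_fst_le norm_snd_le)+
  show "norm (gx x y - gx x' y') \<le> Lg * norm (x - x') + Lg * norm (y - y')"
    using **(1)[of "grad f (x, y) - grad f (x', y')"] * by (simp add: gx_def distrib_left)
  show "norm (gy x y - gy x' y') \<le> Lg * norm (x - x') + Lg * norm (y - y')"
    using **(2)[of "grad f (x, y) - grad f (x', y')"] * by (simp add: gy_def distrib_left)
qed

lemma p_real: "x \<in> X \<Longrightarrow> p x = ereal (pr x)"
  using real_edom[OF pcc(1)] by (simp add: pr_def)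

lemma q_real: "y \<in> Y \<Longrightarrow> q y = ereal (qr y)"
  using real_edom[OF pcc(2)] by (simp add: qr_def)

lemma Fobj_real: "y \<in> Y \<Longrightarrow> Fobj f q x y = ereal (f (x, y) - qr y)"
  by (simp add: Fobj_def q_real)

lemma Fobj_infinite: "y \<notin> Y \<Longrightarrow> Fobj f q x y = - \<infinity>"
  by (simp add: Fobj_def edom_def)

lemma Fmax_real: "x \<in> X \<Longrightarrow> Fmax f q x = ereal (Fs x)"
  using standing by (simp add: Fs_def standing_assumption_def ereal_real')

lemma Psi_real: "x \<in> X \<Longrightarrow> Psi f p q x = ereal (Fs x + pr x)"
  by (simp add: Psi_def Fmax_real p_real)

lemma Y_nonempty: "Y \<noteq> {}"
  using pcc(2) by (simp add: proper_closed_convex_def)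

lemma Fmax_ge: "y \<in> Y \<Longrightarrow> ereal (f (x, y) - qr y) \<le> Fmax f q x"
  unfolding Fmax_def using Fobj_real by (metis SUP_upper UNIV_I)

lemma Psi_infinite:
  assumes "x \<notin> X" shows "Psi f p q x = \<infinity>"
proof -
  obtain y where "y \<in> Y" using Y_nonempty by blast
  then have "Fmax f q x \<noteq> - \<infinity>" using Fmax_ge[of y x] by auto
  then show ?thesis using assms by (simp add: Psi_def edom_def)
qed

lemma edom_Psi: "edom (Psi f p q) = X"
  using Psi_real Psi_infinite by (force simp: edom_def[of "Psi f p q"])

lemma gap_ereal: "x \<in> X \<Longrightarrow> y \<in> Y \<Longrightarrow> Fmax f q x - Fobj f q x y = ereal (gap x y)"
  by (simp add: Fmax_real Fobj_real gap_def)

lemma gap_nonneg: "x \<in> X \<Longrightarrow> y \<in> Y \<Longrightarrow> 0 \<le> gap x y"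
  using Fmax_ge[of y x] by (simp add: Fmax_real gap_def)

lemma Ymax_iff: "x \<in> X \<Longrightarrow> y \<in> Ymax f q x \<longleftrightarrow> y \<in> Y \<and> gap x y = 0"
  by (cases "y \<in> Y") (auto simp: Ymax_def Fmax_real Fobj_real Fobj_infinite gap_def)

lemma Ymax_nonempty: "x \<in> X \<Longrightarrow> Ymax f q x \<noteq> {}"
  using standing by (simp add: standing_assumption_def)

lemma Ymax_D: "x \<in> X \<Longrightarrow> y \<in> Ymax f q x \<Longrightarrow> y \<in> Y" "x \<in> X \<Longrightarrow> y \<in> Ymax f q x \<Longrightarrow> gap x y = 0"
  by (simp_all add: Ymax_iff)

lemma closed_gap_epigraph: "closed {(y, t). y \<in> Y \<and> gap x y \<le> t}"
proof -
  have "closed {z \<in> UNIV. q (fst z) \<le> ereal (f (x, fst z) - Fs x + snd z)}"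
    by (intro closed_sublevel[OF pcc(2)])
       (auto intro!: continuous_intros continuous_on_compose2[OF continuous_f])
  also have "{z \<in> UNIV. q (fst z) \<le> ereal (f (x, fst z) - Fs x + snd z)}
      = {(y, t). y \<in> Y \<and> gap x y \<le> t}"
  proof (intro set_eqI, clarify)
    fix y t
    show "(y, t) \<in> {z \<in> UNIV. q (fst z) \<le> ereal (f (x, fst z) - Fs x + snd z)}
      \<longleftrightarrow> (y, t) \<in> {(y, t). y \<in> Y \<and> gap x y \<le> t}"
    proof (cases "y \<in> Y")
      case True
      then show ?thesis by (auto simp: q_real gap_def)
    next
      case False
      then show ?thesis by (simp add: edom_def)
    qed
  qed
  finally show ?thesis .
qed

lemma closed_Ymax:
  assumes "x \<in> X" shows "closed (Ymax f q x)"
proof -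
  have "closed ((\<lambda>y. (y, 0)) -` {(y, t). y \<in> Y \<and> gap x y \<le> t})"
    by (intro closed_vimage closed_gap_epigraph continuous_intros)
  moreover have "(\<lambda>y. (y, 0)) -` {(y, t). y \<in> Y \<and> gap x y \<le> t} = Ymax f q x"
    using gap_nonneg[OF assms] by (force simp: Ymax_iff[OF assms])
  ultimately show ?thesis by simp
qed

lemma f_lip:
  assumes "x \<in> X" "x' \<in> X" "y \<in> Y"
  shows "f (x, y) \<le> f (x', y) + Lf * norm (x - x')"
proof -
  have "Lf-lipschitz_on X (\<lambda>x. f (x, y))" using standing assms by (simp add: standing_assumption_def)
  from lipschitz_onD[OF this assms(1,2)] show ?thesis by (simp add: dist_norm)
qed

text \<open>Both \<open>F\<^sup>*\<close> and \<open>f (\<cdot>, y)\<close> change by at most \<open>Lf * norm (x - x')\<close>.\<close>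
lemma gap_shift:
  assumes x: "x \<in> X" "x' \<in> X" and y: "y \<in> Y"
  shows "gap x' y \<le> gap x y + 2 * Lf * norm (x - x')"
proof -
  obtain u where u: "u \<in> Ymax f q x'" using Ymax_nonempty x by blast
  have uY: "u \<in> Y" and "gap x' u = 0" using u x Ymax_D by auto
  then have "Fs x' = f (x', u) - qr u" by (simp add: gap_def)
  also have "\<dots> \<le> f (x, u) - qr u + Lf * norm (x - x')"
    using f_lip[OF x(2,1) uY] by (simp add: norm_minus_commute)
  also have "\<dots> \<le> Fs x + Lf * norm (x - x')"
    using gap_nonneg[OF x(1) uY] by (simp add: gap_def)
  finally show ?thesis using f_lip[OF x y] by (simp add: gap_def)
qed

section \<open>Proximal gradient steps\<close>

text \<open>Strong convexity of the model gives the decrease \<open>1 / \<mu>\<close> in place of \<open>1 / (2 \<mu>)\<close> in the third claim;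
  this is why step sizes up to \<open>1 / Lg\<close> are accepted.\<close>
lemma pg_trial_step:
  fixes x z \<mu>
  defines "w \<equiv> pg_trial (\<lambda>u. - f (x, u)) q \<mu> z"
  defines "v \<equiv> gy x z - (1 / \<mu>) *\<^sub>R (w - z)"
  assumes x: "x \<in> X" and z: "z \<in> Y" and \<mu>: "0 < \<mu>"
  shows "w \<in> Y" "v \<in> lim_subdiff q w"
    "gap x w \<le> gap x z - (1 / \<mu> - Lg / 2) * (norm (w - z))\<^sup>2"
    "norm (gy x w - v) \<le> (Lg + 1 / \<mu>) * norm (w - z)"
proof -
  let ?h = "\<lambda>u. (- gy x z) \<bullet> u + (1 / \<mu>) / 2 * (norm (u - z))\<^sup>2"
  have w_eq: "w = arg_min (\<lambda>u. ereal (?h u) + q u) (\<lambda>_. True)"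
    by (simp add: w_def pg_trial_def grad_partial mult.commute)
  have ex: "\<exists>w\<in>Y. True \<and> (\<forall>u\<in>Y. True \<longrightarrow> ?h w + real_of_ereal (q w) \<le> ?h u + real_of_ereal (q u))"
    using prox_attained[OF pcc(2) z, of "1 / \<mu>" "- gy x z"] \<mu> by simp
  show wY: "w \<in> Y" unfolding w_eq by (rule arg_min_ereal(1)[OF pcc(2) ex])
  have wmin: "?h w + real_of_ereal (q w) \<le> ?h u + real_of_ereal (q u)" if "u \<in> Y" for u
    unfolding w_eq by (rule arg_min_ereal(3)[OF pcc(2) ex that]) simp
  have var: "qr w + v \<bullet> (u - w) \<le> qr u" if "u \<in> Y" for u
    using prox_variational[OF pcc(2), of UNIV w "- gy x z" "1 / \<mu>" z u] wmin wY that
    by (simp add: v_def qr_def)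
  show "v \<in> lim_subdiff q w"
    using convex_subgradient_in_lim_subdiff[OF pcc(2) wY] var by (simp add: qr_def)
  have seg: "z + t *\<^sub>R (w - z) \<in> Y" if "t \<in> {0..1}" for t
    using proper_closed_convex_ineq(1)[OF pcc(2) wY z] that by simp
  have "- f (x, z + (w - z)) \<le> - f (x, z) + (- gy x (z + 0 *\<^sub>R (w - z))) \<bullet> (w - z) + Lg / 2 * (norm (w - z))\<^sup>2"
  proof (rule gradient_upper_bound[where g = "\<lambda>u. - f (x, u)" and G = "\<lambda>t. - gy x (z + t *\<^sub>R (w - z))"])
    show "GDERIV (\<lambda>u. - f (x, u)) (z + t *\<^sub>R (w - z)) :> - gy x (z + t *\<^sub>R (w - z))" for t
      by (intro GDERIV_minus GDERIV_gy)
    show "norm (- gy x (z + t *\<^sub>R (w - z)) - - gy x (z + 0 *\<^sub>R (w - z))) \<le> Lg * (t * norm (w - z))"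
      if t: "t \<in> {0..1}" for t
      using grad_lip(2)[OF x x seg[OF t] z] t by (simp add: norm_minus_commute)
  qed
  then have "- f (x, w) \<le> - f (x, z) - gy x z \<bullet> (w - z) + Lg / 2 * (norm (w - z))\<^sup>2" by simp
  moreover have "qr w + gy x z \<bullet> (z - w) + (1 / \<mu>) * (norm (w - z))\<^sup>2 \<le> qr z"
  proof -
    have "(w - z) \<bullet> (z - w) = - (norm (w - z))\<^sup>2"
      by (simp add: power2_norm_eq_inner inner_diff_left inner_diff_right)
    then have "v \<bullet> (z - w) = gy x z \<bullet> (z - w) + (1 / \<mu>) * (norm (w - z))\<^sup>2"
      by (simp add: v_def inner_diff_left)
    then show ?thesis using var[OF z] by simp
  qed
  ultimately show "gap x w \<le> gap x z - (1 / \<mu> - Lg / 2) * (norm (w - z))\<^sup>2"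
    by (simp add: gap_def left_diff_distrib inner_diff_right)
  have "norm (gy x w - v) \<le> norm (gy x w - gy x z) + norm ((1 / \<mu>) *\<^sub>R (w - z))"
    unfolding v_def by (metis add_diff_eq diff_diff_eq2 diff_add_eq norm_triangle_ineq)
  also have "\<dots> \<le> Lg * norm (w - z) + (1 / \<mu>) * norm (w - z)"
    using grad_lip(2)[OF x x wY z] \<mu> by simp
  finally show "norm (gy x w - v) \<le> (Lg + 1 / \<mu>) * norm (w - z)" by (simp add: distrib_right)
qed

lemma pg_accept_iff:
  fixes x z \<mu>
  defines "w \<equiv> pg_trial (\<lambda>u. - f (x, u)) q \<mu> z"
  assumes x: "x \<in> X" and z: "z \<in> Y" and \<mu>: "0 < \<mu>"
  shows "pg_accept (\<lambda>u. - f (x, u)) q \<mu> z \<longleftrightarrow> gap x w + (norm (w - z))\<^sup>2 / (2 * \<mu>) \<le> gap x z"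
proof -
  have "w \<in> Y" using pg_trial_step(1)[OF x z \<mu>] by (simp add: w_def)
  then show ?thesis using z
    by (auto simp: pg_accept_def Let_def w_def[symmetric] q_real gap_def)
qed

lemma pg_accept_small:
  assumes x: "x \<in> X" and z: "z \<in> Y" and \<mu>: "0 < \<mu>" "\<mu> \<le> 1 / Lg"
  shows "pg_accept (\<lambda>u. - f (x, u)) q \<mu> z"
proof -
  let ?w = "pg_trial (\<lambda>u. - f (x, u)) q \<mu> z"
  have "Lg \<le> 1 / \<mu>" using \<mu> constants by (simp add: field_simps)
  then have "(1 / (2 * \<mu>)) * (norm (?w - z))\<^sup>2 \<le> (1 / \<mu> - Lg / 2) * (norm (?w - z))\<^sup>2"
    by (intro mult_right_mono) auto
  then show ?thesis using pg_trial_step(3)[OF x z \<mu>(1)] pg_accept_iff[OF x z \<mu>(1)] by simp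
qed

text \<open>A maximiser is a fixed point of a proximal gradient step, so the subgradient which the step
  produces is the gradient itself.\<close>

lemma Ymax_gradient_subgradient:
  assumes x: "x \<in> X" and y: "y \<in> Ymax f q x"
  shows "gy x y \<in> lim_subdiff q y"
proof -
  let ?w = "pg_trial (\<lambda>u. - f (x, u)) q (1 / Lg) y"
  have yY: "y \<in> Y" and g0: "gap x y = 0" using Ymax_D[OF x y] by auto
  have \<mu>: "0 < 1 / Lg" using constants by simp
  note step = pg_trial_step[OF x yY \<mu>]
  have "Lg / 2 * (norm (?w - y))\<^sup>2 \<le> 0"
    using step(3) g0 gap_nonneg[OF x step(1)] by simp
  then have "(norm (?w - y))\<^sup>2 \<le> 0" using constants by (simp add: mult_le_0_iff)
  then have "?w = y" by simp
  then show ?thesis using step(2) by simp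
qed

section \<open>Error bound and Hoelder continuity\<close>

text \<open>The Kurdyka-Lojasiewicz inequality on the region \<open>0 < gap x y \<le> R\<close>. It holds with \<open>R = \<gamma> \<epsilon>\<^sup>\<sigma>\<close> if \<open>x\<close> is
  not \<open>\<epsilon>\<close>-stationary; at the initial point, where this may fail, it is used with a smaller \<open>R\<close>.\<close>
definition KL_at :: "'a \<Rightarrow> real \<Rightarrow> bool" where
  "KL_at x R \<longleftrightarrow> (\<forall>y\<in>Y. \<forall>v\<in>lim_subdiff q y.
     0 < gap x y \<longrightarrow> gap x y \<le> R \<longrightarrow> C * gap x y powr \<theta> \<le> norm (gy x y - v))"

lemma KL_atD:
  "KL_at x R \<Longrightarrow> y \<in> Y \<Longrightarrow> v \<in> lim_subdiff q y \<Longrightarrow> 0 < gap x y \<Longrightarrow> gap x y \<le> R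
    \<Longrightarrow> C * gap x y powr \<theta> \<le> norm (gy x y - v)"
  by (simp add: KL_at_def)

lemma KL_region_norm:
  assumes x: "x \<in> X" and y: "y \<in> KL_region f p q \<gamma> \<sigma> x" "y \<in> Y" and v: "v \<in> lim_subdiff q y"
  shows "C * gap x y powr \<theta> \<le> norm (gy x y - v)"
proof -
  have "ereal C * epow (Fmax f q x - Fobj f q x y) \<theta> \<le> edist 0 (subdiff_y f q x y)"
    using standing x y(1) by (simp add: standing_assumption_def)
  also have "\<dots> \<le> ereal (dist 0 (gy x y - v))"
    unfolding edist_def using v by (intro INF_lower) (auto simp: subdiff_y_def grad_partial)
  finally show ?thesis by (simp add: gap_ereal[OF x y(2)] epow_def)
qed

lemma KL_at_region:
  assumes x: "x \<in> X" and y: "y \<in> KL_region f p q \<gamma> \<sigma> x" "y \<in> Y"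
  shows "KL_at x (gap x y)"
  unfolding KL_at_def
proof (intro ballI impI)
  fix u v assume u: "u \<in> Y" "v \<in> lim_subdiff q u" "0 < gap x u" "gap x u \<le> gap x y"
  have "ereal (gap x y) \<le> ereal \<gamma> * epow (edist 0 (lim_subdiff (Psi f p q) x)) \<sigma>"
    using y by (simp add: KL_region_def gap_ereal[OF x y(2)])
  moreover have "ereal (gap x u) \<le> ereal (gap x y)" using u by simp
  ultimately have "u \<in> KL_region f p q \<gamma> \<sigma> x"
    using u by (auto simp: KL_region_def gap_ereal[OF x u(1)] simp del: ereal_less_eq intro: order_trans)
  then show "C * gap x u powr \<theta> \<le> norm (gy x u - v)" using KL_region_norm x u by blast
qed

lemma KL_at_nonstationary:
  assumes x: "x \<in> X" and \<epsilon>: "0 < \<epsilon>" and ns: "\<not> edist 0 (lim_subdiff (Psi f p q) x) \<le> ereal \<epsilon>"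
  shows "KL_at x (\<gamma> * \<epsilon> powr \<sigma>)"
  unfolding KL_at_def
proof (intro ballI impI)
  fix u v assume u: "u \<in> Y" "v \<in> lim_subdiff q u" "0 < gap x u" "gap x u \<le> \<gamma> * \<epsilon> powr \<sigma>"
  have "ereal (\<gamma> * \<epsilon> powr \<sigma>) \<le> ereal \<gamma> * epow (edist 0 (lim_subdiff (Psi f p q) x)) \<sigma>"
  proof (cases "edist 0 (lim_subdiff (Psi f p q) x)")
    case (real r)
    then have "\<epsilon> powr \<sigma> \<le> r powr \<sigma>" using ns \<epsilon> constants by (intro powr_mono2) auto
    then show ?thesis using constants by (simp add: real epow_def)
  qed (use ns constants in \<open>auto simp: epow_def\<close>)
  moreover have "ereal (gap x u) \<le> ereal (\<gamma> * \<epsilon> powr \<sigma>)" using u by simp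
  ultimately have "u \<in> KL_region f p q \<gamma> \<sigma> x"
    using u by (auto simp: KL_region_def gap_ereal[OF x u(1)] simp del: ereal_less_eq intro: order_trans)
  then show "C * gap x u powr \<theta> \<le> norm (gy x u - v)" using KL_region_norm x u by blast
qed

text \<open>Ekeland's principle in the form available in finite dimension: minimise
  \<open>gap x u\<^bsup>1-\<theta>\<^esup> + c * norm (u - y)\<close> over the points \<open>u\<close> whose gap does not exceed that of \<open>y\<close>. The
  epigraph variable \<open>t\<close> replaces the gap, which is only lower semicontinuous, by a continuous function
  on a compact set. If the gap is positive at the minimiser, minimality bounds the slope of
  \<open>gap\<^bsup>1-\<theta>\<^esup>\<close> there by \<open>c\<close>, while the Kurdyka-Lojasiewicz inequality makes it at least \<open>C (1 - \<theta>)\<close>.\<close>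
lemma error_bound_rate:
  assumes x: "x \<in> X" and KL: "KL_at x R" and y: "y \<in> Y" "gap x y \<le> R"
    and c: "0 < c" "c < C * (1 - \<theta>)"
  shows "\<exists>u\<in>Ymax f q x. c * norm (u - y) \<le> gap x y powr (1 - \<theta>)"
proof -
  define a where "a = 1 - \<theta>"
  have a: "0 < a" "a < 1" using constants by (auto simp: a_def)
  define B where "B = gap x y powr a / c + 1"
  define S where "S = {(u, t). u \<in> Y \<and> gap x u \<le> t} \<inter> (cball y B \<times> {0..gap x y})"
  have G0: "0 \<le> gap x y" by (rule gap_nonneg[OF x y(1)])
  have B: "B \<ge> 1" using c by (simp add: B_def)
  have "compact (cball y B \<times> {0..gap x y})" by (rule compact_Times) simp_all
  then have "compact S" unfolding S_def by (rule closed_Int_compact[OF closed_gap_epigraph])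
  moreover have "(y, gap x y) \<in> S" using y(1) G0 B by (simp add: S_def)
  moreover have "continuous_on S (\<lambda>z. snd z powr a + c * norm (fst z - y))"
    by (intro continuous_intros continuous_on_powr') (use a in \<open>auto simp: S_def\<close>)
  ultimately have "\<exists>z\<in>S. \<forall>z'\<in>S. snd z powr a + c * norm (fst z - y) \<le> snd z' powr a + c * norm (fst z' - y)"
    by (intro continuous_attains_inf) auto
  then obtain z where z: "z \<in> S"
    "\<And>z'. z' \<in> S \<Longrightarrow> snd z powr a + c * norm (fst z - y) \<le> snd z' powr a + c * norm (fst z' - y)"
    by blast
  obtain u t where ut: "z = (u, t)" by (cases z)
  define s where "s = gap x u"
  have u: "u \<in> Y" "s \<le> t" "t \<le> gap x y" "0 \<le> s"
    using z(1) gap_nonneg[OF x] by (auto simp: S_def s_def ut)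
  have min: "s powr a + c * norm (u - y) \<le> gap x w powr a + c * norm (w - y)"
    if "w \<in> Y" "gap x w \<le> gap x y" "norm (w - y) \<le> B" for w
  proof -
    have "(w, gap x w) \<in> S"
      using that gap_nonneg[OF x] by (simp add: S_def dist_norm norm_minus_commute)
    from z(2)[OF this] have "t powr a + c * norm (u - y) \<le> gap x w powr a + c * norm (w - y)"
      by (simp add: ut)
    moreover have "s powr a \<le> t powr a" using u a by (intro powr_mono2) auto
    ultimately show ?thesis by linarith
  qed
  have miny: "s powr a + c * norm (u - y) \<le> gap x y powr a" using min[of y] y B by simp
  show ?thesis
  proof (cases "s = 0")
    case True
    then show ?thesis using miny u(1) a by (auto simp: Ymax_iff[OF x] s_def a_def)
  next
    case False
    then have s: "s > 0" using u by simp
    have "c * norm (u - y) \<le> gap x y powr a" using miny by (smt (verit) powr_ge_zero)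
    then have uB: "norm (u - y) \<le> B - 1" using c by (simp add: B_def field_simps)
    \<comment> \<open>\<open>h \<mu>\<close> is a lower bound, continuous in \<open>\<mu>\<close>, of the desingularised gap after a step of size \<open>\<mu>\<close> from \<open>u\<close>.\<close>
    define h where "h \<mu> = s powr a - c * sqrt (2 * \<mu> * s)" for \<mu>
    \<comment> \<open>A short proximal gradient step from the minimiser \<open>u\<close> has slope almost \<open>C (1 - \<theta>)\<close> in
      the desingularised gap, which exceeds the slope \<open>c\<close> that minimality allows.\<close>
    have key: "a * C * h \<mu> powr (\<theta> / a) * (1 - \<mu> * Lg / 2) \<le> c * s powr \<theta> * (1 + \<mu> * Lg)"
      if \<mu>: "0 < \<mu>" "\<mu> < 1 / Lg" "\<mu> < 1 / (2 * s)" "0 < h \<mu>" for \<mu>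
    proof -
      define w where "w = pg_trial (\<lambda>u. - f (x, u)) q \<mu> u"
      define D where "D = norm (w - u)"
      define g where "g = gap x w"
      note step = pg_trial_step[OF x u(1) \<mu>(1), folded w_def, folded D_def g_def s_def]
      have g0: "0 \<le> g" using gap_nonneg[OF x step(1)] by (simp add: g_def)
      have Lg\<mu>: "\<mu> * Lg < 1" using \<mu>(2) constants by (simp add: field_simps)
      have "1 / (2 * \<mu>) \<le> 1 / \<mu> - Lg / 2" using Lg\<mu> \<mu>(1) by (simp add: field_simps)
      then have "1 / (2 * \<mu>) * D\<^sup>2 \<le> (1 / \<mu> - Lg / 2) * D\<^sup>2" by (rule mult_right_mono) simp
      then have dec: "1 / (2 * \<mu>) * D\<^sup>2 \<le> s - g" using step(3) by linarith
      then have "D\<^sup>2 \<le> 2 * \<mu> * (s - g)" using \<mu>(1) by (simp add: field_simps)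
      also have "\<dots> \<le> 2 * \<mu> * s" using \<mu>(1) g0 by simp
      finally have D2: "D\<^sup>2 \<le> 2 * \<mu> * s" .
      then have D: "D \<le> sqrt (2 * \<mu> * s)" by (rule real_le_rsqrt)
      have "2 * \<mu> * s \<le> 1" using \<mu>(3) s by (simp add: field_simps)
      then have "D \<le> 1" using D by (smt (verit) real_sqrt_le_1_iff)
      then have "norm (w - y) \<le> B"
        using uB norm_triangle_ineq[of "w - u" "u - y"] by (simp add: D_def)
      moreover have "1 / (2 * \<mu>) * D\<^sup>2 \<ge> 0" using \<mu>(1) by simp
      then have gs: "g \<le> s" using dec by linarith
      ultimately have "s powr a + c * norm (u - y) \<le> g powr a + c * norm (w - y)"
        using min[of w] step(1) u unfolding g_def by linarith
      moreover have "c * norm (w - y) \<le> c * (D + norm (u - y))"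
        using norm_triangle_ineq[of "w - u" "u - y"] c by (intro mult_left_mono) (auto simp: D_def)
      ultimately have sg: "s powr a - g powr a \<le> c * D" by (simp add: distrib_left)
      also have "\<dots> \<le> c * sqrt (2 * \<mu> * s)" using D c by simp
      finally have hg: "h \<mu> \<le> g powr a" by (simp add: h_def)
      then have gpos: "g > 0" using \<mu>(4) g0 by (cases "g = 0") auto
      have "h \<mu> powr (\<theta> / a) \<le> (g powr a) powr (\<theta> / a)"
        using hg \<mu>(4) a constants by (intro powr_mono2) auto
      then have hg': "h \<mu> powr (\<theta> / a) \<le> g powr \<theta>" using a by (simp add: powr_powr)
      have "C * g powr \<theta> \<le> norm (gy x w - (gy x u - (1 / \<mu>) *\<^sub>R (w - u)))"
        unfolding g_def
        by (rule KL_atD[OF KL step(1,2)]) (use gpos gs u y in \<open>auto simp: g_def\<close>)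
      also note step(4)
      finally have KLD: "C * g powr \<theta> \<le> (Lg + 1 / \<mu>) * D" .
      have Dpos: "D > 0"
      proof (rule ccontr)
        assume "\<not> D > 0"
        then have "D = 0" by (simp add: D_def)
        then show False using KLD gpos constants by (simp add: mult_le_0_iff)
      qed
      have "a * s powr (a - 1) * ((1 / \<mu> - Lg / 2) * D\<^sup>2) \<le> a * s powr (a - 1) * (s - g)"
        using step(3) a by (intro mult_left_mono) auto
      also have "\<dots> \<le> s powr a - g powr a"
        using powr_concave_tangent[OF a g0 s] by (simp add: algebra_simps)
      also note sg
      finally have "(a * s powr (a - 1) * (1 / \<mu> - Lg / 2) * D) * D \<le> c * D"
        by (simp add: power2_eq_square mult_ac)
      then have "a * s powr (a - 1) * (1 / \<mu> - Lg / 2) * D \<le> c" using Dpos by simp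
      then have slope: "a * s powr (- \<theta>) * (1 / \<mu> - Lg / 2) * D \<le> c" by (simp add: a_def)
      have pos: "0 \<le> 1 - \<mu> * Lg / 2" using Lg\<mu> by simp
      have "a * C * h \<mu> powr (\<theta> / a) * (1 - \<mu> * Lg / 2) \<le> a * (C * g powr \<theta>) * (1 - \<mu> * Lg / 2)"
        using hg' a constants pos by (intro mult_right_mono) (auto simp: mult.assoc)
      also have "\<dots> \<le> a * ((Lg + 1 / \<mu>) * D) * (1 - \<mu> * Lg / 2)"
        using KLD a pos by (intro mult_right_mono mult_left_mono) auto
      also have "\<dots> = s powr \<theta> * (a * s powr (- \<theta>) * (1 / \<mu> - Lg / 2) * D) * (1 + \<mu> * Lg)"
        using \<mu>(1) s by (simp add: powr_minus field_simps)
      also have "\<dots> \<le> s powr \<theta> * c * (1 + \<mu> * Lg)"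
        using slope s \<mu>(1) constants by (intro mult_right_mono mult_left_mono) auto
      finally show ?thesis by (simp add: mult_ac)
    qed
    have h0: "(h \<longlongrightarrow> s powr a) (at_right 0)"
    proof -
      have "(h \<longlongrightarrow> s powr a - c * sqrt (2 * 0 * s)) (at_right 0)"
        unfolding h_def by (intro tendsto_intros)
      then show ?thesis by simp
    qed
    have ev: "\<forall>\<^sub>F \<mu> in at_right 0. 0 < \<mu> \<and> \<mu> < 1 / Lg \<and> \<mu> < 1 / (2 * s) \<and> 0 < h \<mu>"
    proof -
      have "\<forall>\<^sub>F \<mu> in at_right 0. 0 < h \<mu>" using order_tendstoD(1)[OF h0, of 0] s by simp
      moreover have "\<forall>\<^sub>F \<mu> in at_right (0::real). \<mu> < b" if "0 < b" for b
        using that by (auto simp: eventually_at_right_field)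
      ultimately show ?thesis
        using constants s eventually_at_right_less[of "0::real"] by (auto intro!: eventually_conj)
    qed
    have "a * C * (s powr a) powr (\<theta> / a) * (1 - 0 * Lg / 2) \<le> c * s powr \<theta> * (1 + 0 * Lg)"
    proof (rule tendsto_le[of "at_right (0::real)"])
      show "((\<lambda>\<mu>. c * s powr \<theta> * (1 + \<mu> * Lg)) \<longlongrightarrow> c * s powr \<theta> * (1 + 0 * Lg)) (at_right 0)"
        by (intro tendsto_intros)
      show "((\<lambda>\<mu>. a * C * h \<mu> powr (\<theta> / a) * (1 - \<mu> * Lg / 2))
          \<longlongrightarrow> a * C * (s powr a) powr (\<theta> / a) * (1 - 0 * Lg / 2)) (at_right 0)"
        by (intro tendsto_intros h0) (use s in auto)
      show "\<forall>\<^sub>F \<mu> in at_right 0. a * C * h \<mu> powr (\<theta> / a) * (1 - \<mu> * Lg / 2) \<le> c * s powr \<theta> * (1 + \<mu> * Lg)"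
        using ev by eventually_elim (use key in blast)
    qed simp
    then have "a * C * s powr \<theta> \<le> c * s powr \<theta>" using a by (simp add: powr_powr)
    then have "a * C \<le> c" using s by simp
    then show ?thesis using c by (simp add: a_def mult.commute)
  qed
qed

lemma error_bound:
  assumes x: "x \<in> X" and KL: "KL_at x R" and y: "y \<in> Y" "gap x y \<le> R"
  shows "\<exists>u\<in>Ymax f q x. norm (y - u) \<le> gap x y powr (1 - \<theta>) / (C * (1 - \<theta>))"
proof -
  obtain u where u: "u \<in> Ymax f q x" "\<And>u'. u' \<in> Ymax f q x \<Longrightarrow> dist y u \<le> dist y u'"
    using distance_attains_inf[OF closed_Ymax[OF x] Ymax_nonempty[OF x]] by metis
  have K: "0 < C * (1 - \<theta>)" using constants by simp
  have "C * (1 - \<theta>) * norm (y - u) \<le> gap x y powr (1 - \<theta>)"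
  proof (rule field_le_mult_one_interval)
    fix t :: real assume t: "0 < t" "t < 1"
    have "0 < t * (C * (1 - \<theta>))" "t * (C * (1 - \<theta>)) < C * (1 - \<theta>)"
      using t K mult_strict_right_mono[of t 1 "C * (1 - \<theta>)"] by auto
    from error_bound_rate[OF x KL y this] obtain u' where
      u': "u' \<in> Ymax f q x" "t * (C * (1 - \<theta>)) * norm (u' - y) \<le> gap x y powr (1 - \<theta>)" by blast
    have "norm (y - u) \<le> norm (u' - y)" using u(2)[OF u'(1)] by (simp add: dist_norm norm_minus_commute)
    then have "t * (C * (1 - \<theta>)) * norm (y - u) \<le> t * (C * (1 - \<theta>)) * norm (u' - y)"
      using t K by (intro mult_left_mono) auto
    then show "t * (C * (1 - \<theta>) * norm (y - u)) \<le> gap x y powr (1 - \<theta>)"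
      using u'(2) by (simp add: mult.assoc)
  qed
  then show ?thesis using u(1) K by (auto simp: field_simps)
qed

abbreviation "M \<equiv> M_const Lg C \<theta>"
abbreviation "\<nu> \<equiv> nu_const \<theta>"

lemma nu: "0 < \<nu>" "\<nu> \<le> 1" "1 + \<nu> = 1 / \<theta>"
  using constants by (auto simp: nu_const_def field_simps)

lemma M_pos: "0 < M"
  using constants by (simp add: M_const_def)

text \<open>At the maximiser \<open>y1\<close> for \<open>x1\<close>, the gradient \<open>\<nabla>\<^sub>yf (x1, y1)\<close> is a subgradient of \<open>q\<close>. Hence \<open>y1\<close> is
  stationary for \<open>x2\<close> up to \<open>Lg * norm (x1 - x2)\<close>, its gap at \<open>x2\<close> is small, and the error bound
  applies.\<close>
lemma maximisers_hoelder:
  assumes x: "x1 \<in> X" "x2 \<in> X" and KL: "KL_at x2 R" and y1: "y1 \<in> Ymax f q x1"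
    and R: "2 * Lf * norm (x1 - x2) \<le> R"
  shows "\<exists>y2\<in>Ymax f q x2. Lg * norm (y1 - y2) \<le> M * norm (x1 - x2) powr \<nu>"
proof -
  let ?D = "norm (x1 - x2)" and ?g = "gap x2 y1"
  have y1': "y1 \<in> Y" "gap x1 y1 = 0" using Ymax_D[OF x(1) y1] by auto
  have gR: "?g \<le> R" using gap_shift[OF x y1'(1)] y1'(2) R by simp
  have g0: "0 \<le> ?g" by (rule gap_nonneg[OF x(2) y1'(1)])
  have "?g powr (1 - \<theta>) \<le> (Lg * ?D / C) powr \<nu>"
  proof (cases "?g = 0")
    case False
    then have g: "?g > 0" using g0 by simp
    have "C * ?g powr \<theta> \<le> norm (gy x2 y1 - gy x1 y1)"
      by (rule KL_atD[OF KL y1'(1) Ymax_gradient_subgradient[OF x(1) y1] g gR])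
    also have "\<dots> \<le> Lg * ?D"
      using grad_lip(2)[OF x(2,1) y1'(1,1)] by (simp add: norm_minus_commute)
    finally have "?g powr \<theta> \<le> Lg * ?D / C" using constants by (simp add: field_simps)
    then have "(?g powr \<theta>) powr \<nu> \<le> (Lg * ?D / C) powr \<nu>" using nu by (intro powr_mono2) auto
    then show ?thesis using constants by (simp add: powr_powr nu_const_def)
  qed simp
  moreover obtain y2 where y2: "y2 \<in> Ymax f q x2" "norm (y1 - y2) \<le> ?g powr (1 - \<theta>) / (C * (1 - \<theta>))"
    using error_bound[OF x(2) KL y1'(1) gR] by blast
  moreover have "0 < C * (1 - \<theta>)" using constants by simp
  ultimately have "norm (y1 - y2) \<le> (Lg * ?D / C) powr \<nu> / (C * (1 - \<theta>))"
    by (meson divide_right_mono less_imp_le order_trans)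
  then have "Lg * norm (y1 - y2) \<le> Lg * ((Lg * ?D / C) powr \<nu> / (C * (1 - \<theta>)))"
    using constants by (intro mult_left_mono) auto
  also have "\<dots> = inverse (1 - \<theta>) * (C powr (- \<nu>) * C powr (- 1)) * (Lg powr \<nu> * Lg powr 1) * ?D powr \<nu>"
    using constants by (simp add: powr_mult powr_divide powr_minus field_simps)
  also have "C powr (- \<nu>) * C powr (- 1) = C powr (- 1 / \<theta>)"
  proof -
    have "- \<nu> + - 1 = - 1 / \<theta>" using nu(3) by simp
    then show ?thesis by (simp only: powr_add[symmetric])
  qed
  also have "Lg powr \<nu> * Lg powr 1 = Lg powr (1 / \<theta>)"
    using nu(3) by (simp only: powr_add[symmetric] add.commute)
  finally show ?thesis using y2(1) by (auto simp: M_const_def)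
qed

text \<open>For \<open>s < t\<close>, the increment of \<open>F\<^sup>*\<close> from \<open>c s\<close> to \<open>c t\<close> is at most that of \<open>f (\<cdot>, y\<^sub>t)\<close> with a maximiser \<open>y\<^sub>t\<close>
  at the right end point. The mean value theorem applies to this smooth function, and \<open>y\<^sub>t\<close> can be chosen
  close to \<open>y\<close>. Integrating these slopes, and not just using the one at \<open>t = 1\<close>, yields the factors
  \<open>1 / 2\<close> and \<open>1 / (1 + \<nu>)\<close>, without which the descent estimate could fail for \<open>\<nu> = 1\<close>.\<close>
lemma Fs_upper_bound:
  assumes x: "x \<in> X" "x' \<in> X" and y: "y \<in> Ymax f q x" and R: "2 * Lf * norm (x' - x) \<le> R"
    and KL: "\<And>t. 0 \<le> t \<Longrightarrow> t \<le> 1 \<Longrightarrow> KL_at (x + t *\<^sub>R (x' - x)) R"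
  shows "Fs x' \<le> Fs x + gx x y \<bullet> (x' - x) + Lg / 2 * (norm (x' - x))\<^sup>2
    + M / (1 + \<nu>) * norm (x' - x) powr (1 + \<nu>)"
proof -
  define d where "d = x' - x"
  define D where "D = norm d"
  define c where "c t = x + t *\<^sub>R d" for t
  define w where "w t = gx x y \<bullet> d + Lg * t * D\<^sup>2 + M * t powr \<nu> * D powr (1 + \<nu>)" for t
  define W where "W t = t * (gx x y \<bullet> d) + Lg * (t\<^sup>2 / 2) * D\<^sup>2
    + M * (t powr (1 + \<nu>) / (1 + \<nu>)) * D powr (1 + \<nu>)" for t
  have D0: "D \<ge> 0" by (simp add: D_def)
  have DD: "D powr \<nu> * D = D powr (1 + \<nu>)"
    using D0 by (cases "D = 0") (auto simp: powr_add)
  have cX: "c t \<in> X" if "0 \<le> t" "t \<le> 1" for t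
    unfolding c_def d_def using proper_closed_convex_ineq(1)[OF pcc(1) x(2,1) that] .
  have yY: "y \<in> Y" using Ymax_D x(1) y by blast
  have "Fs (c 1) - Fs (c 0) \<le> W 1 - W 0"
  proof (rule increment_bound[where w = w and \<phi> = "\<lambda>t. Fs (c t)"])
    fix s t :: real assume st: "0 \<le> s" "s < t" "t \<le> 1"
    have "norm (x - c t) = t * D" using st by (simp add: c_def D_def)
    moreover have "t * D \<le> D" using st D0 by (simp add: mult_left_le_one_le)
    ultimately have "2 * Lf * norm (x - c t) \<le> R"
      using R constants unfolding D_def d_def by (smt (verit) mult_left_mono)
    moreover have "c t \<in> X" "KL_at (c t) R"
      using cX KL[of t] st unfolding c_def d_def by auto
    ultimately obtain yt where yt: "yt \<in> Ymax f q (c t)" "Lg * norm (y - yt) \<le> M * (t * D) powr \<nu>"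
      using maximisers_hoelder[OF x(1) _ _ y] \<open>norm (x - c t) = t * D\<close> by metis
    have ytY: "yt \<in> Y" "gap (c t) yt = 0" using Ymax_D[OF cX yt(1)] st by auto
    have "\<exists>z>s. z < t \<and> f (c t, yt) - f (c s, yt) = (t - s) * (gx (c z) yt \<bullet> d)"
    proof (rule MVT2[OF st(2)])
      fix z
      show "((\<lambda>t. f (c t, yt)) has_real_derivative gx (c z) yt \<bullet> d) (at z)"
        unfolding c_def by (rule GDERIV_line[where g = "\<lambda>u. f (u, yt)"]) (rule GDERIV_gx)
    qed
    then obtain z where z: "s < z" "z < t" "f (c t, yt) - f (c s, yt) = (t - s) * (gx (c z) yt \<bullet> d)"
      by blast
    have zX: "c z \<in> X" using cX z st by simp
    have "norm (c z - x) = z * D" using z st by (simp add: c_def D_def)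
    then have "norm (gx (c z) yt - gx x y) \<le> Lg * (z * D) + M * (t * D) powr \<nu>"
      using grad_lip(1)[OF zX x(1) ytY(1) yY] yt(2) by (simp add: norm_minus_commute)
    also have "\<dots> \<le> Lg * (t * D) + M * (t powr \<nu> * D powr \<nu>)"
      using z st D0 constants M_pos by (intro add_mono mult_left_mono mult_right_mono) (auto simp: powr_mult)
    finally have "norm (gx (c z) yt - gx x y) * D \<le> (Lg * (t * D) + M * (t powr \<nu> * D powr \<nu>)) * D"
      using D0 by (rule mult_right_mono)
    also have "\<dots> = Lg * t * D\<^sup>2 + M * t powr \<nu> * D powr (1 + \<nu>)"
      unfolding DD[symmetric] by (simp add: power2_eq_square algebra_simps)
    finally have "(gx (c z) yt - gx x y) \<bullet> d \<le> Lg * t * D\<^sup>2 + M * t powr \<nu> * D powr (1 + \<nu>)"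
      using norm_cauchy_schwarz[of "gx (c z) yt - gx x y" d] by (simp add: D_def)
    then have "gx (c z) yt \<bullet> d \<le> w t" by (simp add: w_def inner_diff_left)
    then have "f (c t, yt) - f (c s, yt) \<le> (t - s) * w t" using z(3) st by simp
    moreover have "Fs (c t) = f (c t, yt) - qr yt" using ytY(2) by (simp add: gap_def)
    moreover have "f (c s, yt) - qr yt \<le> Fs (c s)"
      using gap_nonneg[OF cX[of s] ytY(1)] st by (simp add: gap_def)
    ultimately show "Fs (c t) - Fs (c s) \<le> (t - s) * w t" by linarith
  next
    fix s t :: real assume st: "0 \<le> s" "s < t" "t \<le> 1"
    have "(t - s) * s \<le> (t\<^sup>2 - s\<^sup>2) / 2"
      using sum_squares_ge_zero[of "t - s" 0] by (simp add: field_simps power2_eq_square)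
    then have 1: "(Lg * D\<^sup>2) * ((t - s) * s) \<le> (Lg * D\<^sup>2) * ((t\<^sup>2 - s\<^sup>2) / 2)"
      using constants by (intro mult_left_mono) auto
    have 2: "(M * D powr (1 + \<nu>)) * ((t - s) * s powr \<nu>)
        \<le> (M * D powr (1 + \<nu>)) * ((t powr (1 + \<nu>) - s powr (1 + \<nu>)) / (1 + \<nu>))"
      using powr_tangent[of s t \<nu>] st nu M_pos by (intro mult_left_mono) auto
    from 1 2 show "(t - s) * w s \<le> W t - W s"
      unfolding w_def W_def by (simp add: algebra_simps diff_divide_distrib)
  qed
  then show ?thesis by (simp add: c_def W_def d_def D_def)
qed

text \<open>For a maximiser \<open>y\<close>, the smooth function \<open>f (\<cdot>, y) - q y\<close> is a minorant of \<open>F\<^sup>*\<close> that touches it at \<open>x\<close>.\<close>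
lemma Psi_subgradient:
  assumes x: "x \<in> X" and y: "y \<in> Ymax f q x"
    and s: "\<And>u. u \<in> X \<Longrightarrow> pr x + s \<bullet> (u - x) \<le> pr u"
  shows "gx x y + s \<in> lim_subdiff (Psi f p q) x"
proof (rule lim_subdiff_if_lower_bound)
  show "Psi f p q x = ereal (Fs x + pr x)" by (rule Psi_real[OF x])
next
  fix e :: real assume e: "0 < e"
  have yY: "y \<in> Y" "gap x y = 0" using Ymax_D[OF x y] by auto
  have "((\<lambda>u. f (u, y)) has_derivative (\<lambda>h. h \<bullet> gx x y)) (at x)"
    using GDERIV_gx[of y x] by (simp add: gderiv_def)
  then obtain d where d: "d > 0"
    "\<And>z. norm (z - x) < d \<Longrightarrow> norm (f (z, y) - f (x, y) - (z - x) \<bullet> gx x y) \<le> e * norm (z - x)"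
    using e unfolding has_derivative_at_alt by blast
  have "ereal (Fs x + pr x + (gx x y + s) \<bullet> (z - x) - e * norm (z - x)) \<le> Psi f p q z"
    if z: "norm (z - x) < d" for z
  proof (cases "z \<in> X")
    case True
    have "f (z, y) - qr y \<le> Fs z" using gap_nonneg[OF True yY(1)] by (simp add: gap_def)
    moreover have "Fs x = f (x, y) - qr y" using yY(2) by (simp add: gap_def)
    moreover have "f (x, y) + (z - x) \<bullet> gx x y - e * norm (z - x) \<le> f (z, y)" using d(2)[OF z] by simp
    moreover have "(z - x) \<bullet> gx x y = gx x y \<bullet> (z - x)" by (rule inner_commute)
    ultimately show ?thesis using s[OF True]
      by (simp add: Psi_real[OF True] inner_add_left)
  qed (simp add: Psi_infinite)
  then show "\<forall>\<^sub>F z in at x. ereal (Fs x + pr x + (gx x y + s) \<bullet> (z - x) - e * norm (z - x)) \<le> Psi f p q z"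
    using d(1) by (auto simp: eventually_at dist_norm intro!: exI[of _ d])
qed

section \<open>The descent step\<close>

text \<open>If the new point lies in the interior of the ball, the ball constraint is inactive and the
  optimality condition of the step is a subgradient inequality for \<open>p\<close> on all of \<open>X\<close>.\<close>
lemma x_step_properties:
  fixes x y r L
  defines "x' \<equiv> x_step f p r L x y"
  assumes x: "x \<in> X" and r: "0 < r" and L: "0 < L"
  shows "x' \<in> X" "norm (x' - x) \<le> r"
    "pr x' + gx x y \<bullet> (x' - x) + L * (norm (x' - x))\<^sup>2 \<le> pr x"
    "\<And>u. norm (x' - x) < r \<Longrightarrow> u \<in> X \<Longrightarrow> pr x' + (- gx x y - L *\<^sub>R (x' - x)) \<bullet> (u - x') \<le> pr u"
proof -
  let ?h = "\<lambda>u. gx x y \<bullet> u + L / 2 * (norm (u - x))\<^sup>2"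
  have eq: "x' = arg_min (\<lambda>u. ereal (?h u) + p u) (\<lambda>u. u \<in> cball x r)"
    by (simp add: x'_def x_step_def grad_partial)
  have "x \<in> cball x r \<inter> X" using x r by simp
  then have "cball x r \<inter> X \<noteq> {}" by blast
  moreover have "continuous_on UNIV ?h" by (intro continuous_intros)
  ultimately have "\<exists>w\<in>cball x r \<inter> X. \<forall>u\<in>cball x r \<inter> X. ?h w + real_of_ereal (p w) \<le> ?h u + real_of_ereal (p u)"
    by (intro attains_min_compact[OF pcc(1)]) auto
  then have ex: "\<exists>w\<in>X. w \<in> cball x r \<and> (\<forall>u\<in>X. u \<in> cball x r \<longrightarrow> ?h w + real_of_ereal (p w) \<le> ?h u + real_of_ereal (p u))"
    by blast
  show X': "x' \<in> X" unfolding eq by (rule arg_min_ereal(1)[OF pcc(1) ex])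
  have ball: "x' \<in> cball x r" unfolding eq by (rule arg_min_ereal(2)[OF pcc(1) ex])
  then show nr: "norm (x' - x) \<le> r" by (simp add: dist_norm norm_minus_commute)
  have min: "?h x' + real_of_ereal (p x') \<le> ?h u + real_of_ereal (p u)" if "u \<in> X" "u \<in> cball x r" for u
    unfolding eq by (rule arg_min_ereal(3)[OF pcc(1) ex that])
  define s where "s = - gx x y - L *\<^sub>R (x' - x)"
  have var: "pr x' + s \<bullet> (u - x') \<le> pr u" if "u \<in> cball x r \<inter> X" for u
    using prox_variational[OF pcc(1) convex_cball, of x' x r "gx x y" L x u] X' ball min that
    by (simp add: pr_def s_def)
  have "s \<bullet> (x - x') = gx x y \<bullet> (x' - x) + L * (norm (x' - x))\<^sup>2"
    by (simp add: s_def power2_norm_eq_inner inner_diff_left inner_diff_right algebra_simps)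
  then show "pr x' + gx x y \<bullet> (x' - x) + L * (norm (x' - x))\<^sup>2 \<le> pr x"
    using var[of x] x r by simp
  show "pr x' + (- gx x y - L *\<^sub>R (x' - x)) \<bullet> (u - x') \<le> pr u" if lt: "norm (x' - x) < r" and u: "u \<in> X" for u
  proof -
    \<comment> \<open>A point of the segment from \<open>x'\<close> to \<open>u\<close> close to \<open>x'\<close> lies in the ball.\<close>
    define t where "t = min 1 ((r - norm (x' - x)) / (norm (u - x') + 1))"
    have t: "0 < t" "t \<le> 1" using lt by (auto simp: t_def add_nonneg_pos)
    have "t * norm (u - x') \<le> (r - norm (x' - x)) / (norm (u - x') + 1) * norm (u - x')"
      unfolding t_def by (intro mult_right_mono) auto
    also have "\<dots> = (r - norm (x' - x)) * (norm (u - x') / (norm (u - x') + 1))" by simp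
    also have "\<dots> \<le> (r - norm (x' - x)) * 1"
      using lt by (intro mult_left_mono) (auto simp: divide_le_eq add_nonneg_pos)
    finally have "norm (x' - x) + norm (t *\<^sub>R (u - x')) \<le> r" using t by simp
    then have "norm (x' + t *\<^sub>R (u - x') - x) \<le> r"
      using norm_triangle_ineq[of "x' - x" "t *\<^sub>R (u - x')"] by (simp add: algebra_simps)
    then have "x' + t *\<^sub>R (u - x') \<in> cball x r \<inter> X"
      using proper_closed_convex_ineq(1)[OF pcc(1) u X'] t by (simp add: dist_norm norm_minus_commute)
    then have "pr x' + s \<bullet> (t *\<^sub>R (u - x')) \<le> pr (x' + t *\<^sub>R (u - x'))"
      using var by fastforce
    also have "\<dots> \<le> (1 - t) * pr x' + t * pr u"
      using proper_closed_convex_ineq(2)[OF pcc(1) u X', of t] t by (simp add: pr_def)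
    finally have "t * (pr x' + s \<bullet> (u - x')) \<le> t * pr u" by (simp add: algebra_simps)
    then show ?thesis using t by (simp add: s_def)
  qed
qed

text \<open>Young's inequality trades the Hoelder term for a quadratic one, at the price \<open>\<delta> / 2\<close>.\<close>

lemma hoelder_term_bound:
  assumes D: "0 \<le> D" and \<delta>: "0 < \<delta>"
  shows "M / (1 + \<nu>) * D powr (1 + \<nu>)
    \<le> \<delta> powr ((\<nu> - 1) / (1 + \<nu>)) * M powr (2 / (1 + \<nu>)) / 2 * D\<^sup>2 + \<delta> / 2"
proof (cases "D = 0")
  case True
  then show ?thesis using \<delta> by simp
next
  case False
  then have D: "D > 0" using D by simp
  define u where "u = \<delta> powr ((\<nu> - 1) / (1 + \<nu>)) * M powr (2 / (1 + \<nu>)) * D\<^sup>2"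
  have u: "u > 0" using D \<delta> M_pos by (simp add: u_def)
  have "u powr ((1 + \<nu>) / 2) * \<delta> powr ((1 - \<nu>) / 2) \<le> (1 + \<nu>) / 2 * u + (1 - \<nu>) / 2 * \<delta>"
    using nu(1,2) u \<delta> by (intro Youngs_inequality_0) (auto simp: field_simps)
  moreover have "u powr ((1 + \<nu>) / 2) = \<delta> powr ((\<nu> - 1) / 2) * M * D powr (1 + \<nu>)"
  proof -
    have "D\<^sup>2 = D powr 2" using D by simp
    then have "D\<^sup>2 powr ((1 + \<nu>) / 2) = D powr (2 * ((1 + \<nu>) / 2))" by (simp only: powr_powr)
    also have "2 * ((1 + \<nu>) / 2) = 1 + \<nu>" by simp
    finally have "D\<^sup>2 powr ((1 + \<nu>) / 2) = D powr (1 + \<nu>)" .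
    moreover have exps: "2 / (1 + \<nu>) * ((1 + \<nu>) / 2) = 1"
      "(\<nu> - 1) / (1 + \<nu>) * ((1 + \<nu>) / 2) = (\<nu> - 1) / 2"
      using nu(1) by (simp_all add: field_simps)
    moreover have "M powr 1 = M" using M_pos by simp
    ultimately show ?thesis unfolding u_def powr_mult powr_powr exps by simp
  qed
  moreover have "\<delta> powr ((\<nu> - 1) / 2) * \<delta> powr ((1 - \<nu>) / 2) = 1"
    using \<delta> by (simp add: powr_add[symmetric] add_divide_distrib[symmetric])
  ultimately have "M * D powr (1 + \<nu>) \<le> (1 + \<nu>) / 2 * u + (1 - \<nu>) / 2 * \<delta>"
    by (simp add: mult_ac)
  also have "\<dots> \<le> (1 + \<nu>) / 2 * u + (1 + \<nu>) / 2 * \<delta>"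
    using nu \<delta> by (intro add_left_mono mult_right_mono) auto
  finally have "M * D powr (1 + \<nu>) \<le> (1 + \<nu>) * (u / 2 + \<delta> / 2)" by (simp add: algebra_simps)
  then have "M * D powr (1 + \<nu>) / (1 + \<nu>) \<le> u / 2 + \<delta> / 2"
    using nu(1) by (simp add: divide_le_eq mult.commute)
  then show ?thesis by (simp add: u_def)
qed

text \<open>The proximal step decreases the sum of \<open>p\<close> and the linear model by at least \<open>L * D\<^sup>2\<close>. Half of it pays for the curvature of \<open>F\<^sup>*\<close> and a
  quarter for the error \<open>E\<close> of the gradient, which is evaluated at \<open>y\<close> and not at a maximiser.\<close>
lemma descent_step:
  fixes x y r L
  defines "x' \<equiv> x_step f p r L x y"
  defines "D \<equiv> norm (x' - x)"
  assumes x: "x \<in> X" and y: "y \<in> Y" and r: "0 < r" "2 * Lf * r \<le> R"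
    and KL: "\<And>u. u \<in> X \<Longrightarrow> norm (u - x) \<le> r \<Longrightarrow> KL_at u R"
    and ys: "ys \<in> Ymax f q x" "Lg * norm (y - ys) \<le> E"
    and \<delta>: "0 < \<delta>" and L: "L = Lg + \<delta> powr ((\<nu> - 1) / (1 + \<nu>)) * M powr (2 / (1 + \<nu>))"
  shows "Fs x' + pr x' \<le> Fs x + pr x - L / 4 * D\<^sup>2 + E\<^sup>2 / L + \<delta> / 2"
    and "D < r \<Longrightarrow> edist 0 (lim_subdiff (Psi f p q) x') \<le> ereal (L * D + Lg * D + M * D powr \<nu> + E)"
proof -
  have Lpos: "0 < L" unfolding L using constants by (simp add: add_pos_nonneg)
  note step = x_step_properties[OF x r(1) Lpos, of y, folded x'_def, folded D_def]
  have D0: "D \<ge> 0" by (simp add: D_def)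
  have ysY: "ys \<in> Y" using Ymax_D x ys by blast
  have "2 * Lf * D \<le> 2 * Lf * r" using step(2) constants by (intro mult_left_mono) auto
  then have RD: "2 * Lf * D \<le> R" using r(2) by linarith
  have gE: "norm (gx x ys - gx x y) \<le> E"
    using grad_lip(1)[OF x x ysY y] ys(2) by (simp add: norm_minus_commute)
  have "Fs x' \<le> Fs x + gx x ys \<bullet> (x' - x) + Lg / 2 * D\<^sup>2 + M / (1 + \<nu>) * D powr (1 + \<nu>)"
    unfolding D_def
  proof (rule Fs_upper_bound[OF x step(1) ys(1)])
    show "2 * Lf * norm (x' - x) \<le> R" using RD by (simp add: D_def)
    show "KL_at (x + t *\<^sub>R (x' - x)) R" if t: "0 \<le> t" "t \<le> 1" for t
    proof (rule KL)
      show "x + t *\<^sub>R (x' - x) \<in> X" using proper_closed_convex_ineq(1)[OF pcc(1) step(1) x t] .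
      have "t * D \<le> D" using t D0 by (simp add: mult_left_le_one_le)
      then show "norm (x + t *\<^sub>R (x' - x) - x) \<le> r" using step(2) t by (simp add: D_def)
    qed
  qed
  moreover have "(gx x ys - gx x y) \<bullet> (x' - x) \<le> E * D"
    using norm_cauchy_schwarz[of "gx x ys - gx x y" "x' - x"] mult_right_mono[OF gE D0]
    by (simp add: D_def)
  then have "gx x ys \<bullet> (x' - x) \<le> gx x y \<bullet> (x' - x) + E * D" by (simp add: inner_diff_left)
  moreover have "E * D \<le> L / 4 * D\<^sup>2 + E\<^sup>2 / L"
  proof -
    have "0 \<le> (L * D / 2 - E)\<^sup>2 / L" using Lpos by simp
    also have "\<dots> = L / 4 * D\<^sup>2 + E\<^sup>2 / L - E * D"
      using Lpos by (simp add: power2_eq_square field_simps)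
    finally show ?thesis by simp
  qed
  moreover have "M / (1 + \<nu>) * D powr (1 + \<nu>) \<le> (L - Lg) / 2 * D\<^sup>2 + \<delta> / 2"
    using hoelder_term_bound[OF D0 \<delta>] by (simp add: L)
  moreover have "(L - Lg) / 2 * D\<^sup>2 = L * D\<^sup>2 / 2 - Lg * D\<^sup>2 / 2"
    by (simp add: left_diff_distrib diff_divide_distrib)
  moreover have "L / 4 * D\<^sup>2 = L * D\<^sup>2 / 4" "Lg / 2 * D\<^sup>2 = Lg * D\<^sup>2 / 2" by simp_all
  ultimately show "Fs x' + pr x' \<le> Fs x + pr x - L / 4 * D\<^sup>2 + E\<^sup>2 / L + \<delta> / 2"
    using step(3) by linarith
  assume Dr: "D < r"
  have KL': "KL_at x' R" using KL step(1,2) by (simp add: D_def)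
  obtain y' where y': "y' \<in> Ymax f q x'" "Lg * norm (ys - y') \<le> M * D powr \<nu>"
    using maximisers_hoelder[OF x step(1) KL' ys(1)] RD by (auto simp: D_def norm_minus_commute)
  have y'Y: "y' \<in> Y" using Ymax_D step(1) y'(1) by blast
  let ?v = "gx x' y' + (- gx x y - L *\<^sub>R (x' - x))"
  have "?v \<in> lim_subdiff (Psi f p q) x'"
    by (rule Psi_subgradient[OF step(1) y'(1) step(4)[OF Dr]])
  then have "edist 0 (lim_subdiff (Psi f p q) x') \<le> ereal (dist 0 ?v)"
    unfolding edist_def by (rule INF_lower)
  also have "dist 0 ?v \<le> L * D + Lg * D + M * D powr \<nu> + E"
  proof -
    have "?v = (gx x' y' - gx x ys) + (gx x ys - gx x y) - L *\<^sub>R (x' - x)" by simp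
    then have "norm ?v \<le> norm (gx x' y' - gx x ys) + norm (gx x ys - gx x y) + norm (L *\<^sub>R (x' - x))"
      using norm_triangle_ineq4[of "(gx x' y' - gx x ys) + (gx x ys - gx x y)" "L *\<^sub>R (x' - x)"]
        norm_triangle_ineq[of "gx x' y' - gx x ys" "gx x ys - gx x y"] by (simp add: add_diff_eq)
    moreover have "norm (gx x' y' - gx x ys) \<le> Lg * D + M * D powr \<nu>"
      using grad_lip(1)[OF step(1) x y'Y ysY] y'(2) by (simp add: D_def norm_minus_commute)
    ultimately show ?thesis using gE Lpos by (simp add: D_def)
  qed
  finally show "edist 0 (lim_subdiff (Psi f p q) x') \<le> ereal (L * D + Lg * D + M * D powr \<nu> + E)"
    by simp
qed

section \<open>Counting outer iterations\<close>


definition A_const :: real where "A_const = (1 - \<theta>) powr (- 2) * C powr (- 2) * Lg\<^sup>2"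

text \<open>\<open>sqrt (A_const * eta k)\<close> is the gradient error at step \<open>k\<close>: the error bound places \<open>y\<^sub>k\<close> within
  \<open>sqrt (eta k) / (C (1 - \<theta>))\<close> of a maximiser.\<close>
lemma A_const_eq: "A_const = (Lg / (C * (1 - \<theta>)))\<^sup>2"
proof -
  have "(1 - \<theta>) powr (- 2) = inverse ((1 - \<theta>)\<^sup>2)" "C powr (- 2) = inverse (C\<^sup>2)"
    using constants by (simp_all add: powr_minus)
  then show ?thesis
    unfolding A_const_def power_divide power_mult_distrib by (simp add: divide_inverse)
qed

lemma L_seq_eq: "L_seq Lg C \<theta> k = Lg + real (k + 1) powr ((1 - \<nu>) / (1 + \<nu>)) * M powr (2 / (1 + \<nu>))"
proof -
  have "delta k powr ((\<nu> - 1) / (1 + \<nu>)) = real (k + 1) powr (- ((\<nu> - 1) / (1 + \<nu>)))"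
    by (simp add: delta_def powr_divide powr_minus field_simps)
  also have "- ((\<nu> - 1) / (1 + \<nu>)) = (1 - \<nu>) / (1 + \<nu>)" by (simp add: minus_divide_left)
  finally show ?thesis by (simp add: L_seq_def Let_def)
qed

lemma L_seq_bounds:
  shows "Lg + M powr (2 / (1 + \<nu>)) \<le> L_seq Lg C \<theta> k"
    and "k < n \<Longrightarrow> L_seq Lg C \<theta> k \<le> (Lg + M powr (2 / (1 + \<nu>))) * real n powr ((1 - \<nu>) / (1 + \<nu>))"
    and "0 < n \<Longrightarrow> real n / 2 \<le> real (k + 1) \<Longrightarrow>
      M powr (2 / (1 + \<nu>)) * real n powr ((1 - \<nu>) / (1 + \<nu>)) / 2 < L_seq Lg C \<theta> k"
proof -
  define \<kappa> where "\<kappa> = (1 - \<nu>) / (1 + \<nu>)"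
  have \<kappa>: "0 \<le> \<kappa>" "\<kappa> \<le> 1" using nu(1,2) by (auto simp: \<kappa>_def)
  define M2 where "M2 = M powr (2 / (1 + \<nu>))"
  have M2: "0 < M2" using M_pos by (simp add: M2_def)
  have L: "L_seq Lg C \<theta> k = Lg + real (k + 1) powr \<kappa> * M2"
    unfolding L_seq_eq \<kappa>_def M2_def ..
  have k1: "1 \<le> real (k + 1) powr \<kappa>" using \<kappa> by (intro ge_one_powr_ge_zero) auto
  have "1 * M2 \<le> real (k + 1) powr \<kappa> * M2" using k1 M2 by (intro mult_right_mono) auto
  then show "Lg + M powr (2 / (1 + \<nu>)) \<le> L_seq Lg C \<theta> k" by (simp add: L M2_def)
  show "L_seq Lg C \<theta> k \<le> (Lg + M powr (2 / (1 + \<nu>))) * real n powr ((1 - \<nu>) / (1 + \<nu>))" if "k < n"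
  proof -
    have n1: "real (k + 1) powr \<kappa> \<le> real n powr \<kappa>" using \<kappa> that by (intro powr_mono2) auto
    have "Lg * 1 \<le> Lg * real n powr \<kappa>" using n1 k1 constants by (intro mult_left_mono) linarith+
    moreover have "real (k + 1) powr \<kappa> * M2 \<le> real n powr \<kappa> * M2" using n1 M2 by (intro mult_right_mono) auto
    ultimately show ?thesis unfolding L M2_def[symmetric] \<kappa>_def[symmetric] by (simp add: algebra_simps)
  qed
  show "M powr (2 / (1 + \<nu>)) * real n powr ((1 - \<nu>) / (1 + \<nu>)) / 2 < L_seq Lg C \<theta> k"
    if "0 < n" "real n / 2 \<le> real (k + 1)"
  proof -
    have "real n powr \<kappa> / 2 \<le> real n powr \<kappa> / 2 powr \<kappa>"
      using \<kappa> powr_mono[of \<kappa> 1 2] by (intro divide_left_mono) auto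
    also have "\<dots> = (real n / 2) powr \<kappa>" by (simp add: powr_divide)
    also have "\<dots> \<le> real (k + 1) powr \<kappa>" using that \<kappa> by (intro powr_mono2) auto
    finally have "M2 * (real n powr \<kappa> / 2) \<le> M2 * real (k + 1) powr \<kappa>" using M2 by (intro mult_left_mono) auto
    then show ?thesis using constants unfolding L M2_def[symmetric] \<kappa>_def[symmetric]
      by (simp add: mult.commute)
  qed
qed

text \<open>The budget \<open>\<epsilon>\<close> is split into \<open>\<epsilon> / 3\<close> for \<open>L\<^sub>k D\<^sub>k\<close>, \<open>\<epsilon> / 3\<close> for \<open>M D\<^sub>k\<^sup>\<nu>\<close>, \<open>\<epsilon> / 6\<close> for \<open>Lg D\<^sub>k\<close> and \<open>\<epsilon> / 6\<close> for the
  gradient error. The gradient error is controlled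
  by the summand with \<open>Chat4\<close>. Each of the other three requirements, and the requirement that \<open>D\<^sub>k\<close> be
  less than the radius, has its own pair of terms in \<open>K_hat\<close>, one for the constant \<open>a\<close> and one for the
  logarithmic term with factor \<open>b\<close>; \<open>Chat3\<close> collects the terms with \<open>a\<close> of the first two.\<close>
lemma K_hat_suffices:
  fixes D P :: "nat \<Rightarrow> real" and \<epsilon> \<Delta> :: real and K :: int
  assumes \<epsilon>: "0 < \<epsilon>" "\<epsilon> \<le> 1 / exp 1" and \<Delta>: "0 \<le> \<Delta>"
    and K: "K = K_hat \<Delta> Lf Lg C \<theta> \<gamma> \<sigma> \<epsilon>"
  shows "1 \<le> K"
    and "(\<And>k. 0 \<le> D k) \<Longrightarrow> P 0 - P (nat K) \<le> \<Delta> \<Longrightarrow>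
      (\<And>k. k < nat K \<Longrightarrow> P (Suc k) \<le> P k - L_seq Lg C \<theta> k / 4 * (D k)\<^sup>2
         + A_const * eta k / L_seq Lg C \<theta> k + delta k / 2) \<Longrightarrow>
      \<exists>k<nat K. D k < radius Lf \<gamma> \<sigma> \<epsilon> \<and>
        L_seq Lg C \<theta> k * D k + Lg * D k + M * D k powr \<nu> + sqrt (A_const * eta k) \<le> \<epsilon>"
proof -
  define A where "A = A_const"
  define Lu where "Lu = Lg + M powr (2 / (1 + \<nu>))"
  define a where "a = 8 * (\<Delta> + 3 + 2 * A / Lu)"
  define b where "b = 8 * (3 / 2 + A / Lu)"
  define l where "l = ln (1 / \<epsilon>)"
  define M2 where "M2 = M powr (2 / (1 + \<nu>))"
  define e1 where "e1 = (1 + \<nu>) / (2 * \<nu>)"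
  define e2 where "e2 = (1 + \<nu>) / 2"
  define n where "n = nat K"
  note nu' = nu(1,2)
  have M2: "0 < M2" using M_pos by (simp add: M2_def)
  have Lu: "0 < Lu" using constants by (simp add: Lu_def add_pos_nonneg)
  have A: "0 \<le> A" unfolding A_def A_const_eq by simp
  have AL: "0 \<le> A / Lu" using A Lu by simp
  have a: "0 < a" and b: "0 < b" using AL \<Delta> by (auto simp: a_def b_def)
  have l: "1 \<le> l"
  proof -
    have "exp 1 \<le> 1 / \<epsilon>" using \<epsilon> by (simp add: field_simps)
    then show ?thesis using \<epsilon> unfolding l_def by (subst ln_ge_iff) auto
  qed
  have \<epsilon>1: "\<epsilon> \<le> 1" using \<epsilon>(2) exp_ge_add_one_self[of "1::real"] by (smt (verit) divide_le_eq_1)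
  define t1 where "t1 = Chat1 \<nu> b Lu * \<epsilon> powr (- (1 + \<nu>) / \<nu>) * l powr ((1 + \<nu>) / (2 * \<nu>))"
  define t2 where "t2 = Chat2 \<nu> b M * \<epsilon> powr (- (1 + \<nu>) / \<nu>) * l powr ((1 + \<nu>) / 2)"
  define t3 where "t3 = Chat3 \<nu> a Lu M * \<epsilon> powr (- (1 + \<nu>) / \<nu>)"
  define t4 where "t4 = Chat4 A * \<epsilon> powr (- 2)"
  define t5 where "t5 = Chat5 \<nu> b M Lg * \<epsilon> powr (- (1 + \<nu>)) * l powr ((1 + \<nu>) / 2)"
  define t6 where "t6 = Chat6 \<nu> a M Lg * \<epsilon> powr (- (1 + \<nu>))"
  define t7 where "t7 = Chat7 \<nu> b M Lf \<gamma> \<sigma> * \<epsilon> powr (- (1 + \<nu>) * \<sigma>) * l powr ((1 + \<nu>) / 2)"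
  define t8 where "t8 = Chat8 \<nu> a M Lf \<gamma> * \<epsilon> powr (- (1 + \<nu>) * \<sigma>)"
  have Keq: "K = \<lceil>t1 + t2 + t3 + t4 + t5 + t6 + t7 + t8\<rceil>"
    unfolding K K_hat_def Let_def t1_def t2_def t3_def t4_def t5_def t6_def t7_def t8_def
      a_def b_def Lu_def A_def A_const_def l_def ..
  have cp: "0 \<le> real_of_int (ceil_plus t)" for t by (simp add: ceil_plus_def)
  have tpos: "0 \<le> t1" "0 \<le> t2" "0 \<le> t3" "0 \<le> t4" "0 \<le> t5" "0 \<le> t6" "0 \<le> t7" "0 \<le> t8"
    unfolding t1_def t2_def t3_def t4_def t5_def t6_def t7_def t8_def
      Chat1_def Chat2_def Chat3_def Chat4_def Chat5_def Chat6_def Chat7_def Chat8_def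
    using A M_pos by (auto intro!: mult_nonneg_nonneg add_nonneg_nonneg divide_nonneg_nonneg)
  have t1: "1 \<le> t1"
  proof -
    have "1 \<le> Chat1 \<nu> b Lu"
      unfolding Chat1_def using nu' b Lu cp by (intro ge_one_powr_ge_zero) auto
    moreover have "1 \<le> \<epsilon> powr (- (1 + \<nu>) / \<nu>)"
      using \<epsilon> \<epsilon>1 nu' powr_mono2'[of "- (1 + \<nu>) / \<nu>" \<epsilon> 1] by (simp add: divide_le_0_iff)
    moreover have "1 \<le> l powr ((1 + \<nu>) / (2 * \<nu>))"
      using l nu' by (intro ge_one_powr_ge_zero) auto
    ultimately have "1 * 1 * 1 \<le> t1" unfolding t1_def by (intro mult_mono) auto
    then show ?thesis by simp
  qed
  have Kge: "t1 + t2 + t3 + t4 + t5 + t6 + t7 + t8 \<le> real_of_int K" unfolding Keq by linarith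
  then show K1: "1 \<le> K" using t1 tpos by linarith
  have n: "real n = real_of_int K" "0 < n" using K1 by (auto simp: n_def)
  have nt: "t1 \<le> n" "t2 \<le> n" "t3 \<le> n" "t4 \<le> n" "t5 \<le> n" "t6 \<le> n" "t7 \<le> n" "t8 \<le> n"
    using Kge tpos n(1) by linarith+
  define Q where "Q = a + b * ln (real n)"
  have Q: "0 < Q" using a b n by (simp add: Q_def add_pos_nonneg)
  assume D: "\<And>k. 0 \<le> D k" and P: "P 0 - P (nat K) \<le> \<Delta>"
    and descent: "\<And>k. k < nat K \<Longrightarrow> P (Suc k) \<le> P k - L_seq Lg C \<theta> k / 4 * (D k)\<^sup>2
         + A_const * eta k / L_seq Lg C \<theta> k + delta k / 2"
  let ?L = "L_seq Lg C \<theta>"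
  have Lpos: "0 < ?L k" for k using L_seq_bounds(1)[of k] Lu unfolding Lu_def by linarith
  have "(\<Sum>k<n. ?L k * (D k)\<^sup>2) \<le> Q / 2"
  proof -
    have "?L k * (D k)\<^sup>2 \<le> 4 * (P k - P (Suc k)) + (4 * (A / Lu) + 2) * inverse (real (Suc k))"
      if k: "k < n" for k
    proof -
      have e: "0 \<le> eta k" by (simp add: eta_def)
      have "A * eta k / ?L k \<le> A * eta k / Lu"
        using L_seq_bounds(1)[of k] Lu A e by (intro divide_left_mono mult_nonneg_nonneg mult_pos_pos Lpos) (auto simp: Lu_def)
      also have "\<dots> = A / Lu * inverse (real (Suc k))" by (simp add: eta_def divide_inverse)
      finally have "A * eta k / ?L k \<le> A / Lu * inverse (real (Suc k))" .
      moreover have "delta k = inverse (real (Suc k))" by (simp add: delta_def divide_inverse)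
      ultimately show ?thesis using descent[of k] k unfolding A_def n_def by (simp add: algebra_simps)
    qed
    then have "(\<Sum>k<n. ?L k * (D k)\<^sup>2) \<le> (\<Sum>k<n. 4 * (P k - P (Suc k)) + (4 * (A / Lu) + 2) * inverse (real (Suc k)))"
      by (intro sum_mono) simp
    also have "\<dots> = 4 * (P 0 - P n) + (4 * (A / Lu) + 2) * harm n"
      by (simp only: sum.distrib sum_distrib_left[symmetric] sum_lessThan_telescope' harm_altdef)
    also have "\<dots> \<le> 4 * \<Delta> + (4 * (A / Lu) + 2) * (1 + ln (real n))"
      using P harm_le_ln[OF n(2)] AL unfolding n_def[symmetric]
      by (intro add_mono mult_left_mono) auto
    also have "\<dots> \<le> Q / 2"
    proof -
      define s where "s = A / Lu"
      have as: "a = 8 * (\<Delta> + 3 + 2 * s)" "b = 8 * (3 / 2 + s)" by (simp_all add: a_def b_def s_def)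
      have "0 \<le> ln (real n)" "0 \<le> s" using n AL by (simp_all add: s_def)
      then show ?thesis unfolding Q_def as s_def[symmetric] using \<Delta> by (simp add: algebra_simps)
    qed
    finally show ?thesis .
  qed
  then obtain k where k: "k < n" "real n / 2 \<le> real (k + 1)" "?L k * (D k)\<^sup>2 \<le> Q / real n"
    using exists_small_in_second_half[OF n(2), of "\<lambda>k. ?L k * (D k)\<^sup>2" Q] Lpos
    by (auto simp: less_imp_le)
  define \<kappa> where "\<kappa> = (1 - \<nu>) / (1 + \<nu>)"
  have e1: "0 < e1" "real n powr \<kappa> / real n = 1 / real n powr (1 / e1)"
  proof -
    have "\<kappa> - 1 = - (1 / e1)" using nu' by (simp add: \<kappa>_def e1_def field_simps)
    moreover have "real n powr \<kappa> / real n = real n powr (\<kappa> - 1)" using n by (simp add: powr_diff)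
    ultimately show "real n powr \<kappa> / real n = 1 / real n powr (1 / e1)" by (simp add: powr_minus divide_inverse)
  qed (use nu' in \<open>simp add: e1_def\<close>)
  have e2: "0 < e2" "real n powr \<kappa> * real n = real n powr (1 / e2)"
  proof -
    have "\<kappa> + 1 = 1 / e2" using nu' by (simp add: \<kappa>_def e2_def field_simps)
    moreover have "real n powr \<kappa> * real n = real n powr (\<kappa> + 1)" using n by (simp add: powr_add)
    ultimately show "real n powr \<kappa> * real n = real n powr (1 / e2)" by simp
  qed (use nu' in \<open>simp add: e2_def\<close>)
  have M2e2: "M2 powr e2 = M"
  proof -
    have "2 / (1 + \<nu>) * e2 = 1" using nu' by (simp add: e2_def field_simps)
    then show ?thesis using M_pos unfolding M2_def powr_powr by simp
  qed
  \<comment> \<open>\<open>L\<^sub>k\<close> grows like \<open>k powr \<kappa>\<close>, so that the squared step length is of order \<open>n powr (- 2 / (1 + \<nu>))\<close>,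
    up to a logarithm.\<close>
  have Dsq: "(D k)\<^sup>2 < 2 * Q / (M2 * real n powr (1 / e2))"
  proof (rule ccontr)
    assume "\<not> ?thesis"
    then have ge: "2 * Q / (M2 * real n powr (1 / e2)) \<le> (D k)\<^sup>2" by simp
    have "Q / real n = M2 * real n powr \<kappa> / 2 * (2 * Q / (M2 * real n powr (1 / e2)))"
      unfolding e2(2)[symmetric] using M2 n by (simp add: field_simps)
    also have "\<dots> < ?L k * (2 * Q / (M2 * real n powr (1 / e2)))"
      using L_seq_bounds(3)[OF n(2) k(2)] Q M2 n unfolding M2_def[symmetric] \<kappa>_def[symmetric]
      by (intro mult_strict_right_mono) auto
    also have "\<dots> \<le> ?L k * (D k)\<^sup>2" using ge Lpos[of k] by (intro mult_left_mono) auto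
    finally show False using k(3) by simp
  qed
  have scaled: "\<Gamma> * (D k)\<^sup>2 < \<epsilon> powr \<omega>" if \<Gamma>: "0 < \<Gamma>" and \<omega>: "0 < \<omega>" and c: "c = 2 * (1 + \<nu>) * b * \<Gamma> / M2"
    and n1: "(2 * c * ceil_plus (ln c) + 2 * \<omega> * c + 1) powr e2 * \<epsilon> powr (- \<omega> * e2) * l powr e2 \<le> n"
    and n2: "(4 * a * \<Gamma>) powr e2 / M * \<epsilon> powr (- \<omega> * e2) \<le> n" for \<Gamma> \<omega> c
  proof -
    have c': "c = 4 * e2 * (\<Gamma> * b / M2)" using c M2 by (simp add: e2_def field_simps)
    have "(4 * (\<Gamma> * a / M2)) powr e2 = (4 * a * \<Gamma>) powr e2 / M"
      using a \<Gamma> M2 unfolding M2e2[symmetric] by (simp add: powr_divide[symmetric] mult_ac)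
    then have "(\<Gamma> * a / M2 + \<Gamma> * b / M2 * ln (real n)) / real n powr (1 / e2) \<le> \<epsilon> powr \<omega> / 2"
      using n1 n2 \<Gamma> \<omega> \<epsilon> e2(1) a b M2 n l unfolding c' l_def
      by (intro iteration_count_suffices) auto
    moreover have "\<Gamma> * (2 * Q / (M2 * real n powr (1 / e2)))
        = 2 * ((\<Gamma> * a / M2 + \<Gamma> * b / M2 * ln (real n)) / real n powr (1 / e2))"
      using M2 by (simp add: Q_def field_simps)
    moreover have "\<Gamma> * (D k)\<^sup>2 < \<Gamma> * (2 * Q / (M2 * real n powr (1 / e2)))"
      using Dsq \<Gamma> by (rule mult_strict_left_mono)
    ultimately show ?thesis by linarith
  qed
  have sq_le: "u \<le> v" if "u\<^sup>2 \<le> v\<^sup>2" "0 \<le> v" for u v :: real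
    using that by (rule power2_le_imp_le)
  have \<epsilon>2: "\<epsilon> powr 2 = \<epsilon>\<^sup>2" using \<epsilon> by simp
  have "?L k * D k \<le> \<epsilon> / 3"
  proof -
    have c1: "4 * e1 * (9 * Lu * b) = 18 * (1 + \<nu>) / \<nu> * b * Lu"
      using nu' by (simp add: e1_def field_simps)
    have ex: "- 2 * e1 = - (1 + \<nu>) / \<nu>" using nu' by (simp add: e1_def field_simps)
    have "(9 * Lu * a + 9 * Lu * b * ln (real n)) / real n powr (1 / e1) \<le> \<epsilon> powr 2 / 2"
    proof (rule iteration_count_suffices)
      have "t1 = (2 * (4 * e1 * (9 * Lu * b)) * ceil_plus (ln (4 * e1 * (9 * Lu * b)))
          + 2 * 2 * (4 * e1 * (9 * Lu * b)) + 1) powr e1 * \<epsilon> powr (- 2 * e1) * l powr e1"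
        unfolding c1 ex t1_def Chat1_def e1_def[symmetric] by (simp add: mult_ac)
      then show "(2 * (4 * e1 * (9 * Lu * b)) * ceil_plus (ln (4 * e1 * (9 * Lu * b)))
          + 2 * 2 * (4 * e1 * (9 * Lu * b)) + 1) powr e1 * \<epsilon> powr (- 2 * e1) * ln (1 / \<epsilon>) powr e1 \<le> real n"
        using nt(1) by (simp add: l_def)
      have "(4 * (9 * Lu * a)) powr e1 * \<epsilon> powr (- 2 * e1) \<le> t3"
        unfolding ex t3_def Chat3_def e1_def[symmetric]
        using M_pos by (intro mult_right_mono) (auto simp: mult_ac)
      then show "(4 * (9 * Lu * a)) powr e1 * \<epsilon> powr (- 2 * e1) \<le> real n" using nt(3) by simp
    qed (use e1 Lu a b \<epsilon> n l in \<open>auto simp: l_def\<close>)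
    moreover have "(3 * (?L k * D k))\<^sup>2 \<le> (9 * Lu * a + 9 * Lu * b * ln (real n)) / real n powr (1 / e1)"
    proof -
      have "(3 * (?L k * D k))\<^sup>2 = 9 * ?L k * (?L k * (D k)\<^sup>2)" by (simp add: power2_eq_square)
      also have "\<dots> \<le> 9 * (Lu * real n powr \<kappa>) * (Q / real n)"
        using L_seq_bounds(2)[OF k(1)] k(3) Lu Q Lpos[of k]
        unfolding Lu_def[symmetric] \<kappa>_def[symmetric] by (intro mult_mono) (auto intro: mult_nonneg_nonneg less_imp_le)
      also have "\<dots> = 9 * Lu * Q * (real n powr \<kappa> / real n)" by simp
      also have "\<dots> = 9 * Lu * Q / real n powr (1 / e1)" unfolding e1(2) by simp
      finally show ?thesis by (simp add: Q_def algebra_simps)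
    qed
    ultimately have "(3 * (?L k * D k))\<^sup>2 \<le> \<epsilon>\<^sup>2" using zero_le_power2[of \<epsilon>] unfolding \<epsilon>2 by linarith
    then have "3 * (?L k * D k) \<le> \<epsilon>" by (rule sq_le) (use \<epsilon> in simp)
    then show ?thesis by simp
  qed
  moreover have "M * D k powr \<nu> \<le> \<epsilon> / 3"
  proof -
    let ?\<Gamma> = "(3 * M) powr (2 / \<nu>)"
    have ex: "- (2 / \<nu>) * e2 = - (1 + \<nu>) / \<nu>" using nu' by (simp add: e2_def field_simps)
    have "?\<Gamma> * (D k)\<^sup>2 < \<epsilon> powr (2 / \<nu>)"
    proof (rule scaled[OF _ _ refl])
      show "0 < ?\<Gamma>" "0 < 2 / \<nu>" using M_pos nu' by auto
      define c where "c = 2 * (1 + \<nu>) * b * ?\<Gamma> / M2"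
      have c1: "2 * b * (1 + \<nu>) * ?\<Gamma> / M powr (2 / (1 + \<nu>)) = c" by (simp add: c_def M2_def mult_ac)
      have c2: "4 * b * (1 + \<nu>) * ?\<Gamma> / M powr (2 / (1 + \<nu>)) = 2 * c"
        "8 * b * (1 + \<nu>) * ?\<Gamma> / (\<nu> * M powr (2 / (1 + \<nu>))) = 2 * (2 / \<nu>) * c"
        unfolding c1[symmetric] by simp_all
      show "(2 * (2 * (1 + \<nu>) * b * ?\<Gamma> / M2) * ceil_plus (ln (2 * (1 + \<nu>) * b * ?\<Gamma> / M2))
        + 2 * (2 / \<nu>) * (2 * (1 + \<nu>) * b * ?\<Gamma> / M2) + 1) powr e2 * \<epsilon> powr (- (2 / \<nu>) * e2) * l powr e2 \<le> n"
        using nt(2) unfolding t2_def Chat2_def c1 c2 ex e2_def[symmetric] c_def[symmetric] .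
      have le: "z / M \<le> w + inverse M * z" if "0 \<le> w" for w z
        using that by (simp add: divide_inverse mult.commute)
      have "(4 * a * ?\<Gamma>) powr e2 / M * \<epsilon> powr (- (2 / \<nu>) * e2) \<le> t3"
        unfolding ex t3_def Chat3_def e2_def[symmetric] by (intro mult_right_mono le) auto
      then show "(4 * a * ?\<Gamma>) powr e2 / M * \<epsilon> powr (- (2 / \<nu>) * e2) \<le> n" using nt(3) by simp
    qed
    then have "(?\<Gamma> * (D k)\<^sup>2) powr (\<nu> / 2) \<le> (\<epsilon> powr (2 / \<nu>)) powr (\<nu> / 2)"
      using nu' by (intro powr_mono2) auto
    moreover have "(D k)\<^sup>2 powr (\<nu> / 2) = D k powr \<nu>"
    proof (cases "D k = 0")
      case False
      then have "(D k)\<^sup>2 = D k powr 2" using D[of k] by simp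
      then show ?thesis by (simp only: powr_powr) simp
    qed simp
    ultimately have "3 * M * D k powr \<nu> \<le> \<epsilon>"
      using nu' \<epsilon> M_pos by (simp add: powr_mult powr_powr)
    then show ?thesis by simp
  qed
  moreover have "Lg * D k \<le> \<epsilon> / 6"
  proof -
    let ?\<Gamma> = "36 * Lg\<^sup>2"
    have ex: "- 2 * e2 = - (1 + \<nu>)" by (simp add: e2_def)
    have "?\<Gamma> * (D k)\<^sup>2 < \<epsilon> powr 2"
    proof (rule scaled[OF _ _ refl])
      show "0 < ?\<Gamma>" "(0::real) < 2" using constants by auto
      define c where "c = 2 * (1 + \<nu>) * b * ?\<Gamma> / M2"
      have c1: "72 * (1 + \<nu>) * b * Lg\<^sup>2 / M powr (2 / (1 + \<nu>)) = c" by (simp add: c_def M2_def mult_ac)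
      have c2: "144 * (1 + \<nu>) * b * Lg\<^sup>2 / M powr (2 / (1 + \<nu>)) = 2 * c"
        "288 * (1 + \<nu>) * b * Lg\<^sup>2 / M powr (2 / (1 + \<nu>)) = 2 * 2 * c"
        unfolding c1[symmetric] by simp_all
      show "(2 * (2 * (1 + \<nu>) * b * ?\<Gamma> / M2) * ceil_plus (ln (2 * (1 + \<nu>) * b * ?\<Gamma> / M2))
        + 2 * 2 * (2 * (1 + \<nu>) * b * ?\<Gamma> / M2) + 1) powr e2 * \<epsilon> powr (- 2 * e2) * l powr e2 \<le> n"
        using nt(5) unfolding t5_def Chat5_def c1 c2 ex e2_def[symmetric] c_def[symmetric] .
      show "(4 * a * ?\<Gamma>) powr e2 / M * \<epsilon> powr (- 2 * e2) \<le> n"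
        using nt(6) unfolding ex t6_def Chat6_def e2_def[symmetric] by (simp add: mult_ac)
    qed
    then have "(6 * (Lg * D k))\<^sup>2 \<le> \<epsilon>\<^sup>2" unfolding \<epsilon>2 by (simp add: power_mult_distrib)
    then have "6 * (Lg * D k) \<le> \<epsilon>" by (rule sq_le) (use \<epsilon> in simp)
    then show ?thesis by simp
  qed
  moreover have "sqrt (A * eta k) \<le> \<epsilon> / 6"
  proof -
    have "eta k = 1 / real (k + 1)" by (simp add: eta_def)
    also have "\<dots> \<le> 1 / (real n / 2)" using k(2) n by (intro divide_left_mono) auto
    finally have "A * eta k \<le> A * (2 / real n)" using A by (intro mult_left_mono) auto
    also have "\<dots> \<le> (\<epsilon> / 6)\<^sup>2"
    proof -
      have "72 * A / \<epsilon>\<^sup>2 \<le> real n" using nt(4) \<epsilon> by (simp add: t4_def Chat4_def powr_minus divide_inverse)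
      then have "72 * A \<le> \<epsilon>\<^sup>2 * real n" using \<epsilon> by (simp add: field_simps)
      then show ?thesis using n by (simp add: field_simps power_divide)
    qed
    finally show ?thesis using \<epsilon> by (intro real_le_lsqrt) auto
  qed
  moreover have "D k < radius Lf \<gamma> \<sigma> \<epsilon>"
  proof -
    let ?\<Gamma> = "16 * Lf\<^sup>2 / \<gamma>\<^sup>2"
    have ex: "- (2 * \<sigma>) * e2 = - (1 + \<nu>) * \<sigma>" by (simp add: e2_def field_simps)
    have "?\<Gamma> * (D k)\<^sup>2 < \<epsilon> powr (2 * \<sigma>)"
    proof (rule scaled[OF _ _ refl])
      show "0 < ?\<Gamma>" "0 < 2 * \<sigma>" using constants by auto
      define c where "c = 2 * (1 + \<nu>) * b * ?\<Gamma> / M2"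
      have c1: "32 * (1 + \<nu>) * b * Lf\<^sup>2 / (\<gamma>\<^sup>2 * M powr (2 / (1 + \<nu>))) = c" by (simp add: c_def M2_def mult_ac)
      have c2: "64 * (1 + \<nu>) * b * Lf\<^sup>2 / (\<gamma>\<^sup>2 * M powr (2 / (1 + \<nu>))) = 2 * c"
        "128 * \<sigma> * (1 + \<nu>) * b * Lf\<^sup>2 / (\<gamma>\<^sup>2 * M powr (2 / (1 + \<nu>))) = 2 * (2 * \<sigma>) * c"
        unfolding c1[symmetric] by simp_all
      show "(2 * (2 * (1 + \<nu>) * b * ?\<Gamma> / M2) * ceil_plus (ln (2 * (1 + \<nu>) * b * ?\<Gamma> / M2))
        + 2 * (2 * \<sigma>) * (2 * (1 + \<nu>) * b * ?\<Gamma> / M2) + 1) powr e2 * \<epsilon> powr (- (2 * \<sigma>) * e2) * l powr e2 \<le> n"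
        using nt(7) unfolding t7_def Chat7_def c1 c2 ex e2_def[symmetric] c_def[symmetric] .
      have "(\<gamma>\<^sup>2) powr e2 = \<gamma> powr (1 + \<nu>)"
      proof -
        have "\<gamma>\<^sup>2 = \<gamma> powr 2" using constants by simp
        moreover have "2 * e2 = 1 + \<nu>" by (simp add: e2_def)
        ultimately show ?thesis by (simp only: powr_powr)
      qed
      then have "(4 * a * ?\<Gamma>) powr e2 = (64 * a * Lf\<^sup>2) powr e2 / \<gamma> powr (1 + \<nu>)"
        by (simp add: powr_divide[symmetric] mult_ac flip: \<open>(\<gamma>\<^sup>2) powr e2 = \<gamma> powr (1 + \<nu>)\<close>)
      then show "(4 * a * ?\<Gamma>) powr e2 / M * \<epsilon> powr (- (2 * \<sigma>) * e2) \<le> n"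
        using nt(8) unfolding ex t8_def Chat8_def e2_def[symmetric] by simp
    qed
    moreover have "\<epsilon> powr (2 * \<sigma>) = (\<epsilon> powr \<sigma>)\<^sup>2"
      by (simp add: power2_eq_square powr_add[symmetric])
    ultimately have "(4 * Lf / \<gamma> * D k)\<^sup>2 < (\<epsilon> powr \<sigma>)\<^sup>2" by (simp add: power_mult_distrib power_divide)
    then have "4 * Lf / \<gamma> * D k < \<epsilon> powr \<sigma>" by (rule power2_less_imp_less) simp
    then show ?thesis using constants by (simp add: radius_def field_simps)
  qed
  ultimately show "\<exists>k<nat K. D k < radius Lf \<gamma> \<sigma> \<epsilon> \<and>
        ?L k * D k + Lg * D k + M * D k powr \<nu> + sqrt (A_const * eta k) \<le> \<epsilon>"
    using k(1) unfolding n_def A_def by (intro exI[of _ k]) auto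
qed

section \<open>Complexity of the subroutine\<close>

lemma KL_power_bound:
  assumes "0 \<le> g" "0 \<le> t" "C * g powr \<theta> \<le> C * t powr \<theta>"
  shows "g \<le> t"
proof (rule ccontr)
  assume "\<not> g \<le> t"
  then have "t powr \<theta> < g powr \<theta>" using assms constants by (intro powr_less_mono2) auto
  then show False using assms(3) constants by simp
qed


context
  fixes lam \<rho> :: real
  assumes lam: "0 < lam" and \<rho>: "0 < \<rho>" "\<rho> < 1"
begin

abbreviation "S \<equiv> Lg + inverse (lam_low Lg lam \<rho>)"

lemma lam_low_bounds: "0 < lam_low Lg lam \<rho>" "lam_low Lg lam \<rho> \<le> lam" "lam_low Lg lam \<rho> \<le> \<rho> / Lg"
  using lam \<rho> constants by (auto simp: lam_low_def)

lemma S_pos: "0 < S"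
  using lam_low_bounds constants by (simp add: add_pos_pos)

lemma beta_low_pos: "0 < beta_low Lg C lam \<rho>"
  using S_pos lam constants by (simp add: beta_low_def)

text \<open>The accepted step size lies between \<open>lam_low\<close> and \<open>lam\<close>. The decrease and the subgradient bound are
  stated with these two extreme values, so that they do not depend on the number of trials.\<close>
lemma backtracking_step:
  assumes x: "x \<in> X" and z: "z \<in> Y"
  shows "\<exists>w. w \<in> Y \<and> (\<exists>i\<le>nat (ceil_plus (ln (2 * Lg * lam) / ln (1 / \<rho>))). pg_step (\<lambda>u. - f (x, u)) q lam \<rho> z i w)
    \<and> gap x w + (norm (w - z))\<^sup>2 / (2 * lam) \<le> gap x z
    \<and> (\<exists>v\<in>lim_subdiff q w. norm (gy x w - v) \<le> S * norm (w - z))"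
proof -
  let ?acc = "\<lambda>i. pg_accept (\<lambda>u. - f (x, u)) q (lam * \<rho> ^ i) z"
  have small: "?acc i" if "lam * \<rho> ^ i \<le> 1 / Lg" for i
    using pg_accept_small[OF x z _ that] lam \<rho> by simp
  obtain n where "\<rho> ^ n < 1 / (Lg * lam)"
    using real_arch_pow_inv[of "1 / (Lg * lam)" \<rho>] \<rho> lam constants by auto
  then have "lam * \<rho> ^ n \<le> 1 / Lg" using lam constants by (simp add: field_simps)
  then have ex: "?acc n" by (rule small)
  define i where "i = (LEAST i. ?acc i)"
  have acc: "?acc i" unfolding i_def by (rule LeastI[of ?acc, OF ex])
  have rej: "\<not> ?acc j" if "j < i" for j using not_less_Least[of j ?acc] that by (simp add: i_def)
  define \<mu> where "\<mu> = lam * \<rho> ^ i"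
  define w where "w = pg_trial (\<lambda>u. - f (x, u)) q \<mu> z"
  have \<mu>: "0 < \<mu>" "\<mu> \<le> lam" using lam \<rho> by (auto simp: \<mu>_def power_le_one mult_left_le)
  \<comment> \<open>The trial before the accepted one was rejected, so its step size exceeded \<open>1 / Lg\<close>.\<close>
  have bnd: "lam_low Lg lam \<rho> \<le> \<mu> \<and> i \<le> nat (ceil_plus (ln (2 * Lg * lam) / ln (1 / \<rho>)))"
  proof (cases i)
    case 0
    then show ?thesis using lam_low_bounds by (simp add: \<mu>_def)
  next
    case (Suc j)
    then have "1 / Lg < lam * \<rho> ^ j" using small[of j] rej[of j] by (meson lessI not_le)
    then have j: "1 < Lg * lam * \<rho> ^ j" using constants by (simp add: field_simps)
    then have "\<rho> / Lg \<le> \<mu>" using Suc \<rho> constants by (simp add: \<mu>_def field_simps)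
    then have 1: "lam_low Lg lam \<rho> \<le> \<mu>" using lam_low_bounds by linarith
    have "0 < ln (Lg * lam * \<rho> ^ j)" using j by simp
    also have "\<dots> \<le> ln (2 * Lg * lam * \<rho> ^ j)" using lam \<rho> constants by (subst ln_le_cancel_iff) auto
    also have "\<dots> = ln (2 * Lg * lam) - real j * ln (1 / \<rho>)"
      using lam \<rho> constants by (simp add: ln_mult ln_realpow ln_div)
    finally have "real j * ln (1 / \<rho>) < ln (2 * Lg * lam)" by simp
    moreover have "0 < ln (1 / \<rho>)" using \<rho> by simp
    ultimately have "real j < ln (2 * Lg * lam) / ln (1 / \<rho>)" by (simp add: field_simps)
    then have "int j < \<lceil>ln (2 * Lg * lam) / ln (1 / \<rho>)\<rceil>" by (simp add: less_ceiling_iff)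
    then show ?thesis using 1 Suc by (simp add: ceil_plus_def)
  qed
  note step = pg_trial_step[OF x z \<mu>(1), folded w_def]
  have "pg_step (\<lambda>u. - f (x, u)) q lam \<rho> z i w"
    using acc rej by (simp add: pg_step_def w_def \<mu>_def)
  moreover have "gap x w + (norm (w - z))\<^sup>2 / (2 * lam) \<le> gap x z"
  proof -
    have "gap x w + (norm (w - z))\<^sup>2 / (2 * \<mu>) \<le> gap x z"
      using acc pg_accept_iff[OF x z \<mu>(1)] by (simp add: \<mu>_def w_def)
    moreover have "(norm (w - z))\<^sup>2 / (2 * lam) \<le> (norm (w - z))\<^sup>2 / (2 * \<mu>)"
      using \<mu> by (intro divide_left_mono) auto
    ultimately show ?thesis by linarith
  qed
  moreover have "norm (gy x w - (gy x z - (1 / \<mu>) *\<^sub>R (w - z))) \<le> S * norm (w - z)"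
  proof -
    have "1 / \<mu> \<le> inverse (lam_low Lg lam \<rho>)"
      using bnd lam_low_bounds by (simp add: divide_inverse le_imp_inverse_le)
    then have "(Lg + 1 / \<mu>) * norm (w - z) \<le> S * norm (w - z)" by (intro mult_right_mono) auto
    then show ?thesis using step(4) by linarith
  qed
  ultimately show ?thesis using step(1,2) bnd by blast
qed

text \<open>While the subroutine does not stop, each step decreases the gap by more than \<open>\<tau>\<^sup>2 / (2 lam)\<close>, so
  the gap before the last of these steps exceeds that threshold; the decay rate limits how long this
  is possible. The rate enters through the premise \<open>steps\<close>, as it has a different form for \<open>\<theta> = 1 / 2\<close>.\<close>

lemma pg_terminates:
  assumes x: "x \<in> X" and z: "z \<in> Y" "gap x z \<le> R" and KL: "KL_at x R" and \<tau>: "0 < \<tau>"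
    and steps: "\<And>g m. (\<And>k. k \<le> m \<Longrightarrow> 0 < g k)
      \<Longrightarrow> (\<And>k. k < m \<Longrightarrow> beta_low Lg C lam \<rho> * g (Suc k) powr (2 * \<theta>) \<le> g k - g (Suc k))
      \<Longrightarrow> g 0 \<le> R \<Longrightarrow> \<tau>\<^sup>2 / (2 * lam) < g m \<Longrightarrow> int m + 2 \<le> Kf"
    and Kf: "1 \<le> Kf"
  defines "I \<equiv> ceil_plus (ln (2 * Lg * lam) / ln (1 / \<rho>))"
  shows "\<exists>w N G. pg_run (\<lambda>u. - f (x, u)) q lam \<rho> \<tau> z w N G \<and> w \<in> Y
    \<and> int N \<le> (I + 1) * Kf \<and> int G \<le> Kf \<and> gap x w \<le> R \<and> C * gap x w powr \<theta> \<le> S * \<tau>"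
proof -
  let ?rel = "\<lambda>z w. w \<in> Y \<and> (\<exists>i\<le>nat I. pg_step (\<lambda>u. - f (x, u)) q lam \<rho> z i w)
    \<and> gap x w + (norm (w - z))\<^sup>2 / (2 * lam) \<le> gap x z
    \<and> (\<exists>v\<in>lim_subdiff q w. norm (gy x w - v) \<le> S * norm (w - z))"
  have "\<forall>u\<in>Y. \<exists>w. ?rel u w" using backtracking_step[OF x] unfolding I_def by blast
  from bchoice[OF this] obtain F where F: "\<And>u. u \<in> Y \<Longrightarrow> ?rel u (F u)" by blast
  define zs where "zs k = (F ^^ k) z" for k
  have zs0: "zs 0 = z" by (simp add: zs_def)
  have zsY: "zs k \<in> Y" for k
  proof (induction k)
    case (Suc k) then show ?case using F[of "zs k"] by (simp add: zs_def)
  qed (use z zs0 in simp)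
  have rel: "?rel (zs k) (zs (Suc k))" for k using F[OF zsY[of k]] by (simp add: zs_def)
  define g where "g k = gap x (zs k)" for k
  define D where "D k = norm (zs (Suc k) - zs k)" for k
  have g0: "0 \<le> g k" for k using gap_nonneg[OF x zsY] by (simp add: g_def)
  have dec: "g (Suc k) + (D k)\<^sup>2 / (2 * lam) \<le> g k" for k using rel[of k] by (simp add: g_def D_def)
  have D2: "0 \<le> (D k)\<^sup>2 / (2 * lam)" for k using lam by simp
  have gR: "g k \<le> R" for k
  proof (induction k)
    case (Suc k) then show ?case using dec[of k] D2[of k] by linarith
  qed (use z zs0 in \<open>simp add: g_def\<close>)
  have KLD: "C * g (Suc k) powr \<theta> \<le> S * D k" for k
  proof (cases "g (Suc k) = 0")
    case True
    then show ?thesis using S_pos by (simp add: D_def)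
  next
    case False
    then have pos: "0 < gap x (zs (Suc k))" using g0[of "Suc k"] by (simp add: g_def)
    obtain v where "v \<in> lim_subdiff q (zs (Suc k))" "norm (gy x (zs (Suc k)) - v) \<le> S * D k"
      using rel[of k] by (auto simp: D_def)
    then show ?thesis
      using KL_atD[OF KL zsY _ pos, of v] gR[of "Suc k"] by (simp add: g_def)
  qed
  have \<beta>: "beta_low Lg C lam \<rho> * g (Suc k) powr (2 * \<theta>) \<le> g k - g (Suc k)" for k
  proof -
    have "(C * g (Suc k) powr \<theta>)\<^sup>2 \<le> (S * D k)\<^sup>2"
      using KLD[of k] constants by (intro power_mono) auto
    moreover have "(g (Suc k) powr \<theta>)\<^sup>2 = g (Suc k) powr (2 * \<theta>)"
      by (simp add: power2_eq_square powr_add[symmetric])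
    ultimately have "C\<^sup>2 * g (Suc k) powr (2 * \<theta>) \<le> S\<^sup>2 * (D k)\<^sup>2"
      by (simp add: power_mult_distrib)
    then have "C\<^sup>2 * g (Suc k) powr (2 * \<theta>) / (2 * lam * S\<^sup>2) \<le> S\<^sup>2 * (D k)\<^sup>2 / (2 * lam * S\<^sup>2)"
      using lam by (intro divide_right_mono) auto
    also have "\<dots> = (D k)\<^sup>2 / (2 * lam)" using S_pos by simp
    finally show ?thesis using dec[of k] by (simp add: beta_low_def)
  qed
  have bound: "int n + 1 \<le> Kf" if n: "\<And>k. k < n \<Longrightarrow> \<tau> < D k" for n
  proof (cases n)
    case 0
    then show ?thesis using Kf by simp
  next
    case (Suc m)
    have drop: "g (Suc k) + \<tau>\<^sup>2 / (2 * lam) < g k" if "k \<le> m" for k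
    proof -
      have "\<tau>\<^sup>2 < (D k)\<^sup>2" using n[of k] that Suc \<tau> by (intro power_strict_mono) auto
      then have "\<tau>\<^sup>2 / (2 * lam) < (D k)\<^sup>2 / (2 * lam)" using lam by (intro divide_strict_right_mono) auto
      then show ?thesis using dec[of k] by linarith
    qed
    have T0: "0 \<le> \<tau>\<^sup>2 / (2 * lam)" using lam by simp
    have "int m + 2 \<le> Kf"
    proof (rule steps[of m g])
      show "0 < g k" if "k \<le> m" for k using drop[OF that] g0[of "Suc k"] T0 by linarith
      show "\<tau>\<^sup>2 / (2 * lam) < g m" using drop[of m] g0[of "Suc m"] by simp
    qed (use \<beta> gR in auto)
    then show ?thesis using Suc by simp
  qed
  have "\<exists>n. D n \<le> \<tau>"
  proof (rule ccontr)
    assume "\<nexists>n. D n \<le> \<tau>"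
    then have "int (nat Kf) + 1 \<le> Kf" by (intro bound) (simp add: not_le)
    then show False using Kf by simp
  qed
  define n where "n = (LEAST n. D n \<le> \<tau>)"
  have Dn: "D n \<le> \<tau>" using \<open>\<exists>n. D n \<le> \<tau>\<close> unfolding n_def by (rule LeastI_ex)
  have before: "\<tau> < D k" if "k < n" for k
    using not_less_Least[of k "\<lambda>n. D n \<le> \<tau>"] that by (simp add: n_def)
  obtain N where N: "pg_run (\<lambda>u. - f (x, u)) q lam \<rho> \<tau> z (zs (Suc n)) N (n + 1)"
    "N \<le> (nat I + 1) * (n + 1)"
    using pg_run_of_sequence[of n "nat I" "\<lambda>u. - f (x, u)" q lam \<rho> zs \<tau>] rel before Dn zs0
    by (auto simp: D_def)
  have nK: "int (n + 1) \<le> Kf" using bound[of n] before by simp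
  have I0: "0 \<le> I" by (simp add: I_def ceil_plus_def)
  have "int N \<le> int ((nat I + 1) * (n + 1))" using N(2) by linarith
  also have "\<dots> = (I + 1) * int (n + 1)" using I0 by (simp add: algebra_simps)
  also have "\<dots> \<le> (I + 1) * Kf" using nK I0 by (intro mult_left_mono) auto
  finally have "int N \<le> (I + 1) * Kf" .
  moreover have "C * gap x (zs (Suc n)) powr \<theta> \<le> S * \<tau>"
    using KLD[of n] mult_left_mono[OF Dn, of S] S_pos unfolding g_def by linarith
  ultimately show ?thesis using N(1) zsY[of "Suc n"] nK gR[of "Suc n"] unfolding g_def by blast
qed

context
  fixes \<epsilon> :: real
  assumes \<epsilon>: "0 < \<epsilon>"
begin

abbreviation "R \<equiv> \<gamma> * \<epsilon> powr \<sigma>"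
abbreviation "\<tau> \<equiv> tau_seq Lg C \<theta> \<gamma> \<sigma> \<epsilon> lam \<rho>"

lemma R_pos: "0 < R"
  using constants \<epsilon> by simp

lemma eta_pos: "0 < eta k" "eta k \<le> 1"
  by (auto simp: eta_def)

lemma tau_pos: "0 < \<tau> k"
proof -
  have "0 < eta (k + 1) powr c" for c using eta_pos(1)[of "k + 1"] by simp
  moreover have "0 < (R / 2) powr \<theta>" by (subst powr_gt_zero) (use R_pos in linarith)
  moreover have "0 < C / S" using constants S_pos by simp
  ultimately show ?thesis unfolding tau_seq_def by (intro mult_pos_pos) auto
qed

text \<open>The tolerance decreases with \<open>k\<close>; \<open>Lambda_const\<close> belongs to the last index \<open>k = K - 1\<close>.\<close>
lemma tau_threshold:
  assumes k: "int k < K"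
  shows "1 / ((\<tau> k)\<^sup>2 / (2 * lam)) \<le> 2 * lam / C\<^sup>2 * S\<^sup>2 * Lambda_const \<theta> \<gamma> \<sigma> \<epsilon> K"
proof -
  define S' where "S' = S"
  have S': "0 < S'" using S_pos by (simp add: S'_def)
  define A1 A2 where "A1 = (R / 2) powr \<theta>" and "A2 = eta (k + 1) powr (\<theta> / (2 * (1 - \<theta>)))"
  have A: "0 < A1" "0 < A2" using R_pos eta_pos[of "k + 1"] constants by (auto simp: A1_def A2_def)
  have \<tau>: "\<tau> k = C / S' * min A1 A2" by (simp add: tau_seq_def S'_def A1_def A2_def)
  have inv2: "1 / (b powr c)\<^sup>2 = b powr (- 2 * c)" if "0 < b" for b c :: real
    by (simp add: powr_minus power2_eq_square powr_add[symmetric] divide_inverse mult.commute)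
  have "1 / A1\<^sup>2 \<le> Lambda_const \<theta> \<gamma> \<sigma> \<epsilon> K"
    unfolding A1_def using inv2[of "R / 2" \<theta>] R_pos by (simp add: Lambda_const_def)
  moreover have "1 / A2\<^sup>2 \<le> Lambda_const \<theta> \<gamma> \<sigma> \<epsilon> K"
  proof -
    have "- 2 * (\<theta> / (2 * (1 - \<theta>))) = - (\<theta> / (1 - \<theta>))" using constants by (simp add: field_simps)
    then have "1 / A2\<^sup>2 = eta (k + 1) powr (- (\<theta> / (1 - \<theta>)))"
      unfolding A2_def using inv2[of "eta (k + 1)"] eta_pos by simp
    also have "\<dots> = (real k + 2) powr (\<theta> / (1 - \<theta>))"
      by (simp add: eta_def powr_minus powr_divide add.commute)
    also have "\<dots> \<le> (real_of_int K + 1) powr (\<theta> / (1 - \<theta>))"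
    proof (rule powr_mono2)
      have "int k + 1 \<le> K" using k by simp
      then have "real k + 1 \<le> real_of_int K" by linarith
      then show "real k + 2 \<le> real_of_int K + 1" by simp
    qed (use constants in auto)
    finally show ?thesis by (simp add: Lambda_const_def)
  qed
  ultimately have \<Lambda>: "1 / (min A1 A2)\<^sup>2 \<le> Lambda_const \<theta> \<gamma> \<sigma> \<epsilon> K" by (simp add: min_def)
  have "1 / ((\<tau> k)\<^sup>2 / (2 * lam)) = 2 * lam / C\<^sup>2 * S'\<^sup>2 * (1 / (min A1 A2)\<^sup>2)"
    unfolding \<tau> by (simp add: power_mult_distrib power_divide)
  also have "\<dots> \<le> 2 * lam / C\<^sup>2 * S'\<^sup>2 * Lambda_const \<theta> \<gamma> \<sigma> \<epsilon> K"
    using \<Lambda> lam by (intro mult_left_mono) auto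
  finally show ?thesis by (simp add: S'_def)
qed

lemma beta_low_le_beta_up: "beta_low Lg C lam \<rho> \<le> beta_up Lg C lam \<rho>"
proof -
  note ll = lam_low_bounds
  have "Lg + inverse lam \<le> S" using ll by (simp add: le_imp_inverse_le)
  moreover have "0 < Lg + inverse lam" using lam constants by (simp add: add_pos_pos)
  ultimately have "(Lg + inverse lam)\<^sup>2 \<le> S\<^sup>2" "0 < (Lg + inverse lam)\<^sup>2"
    by (auto intro: power_mono)
  moreover have "C\<^sup>2 / (2 * lam) \<le> C\<^sup>2 / (2 * lam_low Lg lam \<rho>)"
    using ll constants lam by (intro divide_left_mono) auto
  ultimately show ?thesis
    unfolding beta_low_def beta_up_def using ll by (intro frac_le) auto
qed

lemma Cf_const_pos: "1 / 2 < \<theta> \<Longrightarrow> 0 < Cf_const Lg C \<theta> \<gamma> \<sigma> \<epsilon> lam \<rho>"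
proof -
  assume \<theta>: "1 / 2 < \<theta>"
  have "1 < 2 powr ((2 * \<theta> - 1) / (2 * \<theta>))" using \<theta> by (intro gr_one_powr) auto
  moreover have "0 < beta_up Lg C lam \<rho>"
    using beta_low_le_beta_up beta_low_pos by linarith
  moreover have "0 < R powr (1 - 2 * \<theta>)" by (subst powr_gt_zero) (use R_pos in linarith)
  ultimately have "0 < (2 powr ((2 * \<theta> - 1) / (2 * \<theta>)) - 1) * R powr (1 - 2 * \<theta>)
      / ((2 * \<theta> - 1) * beta_up Lg C lam \<rho>)"
    using \<theta> by (intro divide_pos_pos mult_pos_pos) auto
  then show ?thesis by (simp add: Cf_const_def)
qed

lemma Kf_bar_ge_1: "1 \<le> Kf_bar Lg C \<theta> \<gamma> \<sigma> \<epsilon> lam \<rho> K"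
proof (cases "\<theta> = 1 / 2")
  case True
  then show ?thesis by (simp add: Kf_bar_def Let_def ceil_plus_def)
next
  case False
  then have \<theta>: "1 / 2 < \<theta>" using constants by simp
  have "0 \<le> 1 / (Cf_const Lg C \<theta> \<gamma> \<sigma> \<epsilon> lam \<rho> * (2 * \<theta> - 1) * beta_low Lg C lam \<rho>) * c powr (2 * \<theta> - 1)" for c
    using Cf_const_pos[OF \<theta>] beta_low_pos \<theta>
    by (intro mult_nonneg_nonneg divide_nonneg_nonneg) auto
  then show ?thesis using False by (simp add: Kf_bar_def Let_def) (smt (verit) zero_le_ceiling less_ceiling_iff)
qed

text \<open>Here \<open>m + 1\<close> steps fail the stopping test and one more step passes it. The decay lemmas bound \<open>m\<close> by a
  strict inequality, so that rounding up absorbs one of the two additional steps.\<close>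
lemma Kf_bar_bounds_steps:
  fixes g :: "nat \<Rightarrow> real"
  assumes k: "int k < K" and pos: "\<And>j. j \<le> m \<Longrightarrow> 0 < g j"
    and step: "\<And>j. j < m \<Longrightarrow> beta_low Lg C lam \<rho> * g (Suc j) powr (2 * \<theta>) \<le> g j - g (Suc j)"
    and g0: "g 0 \<le> R" and last: "(\<tau> k)\<^sup>2 / (2 * lam) < g m"
  shows "int m + 2 \<le> Kf_bar Lg C \<theta> \<gamma> \<sigma> \<epsilon> lam \<rho> K"
proof -
  define T where "T = (\<tau> k)\<^sup>2 / (2 * lam)"
  define B where "B = beta_low Lg C lam \<rho>"
  define c where "c = 2 * lam / C\<^sup>2 * S\<^sup>2"
  define \<Lambda> where "\<Lambda> = Lambda_const \<theta> \<gamma> \<sigma> \<epsilon> K"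
  have T: "0 < T" "T < g m" using tau_pos[of k] lam last by (auto simp: T_def)
  have B: "0 < B" using beta_low_pos by (simp add: B_def)
  have T\<Lambda>: "1 / T \<le> c * \<Lambda>" using tau_threshold[OF k] by (simp add: T_def c_def \<Lambda>_def)
  show ?thesis
  proof (cases "\<theta> = 1 / 2")
    case True
    have "real m < (1 + B) / B * ln (R / T)"
    proof (rule geometric_decay_steps[OF B _ g0 T])
      fix j assume j: "j < m"
      then have "B * g (Suc j) \<le> g j - g (Suc j)" using step[OF j] pos[of "Suc j"] True by (simp add: B_def)
      then show "(1 + B) * g (Suc j) \<le> g j" by (simp add: algebra_simps)
    qed
    also have "\<dots> \<le> (1 + B) / B * ln (c * \<gamma> * \<epsilon> powr \<sigma> * \<Lambda>)"
    proof (rule mult_left_mono)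
      have RT: "0 < R / T" using R_pos T by simp
      have "R * (1 / T) \<le> R * (c * \<Lambda>)" using T\<Lambda> R_pos by (intro mult_left_mono) auto
      then have "R / T \<le> c * \<gamma> * \<epsilon> powr \<sigma> * \<Lambda>" by (simp add: mult_ac)
      then show "ln (R / T) \<le> ln (c * \<gamma> * \<epsilon> powr \<sigma> * \<Lambda>)" using RT by simp
    qed (use B in simp)
    finally have "int m < \<lceil>(1 + B) / B * ln (c * \<gamma> * \<epsilon> powr \<sigma> * \<Lambda>)\<rceil>" by (simp add: less_ceiling_iff)
    then show ?thesis using True
      unfolding Kf_bar_def Let_def B_def[symmetric] c_def[symmetric] \<Lambda>_def[symmetric] ceil_plus_def by simp
  next
    case False
    then have \<theta>: "1 / 2 < \<theta>" "\<theta> < 1" using constants by auto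
    define Cf where "Cf = Cf_const Lg C \<theta> \<gamma> \<sigma> \<epsilon> lam \<rho>"
    define \<kappa> where "\<kappa> = Cf * (2 * \<theta> - 1) * B"
    have Cf: "0 < Cf" using Cf_const_pos[OF \<theta>(1)] by (simp add: Cf_def)
    have \<kappa>: "0 < \<kappa>" using Cf B \<theta> by (simp add: \<kappa>_def)
    have "real m * \<kappa> < (1 / T) powr (2 * \<theta> - 1)"
    proof (rule sublinear_decay_steps[OF \<theta> B pos _ g0 T])
      show "B * g (Suc j) powr (2 * \<theta>) \<le> g j - g (Suc j)" if "j < m" for j
        using step[OF that] by (simp add: B_def)
      have "Cf \<le> 1 / 2" unfolding Cf_def Cf_const_def by (rule min.cobounded1)
      then have "Cf * ((2 * \<theta> - 1) * B) \<le> 1 / 2 * ((2 * \<theta> - 1) * B)"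
        using B \<theta> by (intro mult_right_mono) auto
      then show "\<kappa> \<le> (2 * \<theta> - 1) * B / 2" by (simp add: \<kappa>_def mult.assoc)
      define U where "U = beta_up Lg C lam \<rho>"
      have U: "B \<le> U" using beta_low_le_beta_up by (simp add: B_def U_def)
      define V where "V = (2 powr ((2 * \<theta> - 1) / (2 * \<theta>)) - 1) * R powr (1 - 2 * \<theta>)"
      have "\<kappa> \<le> Cf * ((2 * \<theta> - 1) * U)"
        unfolding \<kappa>_def mult.assoc using U Cf \<theta> by (intro mult_left_mono) auto
      also have "\<dots> \<le> V / ((2 * \<theta> - 1) * U) * ((2 * \<theta> - 1) * U)"
        using U B \<theta> unfolding Cf_def Cf_const_def V_def U_def by (intro mult_right_mono min.cobounded2) auto
      also have "\<dots> = V" using U B \<theta> by simp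
      finally show "\<kappa> \<le> (2 powr ((2 * \<theta> - 1) / (2 * \<theta>)) - 1) * R powr (1 - 2 * \<theta>)" by (simp add: V_def)
    qed
    also have "\<dots> \<le> (c * \<Lambda>) powr (2 * \<theta> - 1)" using T\<Lambda> T \<theta> by (intro powr_mono2) auto
    finally have "real m < 1 / \<kappa> * (c * \<Lambda>) powr (2 * \<theta> - 1)" using \<kappa> by (simp add: field_simps)
    then have "int m < \<lceil>1 / \<kappa> * (c * \<Lambda>) powr (2 * \<theta> - 1)\<rceil>" by (simp add: less_ceiling_iff)
    then show ?thesis using False
      unfolding Kf_bar_def Let_def B_def[symmetric] c_def[symmetric] \<Lambda>_def[symmetric]
        Cf_def[symmetric] \<kappa>_def[symmetric] by simp
  qed
qed

text \<open>With this exponent of \<open>eta\<close>, a gap within the accuracy has a \<open>(1 - \<theta>)\<close>-th power of at most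
  \<open>sqrt (eta k)\<close>, which is the quantity in the error bound.\<close>
definition accuracy :: "nat \<Rightarrow> real" where
  "accuracy k = min (R / 2) (eta k powr (1 / (2 * (1 - \<theta>))))"

lemma subroutine_complexity:
  fixes K :: int
  defines "Kf \<equiv> Kf_bar Lg C \<theta> \<gamma> \<sigma> \<epsilon> lam \<rho> K"
  assumes x: "x \<in> X" and z: "z \<in> Y" "gap x z \<le> R" and KL: "KL_at x R" and k: "int k < K"
  shows "\<exists>w N G. pg_run (\<lambda>u. - f (x, u)) q lam \<rho> (\<tau> k) z w N G \<and> w \<in> Y
    \<and> int N \<le> (ceil_plus (ln (2 * Lg * lam) / ln (1 / \<rho>)) + 1) * Kf \<and> int G \<le> Kf
    \<and> gap x w \<le> accuracy (Suc k)"
proof -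
  obtain w N G where w: "pg_run (\<lambda>u. - f (x, u)) q lam \<rho> (\<tau> k) z w N G" "w \<in> Y"
    "int N \<le> (ceil_plus (ln (2 * Lg * lam) / ln (1 / \<rho>)) + 1) * Kf" "int G \<le> Kf"
    "C * gap x w powr \<theta> \<le> S * \<tau> k"
  proof -
    have "\<exists>w N G. pg_run (\<lambda>u. - f (x, u)) q lam \<rho> (\<tau> k) z w N G \<and> w \<in> Y
      \<and> int N \<le> (ceil_plus (ln (2 * Lg * lam) / ln (1 / \<rho>)) + 1) * Kf \<and> int G \<le> Kf
      \<and> gap x w \<le> R \<and> C * gap x w powr \<theta> \<le> S * \<tau> k"
    proof (rule pg_terminates[OF x z KL tau_pos])
      show "1 \<le> Kf" unfolding Kf_def by (rule Kf_bar_ge_1)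
      show "int m + 2 \<le> Kf"
        if "\<And>j. j \<le> m \<Longrightarrow> 0 < g j"
          "\<And>j. j < m \<Longrightarrow> beta_low Lg C lam \<rho> * g (Suc j) powr (2 * \<theta>) \<le> g j - g (Suc j)"
          "g 0 \<le> R" "(\<tau> k)\<^sup>2 / (2 * lam) < g m" for g m
        unfolding Kf_def using that by (intro Kf_bar_bounds_steps[OF k]) auto
    qed
    then show ?thesis using that by blast
  qed
  have "S * \<tau> k = C * min ((R / 2) powr \<theta>) (eta (k + 1) powr (\<theta> / (2 * (1 - \<theta>))))"
    using S_pos by (simp add: tau_seq_def)
  also have "eta (k + 1) powr (\<theta> / (2 * (1 - \<theta>))) = (eta (Suc k) powr (1 / (2 * (1 - \<theta>)))) powr \<theta>"
    by (simp add: powr_powr)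
  finally have S\<tau>: "S * \<tau> k
      = C * min ((R / 2) powr \<theta>) ((eta (Suc k) powr (1 / (2 * (1 - \<theta>)))) powr \<theta>)" .
  have "C * gap x w powr \<theta> \<le> C * t" if "min ((R / 2) powr \<theta>) ((eta (Suc k) powr (1 / (2 * (1 - \<theta>)))) powr \<theta>) \<le> t" for t
    using w(5) mult_left_mono[OF that, of C] constants unfolding S\<tau> by linarith
  note le = this[OF min.cobounded1] this[OF min.cobounded2]
  have g0: "0 \<le> gap x w" by (rule gap_nonneg[OF x w(2)])
  have "gap x w \<le> R / 2" by (rule KL_power_bound[OF g0 _ le(1)]) (use R_pos in linarith)
  moreover have "gap x w \<le> eta (Suc k) powr (1 / (2 * (1 - \<theta>)))"
    by (rule KL_power_bound[OF g0 _ le(2)]) simp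
  ultimately have "gap x w \<le> accuracy (Suc k)" unfolding accuracy_def by (rule min.boundedI)
  then show ?thesis using w(1-4) by blast
qed

lemma accuracy_bounds: "accuracy k \<le> R / 2" "accuracy k \<le> 1 / (real k + 1)"
proof -
  have "1 \<le> 1 / (2 * (1 - \<theta>))" using constants by (simp add: field_simps)
  then have "eta k powr (1 / (2 * (1 - \<theta>))) \<le> eta k powr 1"
    using eta_pos[of k] by (intro powr_mono') auto
  then show "accuracy k \<le> 1 / (real k + 1)"
    using eta_pos[of k] by (simp add: accuracy_def eta_def min_le_iff_disj)
qed (simp add: accuracy_def)

lemma accuracy_error_bound:
  assumes x: "x \<in> X" and y: "y \<in> Y" and g: "gap x y \<le> accuracy k"
    and KL: "KL_at x R'" "gap x y \<le> R'"
  shows "\<exists>u\<in>Ymax f q x. norm (y - u) \<le> min ((R / 2) powr (1 - \<theta>)) (1 / sqrt (real k + 1)) / (C * (1 - \<theta>))"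
proof -
  obtain u where u: "u \<in> Ymax f q x" "norm (y - u) \<le> gap x y powr (1 - \<theta>) / (C * (1 - \<theta>))"
    using error_bound[OF x KL(1) y KL(2)] by blast
  have g0: "0 \<le> gap x y" by (rule gap_nonneg[OF x y])
  have "gap x y powr (1 - \<theta>) \<le> (R / 2) powr (1 - \<theta>)"
    using g g0 constants by (intro powr_mono2) (auto simp: accuracy_def)
  moreover have "gap x y powr (1 - \<theta>) \<le> 1 / sqrt (real k + 1)"
  proof -
    have "gap x y powr (1 - \<theta>) \<le> (eta k powr (1 / (2 * (1 - \<theta>)))) powr (1 - \<theta>)"
      using g g0 constants by (intro powr_mono2) (auto simp: accuracy_def)
    also have "\<dots> = eta k powr (1 / 2)"
    proof -
      have "1 / (2 * (1 - \<theta>)) * (1 - \<theta>) = 1 / 2" using constants by (simp add: field_simps)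
      then show ?thesis by (simp only: powr_powr)
    qed
    also have "\<dots> = 1 / sqrt (real k + 1)"
      using eta_pos[of k] by (simp add: powr_half_sqrt eta_def real_sqrt_divide)
    finally show ?thesis .
  qed
  ultimately have "gap x y powr (1 - \<theta>) / (C * (1 - \<theta>))
      \<le> min ((R / 2) powr (1 - \<theta>)) (1 / sqrt (real k + 1)) / (C * (1 - \<theta>))"
    using constants by (intro divide_right_mono) auto
  then show ?thesis using u by force
qed

section \<open>Complexity of the method\<close>

text \<open>This is the purpose of the radius in the notion of stationarity: the run continues only while
  the Kurdyka-Lojasiewicz inequality is available on the whole ball searched by the next step.\<close>
lemma nonstationary_ball:
  assumes x: "x \<in> X" and ns: "\<not> stationary_point (Psi f p q) (radius Lf \<gamma> \<sigma> \<epsilon>) \<epsilon> x"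
    and u: "norm (u - x) \<le> radius Lf \<gamma> \<sigma> \<epsilon>"
  shows "\<not> edist 0 (lim_subdiff (Psi f p q) u) \<le> ereal \<epsilon>"
proof
  assume "edist 0 (lim_subdiff (Psi f p q) u) \<le> ereal \<epsilon>"
  then have "edist x {u. edist 0 (lim_subdiff (Psi f p q) u) \<le> ereal \<epsilon>} \<le> ereal (dist x u)"
    unfolding edist_def[of x] by (intro INF_lower) simp
  also have "\<dots> \<le> ereal (radius Lf \<gamma> \<sigma> \<epsilon>)" using u by (simp add: dist_norm norm_minus_commute)
  finally show False using ns x by (simp add: stationary_point_def edom_Psi)
qed

lemma radius_eq: "2 * Lf * radius Lf \<gamma> \<sigma> \<epsilon> = R / 2" "0 < radius Lf \<gamma> \<sigma> \<epsilon>"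
  using constants \<epsilon> by (simp_all add: radius_def)

text \<open>The invariant of the outer loop. For \<open>k = 0\<close>, nothing is known about the Kurdyka-Lojasiewicz inequality
  at \<open>x\<close>, as the initial point may be \<open>\<epsilon>\<close>-stationary; for \<open>k > 0\<close>, the point \<open>x\<close> was found in a ball
  free of such points.\<close>
definition reached :: "int \<Rightarrow> 'a \<Rightarrow> 'b \<Rightarrow> nat \<Rightarrow> 'a \<times> 'b \<times> nat \<times> nat \<times> nat \<Rightarrow> bool" where
  "reached K x0 y0 k = (\<lambda>(x, y, P, Q, G).
     ipg_run f p q Lf Lg C \<theta> \<gamma> \<sigma> \<epsilon> lam \<rho> x0 y0 k x y P Q G \<and> P = k
     \<and> int Q \<le> int k * ((ceil_plus (ln (2 * Lg * lam) / ln (1 / \<rho>)) + 1) * Kf_bar Lg C \<theta> \<gamma> \<sigma> \<epsilon> lam \<rho> K)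
     \<and> int G \<le> int k * (1 + Kf_bar Lg C \<theta> \<gamma> \<sigma> \<epsilon> lam \<rho> K)
     \<and> x \<in> X \<and> y \<in> Y \<and> gap x y \<le> accuracy k
     \<and> (k = 0 \<longrightarrow> x = x0 \<and> y = y0) \<and> (0 < k \<longrightarrow> KL_at x R))"

lemma reached_step:
  assumes r: "reached K x0 y0 k (x, y, P, Q, G)" and k: "int k < K"
    and ns: "\<not> stationary_point (Psi f p q) (radius Lf \<gamma> \<sigma> \<epsilon>) \<epsilon> x"
  defines "x' \<equiv> x_step f p (radius Lf \<gamma> \<sigma> \<epsilon>) (L_seq Lg C \<theta> k) x y"
  shows "\<exists>y' P' Q' G'. reached K x0 y0 (Suc k) (x', y', P', Q', G')"
proof -
  let ?Kf = "Kf_bar Lg C \<theta> \<gamma> \<sigma> \<epsilon> lam \<rho> K"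
  let ?W = "(ceil_plus (ln (2 * Lg * lam) / ln (1 / \<rho>)) + 1) * ?Kf"
  have x: "x \<in> X" and y: "y \<in> Y" and g: "gap x y \<le> accuracy k"
    and run: "ipg_run f p q Lf Lg C \<theta> \<gamma> \<sigma> \<epsilon> lam \<rho> x0 y0 k x y P Q G" "P = k"
      "int Q \<le> int k * ?W" "int G \<le> int k * (1 + ?Kf)"
    using r by (auto simp: reached_def)
  have Lpos: "0 < L_seq Lg C \<theta> k" using L_seq_bounds(1)[of k] constants by (smt (verit) powr_ge_zero)
  note step = x_step_properties[OF x radius_eq(2) Lpos, of y, folded x'_def]
  have KL: "KL_at x' R" by (rule KL_at_nonstationary[OF step(1) \<epsilon> nonstationary_ball[OF x ns step(2)]])
  have "2 * Lf * norm (x - x') \<le> 2 * Lf * radius Lf \<gamma> \<sigma> \<epsilon>"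
    using step(2) constants by (intro mult_left_mono) (auto simp: norm_minus_commute)
  then have "gap x' y \<le> R"
    using gap_shift[OF x step(1) y] g accuracy_bounds(1)[of k] radius_eq(1) by linarith
  from subroutine_complexity[OF step(1) y this KL k] obtain w N H where w:
    "pg_run (\<lambda>u. - f (x', u)) q lam \<rho> (\<tau> k) y w N H" "w \<in> Y" "int N \<le> ?W" "int H \<le> ?Kf"
    "gap x' w \<le> accuracy (Suc k)" by blast
  have "ipg_run f p q Lf Lg C \<theta> \<gamma> \<sigma> \<epsilon> lam \<rho> x0 y0 (Suc k) x' w (P + 1) (Q + N) (G + 1 + H)"
    using ipg_run.Suc[OF run(1) _ w(1)] by (simp add: x'_def)
  then have "reached K x0 y0 (Suc k) (x', w, P + 1, Q + N, G + 1 + H)"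
    using run(2-) w step(1) KL unfolding reached_def by (simp add: distrib_right)
  then show ?thesis by blast
qed

text \<open>Otherwise the run can be continued up to iterate \<open>K\<close>. Then some \<open>x\<^sub>k\<^sub>+\<^sub>1\<close> with \<open>k < K\<close> is \<open>\<epsilon>\<close>-stationary and
  within the radius of \<open>x\<^sub>k\<close>, contradicting the assumption on \<open>x\<^sub>k\<close>.\<close>
lemma stationary_point_reached:
  assumes x0: "x0 \<in> X" and y0: "y0 \<in> Y" and g0: "gap x0 y0 \<le> min (R / 2) 1" and \<epsilon>e: "\<epsilon> \<le> 1 / exp 1"
    and bd: "Psi_min f p q \<noteq> - \<infinity>"
    and K: "K = K_hat (real_of_ereal (Psi f p q x0 - Psi_min f p q)) Lf Lg C \<theta> \<gamma> \<sigma> \<epsilon>"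
  shows "\<exists>k x y P Q G. int k \<le> K \<and> reached K x0 y0 k (x, y, P, Q, G)
    \<and> stationary_point (Psi f p q) (radius Lf \<gamma> \<sigma> \<epsilon>) \<epsilon> x"
proof (rule ccontr)
  let ?r = "radius Lf \<gamma> \<sigma> \<epsilon>" and ?L = "L_seq Lg C \<theta>"
  assume "\<not> ?thesis"
  then have ns: "\<not> stationary_point (Psi f p q) ?r \<epsilon> x"
    if "int k \<le> K" "reached K x0 y0 k (x, y, P, Q, G)" for k x y P Q G using that by blast
  define next_x where "next_x k s = x_step f p ?r (?L k) (fst s) (fst (snd s))"
    for k and s :: "'a \<times> 'b \<times> nat \<times> nat \<times> nat"
  have "\<exists>s. \<forall>k. (int k \<le> K \<longrightarrow> reached K x0 y0 k (s k)) \<and> (int k < K \<longrightarrow> fst (s (Suc k)) = next_x k (s k))"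
  proof (rule dependent_nat_choice)
    have "reached K x0 y0 0 (x0, y0, 0, 0, 0)"
      using x0 y0 g0 by (auto simp: reached_def accuracy_def eta_def intro: ipg_run.Zero)
    then show "\<exists>s. (int 0 \<le> K \<longrightarrow> reached K x0 y0 0 s)" by blast
  next
    fix s k assume s: "int k \<le> K \<longrightarrow> reached K x0 y0 k s"
    show "\<exists>s'. (int (Suc k) \<le> K \<longrightarrow> reached K x0 y0 (Suc k) s') \<and> (int k < K \<longrightarrow> fst s' = next_x k s)"
    proof (cases "int k < K")
      case True
      obtain x y P Q G where se: "s = (x, y, P, Q, G)" by (cases s)
      have "reached K x0 y0 k (x, y, P, Q, G)" using s True se by simp
      from reached_step[OF this True ns[OF _ this]] True show ?thesis
        by (auto simp: next_x_def se)
    qed auto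
  qed
  then obtain s where s: "\<And>k. int k \<le> K \<Longrightarrow> reached K x0 y0 k (s k)"
    and nx: "\<And>k. int k < K \<Longrightarrow> fst (s (Suc k)) = next_x k (s k)" by blast
  define xs where "xs k = fst (s k)" for k
  define ys where "ys k = fst (snd (s k))" for k
  have state: "xs k \<in> X" "ys k \<in> Y" "gap (xs k) (ys k) \<le> accuracy k"
    "\<not> stationary_point (Psi f p q) ?r \<epsilon> (xs k)" "k = 0 \<longrightarrow> xs k = x0" if "int k \<le> K" for k
  proof -
    obtain x y P Q G where se: "s k = (x, y, P, Q, G)" by (cases "s k")
    show "xs k \<in> X" "ys k \<in> Y" "gap (xs k) (ys k) \<le> accuracy k"
      "\<not> stationary_point (Psi f p q) ?r \<epsilon> (xs k)" "k = 0 \<longrightarrow> xs k = x0"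
      using s[OF that] ns[OF that, of x y P Q G] unfolding se xs_def ys_def by (auto simp: reached_def)
  qed
  have xs_Suc: "xs (Suc k) = x_step f p ?r (?L k) (xs k) (ys k)" if "int k < K" for k
    using nx[OF that] by (simp add: xs_def ys_def next_x_def)
  define D where "D k = norm (xs (Suc k) - xs k)" for k
  define Pv where "Pv k = Fs (xs k) + pr (xs k)" for k
  have step: "Pv (Suc k) \<le> Pv k - ?L k / 4 * (D k)\<^sup>2 + A_const * eta k / ?L k + delta k / 2"
    "D k < ?r \<Longrightarrow> edist 0 (lim_subdiff (Psi f p q) (xs (Suc k)))
        \<le> ereal (?L k * D k + Lg * D k + M * D k powr \<nu> + sqrt (A_const * eta k))"
    if k: "int k < K" for k
  proof -
    have k': "int k \<le> K" using k by simp
    note st = state[OF k']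
    have KL: "KL_at u R" if "u \<in> X" "norm (u - xs k) \<le> ?r" for u
      by (rule KL_at_nonstationary[OF that(1) \<epsilon> nonstationary_ball[OF st(1,4) that(2)]])
    have KLx: "KL_at (xs k) R" using KL st(1) radius_eq(2) by simp
    have "gap (xs k) (ys k) \<le> R" using st(3) accuracy_bounds(1)[of k] R_pos by linarith
    from accuracy_error_bound[OF st(1,2,3) KLx this] obtain u where
      u: "u \<in> Ymax f q (xs k)" "norm (ys k - u)
        \<le> min ((R / 2) powr (1 - \<theta>)) (1 / sqrt (real k + 1)) / (C * (1 - \<theta>))" by blast
    note u(2)
    also have "min ((R / 2) powr (1 - \<theta>)) (1 / sqrt (real k + 1)) / (C * (1 - \<theta>))
        \<le> 1 / sqrt (real k + 1) / (C * (1 - \<theta>))"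
      using constants by (intro divide_right_mono min.cobounded2) auto
    finally have u2: "norm (ys k - u) \<le> 1 / sqrt (real k + 1) / (C * (1 - \<theta>))" .
    have "Lg * norm (ys k - u) \<le> Lg * (1 / sqrt (real k + 1) / (C * (1 - \<theta>)))"
      using u2 constants by (intro mult_left_mono) auto
    also have "\<dots> = sqrt (A_const * eta k)"
      using constants by (simp add: A_const_eq real_sqrt_mult eta_def real_sqrt_divide)
    finally have E: "Lg * norm (ys k - u) \<le> sqrt (A_const * eta k)" .
    have \<delta>: "0 < delta k" by (simp add: delta_def)
    have L: "?L k = Lg + delta k powr ((\<nu> - 1) / (1 + \<nu>)) * M powr (2 / (1 + \<nu>))"
      by (simp add: L_seq_def Let_def)
    have r2: "2 * Lf * ?r \<le> R" using radius_eq(1) R_pos by linarith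
    note ds = descent_step[OF st(1,2) radius_eq(2) r2 KL u(1) E \<delta> L, folded xs_Suc[OF k] D_def]
    have "0 \<le> A_const * eta k" using eta_pos[of k] by (simp add: A_const_eq)
    then show "Pv (Suc k) \<le> Pv k - ?L k / 4 * (D k)\<^sup>2 + A_const * eta k / ?L k + delta k / 2"
      using ds(1) by (simp add: Pv_def)
    show "D k < ?r \<Longrightarrow> edist 0 (lim_subdiff (Psi f p q) (xs (Suc k)))
        \<le> ereal (?L k * D k + Lg * D k + M * D k powr \<nu> + sqrt (A_const * eta k))"
      by (rule ds(2))
  qed
  have Pmin: "Psi_min f p q \<le> ereal (Fs x + pr x)" if "x \<in> X" for x
    using Psi_real[OF that] unfolding Psi_min_def by (metis INF_lower UNIV_I)
  obtain m where m: "Psi_min f p q = ereal m"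
    using bd Pmin[OF x0] by (cases "Psi_min f p q") auto
  define \<Delta> where "\<Delta> = real_of_ereal (Psi f p q x0 - Psi_min f p q)"
  have \<Delta>: "\<Delta> = Fs x0 + pr x0 - m" by (simp add: \<Delta>_def m Psi_real[OF x0])
  have \<Delta>0: "0 \<le> \<Delta>" using Pmin[OF x0] by (simp add: \<Delta> m)
  note KS = K_hat_suffices[OF \<epsilon> \<epsilon>e \<Delta>0 K[folded \<Delta>_def]]
  have K1: "1 \<le> K" by (rule KS(1))
  have "Pv 0 - Pv (nat K) \<le> \<Delta>"
    using Pmin[OF state(1)[of "nat K"]] state(5)[of 0] K1 by (simp add: m \<Delta> Pv_def)
  moreover have "0 \<le> D k" for k by (simp add: D_def)
  moreover have "Pv (Suc k) \<le> Pv k - ?L k / 4 * (D k)\<^sup>2 + A_const * eta k / ?L k + delta k / 2"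
    if "k < nat K" for k using step(1)[of k] that by linarith
  ultimately obtain k where k: "k < nat K" "D k < ?r"
    "?L k * D k + Lg * D k + M * D k powr \<nu> + sqrt (A_const * eta k) \<le> \<epsilon>"
    using KS(2)[of D Pv] by blast
  have kK: "int k < K" using k(1) by linarith
  have "edist 0 (lim_subdiff (Psi f p q) (xs (Suc k))) \<le> ereal \<epsilon>"
    using step(2)[OF kK k(2)] k(3) by (meson ereal_less_eq(3) order_trans)
  moreover have "\<not> edist 0 (lim_subdiff (Psi f p q) (xs (Suc k))) \<le> ereal \<epsilon>"
    using k(2) kK by (intro nonstationary_ball[of "xs k"] state) (auto simp: D_def)
  ultimately show False by simp
qed

end

end

end

theorem theorem5:
  fixes f :: "(real ^ 'n) \<times> (real ^ 'm) \<Rightarrow> real"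
    and p :: "real ^ 'n \<Rightarrow> ereal" and q :: "real ^ 'm \<Rightarrow> ereal"
    and Lf Lg C \<theta> \<gamma> \<sigma> \<epsilon> lam \<rho> :: real
    and x0 :: "real ^ 'n" and y0 :: "real ^ 'm"
    and K N :: int
  assumes "standing_assumption f p q Lf Lg C \<theta> \<gamma> \<sigma>"
    and "Psi_min f p q \<noteq> -\<infinity>"
    and "0 < \<epsilon>" and "\<epsilon> \<le> 1 / exp 1"
    and "0 < lam" and "0 < \<rho>" and "\<rho> < 1"
    and "x0 \<in> edom p" and "y0 \<in> edom q"
    and "Fmax f q x0 - Fobj f q x0 y0 \<le> ereal (min (\<gamma> * \<epsilon> powr \<sigma> / 2) 1)"
    and K_eq: "K = K_hat (real_of_ereal (Psi f p q x0 - Psi_min f p q)) Lf Lg C \<theta> \<gamma> \<sigma> \<epsilon>"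
    and N_eq: "N = N_hat Lg C \<theta> \<gamma> \<sigma> \<epsilon> lam \<rho> K"
  shows "\<exists>k x y P Q G.
      ipg_run f p q Lf Lg C \<theta> \<gamma> \<sigma> \<epsilon> lam \<rho> x0 y0 k x y P Q G \<and>
      int P \<le> K \<and> int Q \<le> N \<and> int G \<le> K + N \<and>
      stationary_point (Psi f p q) (\<gamma> * \<epsilon> powr \<sigma> / (4 * Lf)) \<epsilon> x \<and>
      Fmax f q x - Fobj f q x y \<le> ereal (min (\<gamma> * \<epsilon> powr \<sigma> / 2) (1 / (real k + 1))) \<and>
      (0 < k \<or> y0 \<in> KL_region f p q \<gamma> \<sigma> x0 \<union> Ymax f q x0 \<longrightarrow>
       edist y (Ymax f q x) \<le>
         ereal (1 / (C * (1 - \<theta>)) *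
           min ((\<gamma> / 2) powr (1 - \<theta>) * \<epsilon> powr (\<sigma> * (1 - \<theta>))) (1 / sqrt (real k + 1))))"
proof -
  interpret minimax_problem f p q Lf Lg C \<theta> \<gamma> \<sigma>
    by unfold_locales (rule assms(1))
  let ?Kf = "Kf_bar Lg C \<theta> \<gamma> \<sigma> \<epsilon> lam \<rho> K"
  let ?I = "ceil_plus (ln (2 * Lg * lam) / ln (1 / \<rho>))"
  note par = assms(5-7,3)
  have g0: "gap x0 y0 \<le> min (\<gamma> * \<epsilon> powr \<sigma> / 2) 1"
    using assms(10) by (simp add: gap_ereal[OF assms(8,9)])
  obtain k x y P Q G where kK: "int k \<le> K" and r: "reached lam \<rho> \<epsilon> K x0 y0 k (x, y, P, Q, G)"
    and stat: "stationary_point (Psi f p q) (radius Lf \<gamma> \<sigma> \<epsilon>) \<epsilon> x"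
    using stationary_point_reached[OF par assms(8,9) g0 assms(4,2) K_eq] by blast
  note r = r[unfolded reached_def[OF par] prod.case]
  have x: "x \<in> X" and y: "y \<in> Y" and g: "gap x y \<le> accuracy \<epsilon> k" using r by auto
  have Kf: "1 \<le> ?Kf" by (rule Kf_bar_ge_1[OF par])
  have I: "0 \<le> ?I" by (simp add: ceil_plus_def)
  have N: "N = K * ((?I + 1) * ?Kf)" by (simp add: N_eq N_hat_def)
  have "int Q \<le> int k * ((?I + 1) * ?Kf)" using r by blast
  also have "\<dots> \<le> N" unfolding N using kK Kf I by (intro mult_right_mono) auto
  finally have Q: "int Q \<le> N" .
  have "int G \<le> int k * (1 + ?Kf)" using r by blast
  also have "\<dots> \<le> K * (1 + ?Kf)" using kK Kf by (intro mult_right_mono) auto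
  also have "\<dots> = K + K * (1 * ?Kf)" by (simp add: distrib_left)
  also have "\<dots> \<le> K + N" unfolding N using kK Kf I by (intro add_left_mono mult_left_mono mult_right_mono) auto
  finally have G: "int G \<le> K + N" .
  have gap: "Fmax f q x - Fobj f q x y \<le> ereal (min (\<gamma> * \<epsilon> powr \<sigma> / 2) (1 / (real k + 1)))"
    using g accuracy_bounds[OF par, of k] by (simp add: gap_ereal[OF x y])
  have dist: "edist y (Ymax f q x) \<le> ereal (1 / (C * (1 - \<theta>)) *
           min ((\<gamma> / 2) powr (1 - \<theta>) * \<epsilon> powr (\<sigma> * (1 - \<theta>))) (1 / sqrt (real k + 1)))"
    if init: "0 < k \<or> y0 \<in> KL_region f p q \<gamma> \<sigma> x0 \<union> Ymax f q x0"
  proof -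
    have "\<exists>R'. KL_at x R' \<and> gap x y \<le> R'"
    proof (cases "0 < k")
      case True
      then have "KL_at x (\<gamma> * \<epsilon> powr \<sigma>)" using r by blast
      moreover have "gap x y \<le> \<gamma> * \<epsilon> powr \<sigma>"
        using g accuracy_bounds(1)[OF par, of k] R_pos[OF par] by linarith
      ultimately show ?thesis by blast
    next
      case False
      then have xy: "x = x0" "y = y0" using r by auto
      then consider "y \<in> KL_region f p q \<gamma> \<sigma> x" | "y \<in> Ymax f q x" using init False by auto
      then show ?thesis
      proof cases
        case 1
        then show ?thesis using KL_at_region[OF x _ y] by blast
      next
        case 2
        then have "gap x y = 0" using Ymax_D x by blast
        moreover have "KL_at x 0" by (simp add: KL_at_def)
        ultimately show ?thesis by (intro exI[of _ 0]) simp
      qed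
    qed
    then obtain R' where R': "KL_at x R'" "gap x y \<le> R'" by blast
    obtain u where u: "u \<in> Ymax f q x"
      "norm (y - u) \<le> min ((\<gamma> * \<epsilon> powr \<sigma> / 2) powr (1 - \<theta>)) (1 / sqrt (real k + 1)) / (C * (1 - \<theta>))"
      using accuracy_error_bound[OF par x y g R'] by blast
    have "(\<gamma> * \<epsilon> powr \<sigma> / 2) powr (1 - \<theta>) = (\<gamma> / 2) powr (1 - \<theta>) * \<epsilon> powr (\<sigma> * (1 - \<theta>))"
      using constants by (simp add: powr_mult powr_divide powr_powr)
    moreover have "edist y (Ymax f q x) \<le> ereal (dist y u)"
      unfolding edist_def by (rule INF_lower[OF u(1)])
    ultimately show ?thesis using u(2) by (simp add: dist_norm) (metis ereal_less_eq(3) order_trans)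
  qed
  show ?thesis
    using r kK Q G stat[unfolded radius_def] gap dist
    by (intro exI[of _ k] exI[of _ x] exI[of _ y] exI[of _ P] exI[of _ Q] exI[of _ G]) auto
qed

end
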